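(* Fix $s\in(0,1)$. Let $\gamma>0$ and let $f\in\dot L^2(\mathbb T)$ be real valued. Consider the forced and weakly damped KdV equation $$u_t+u_{xxx}+\gamma u+uu_x=f$$ on $\mathbb T\times\mathbb R$ (that is, $x\in\mathbb T$, $t\in\mathbb R$), with real-valued initial data $u(x,0)=u_0(x)\in\dot L^2(\mathbb T)$. Then $$u(t)-e^{-\gamma t}e^{tL}u_0\in C^0_tH^s_x$$ and $$\|u(t)-e^{-\gamma t}e^{tL}u_0\|_{H^s}\le C(s,\gamma,\|u_0\|,\|f\|),$$ where $L=-\partial_x^3$.
   Context: $\mathbb T=\mathbb R/2\pi\mathbb Z$; $\dot L^2(\mathbb T)=\{g\in L^2(\mathbb T):\int_{\mathbb T}g\,dx=0\}$; $\|\cdot\|=\|\cdot\|_{L^2(\mathbb T)}$. The forcing $f$ is independent of time. $C(s,\gamma,\|u_0\|,\|f\|)$ denotes a constant depending only on the indicated quantities. $C^0_tH^s_x$ denotes functions continuous in time with values in $H^s(\mathbb T)$. Fourier coefficients are $g_k=\frac1{2\pi}\int_0^{2\pi}g(x)e^{-ikx}dx$, and for mean-zero $g$, $\|g\|_{H^s}\approx\||k|^sg_k\|_{\ell^2}$. With $L=-\partial_x^3$, $e^{tL}$ is the Fourier multiplier $(e^{tL}g)_k=e^{ik^3t}g_k$. Solution: for $u_0\in\dot L^2$, the equation is locally and globally well-posed in $L^2$, and $u$ denotes the unique solution, continuous in time with values in $\dot L^2(\mathbb T)$, such that every time $t_0$ has a $\delta>0$ for which $u$ coincides on $[t_0-\delta,t_0+\delta]$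 with an element of $Y^0$. Here, with $\langle\cdot\rangle=1+|\cdot|$ and $\widehat u(k,\tau)$ the space-time Fourier transform ($k\in\mathbb Z$, $\tau\in\mathbb R$; $dk$ is counting measure), $$\|u\|_{Y^0}=\|\langle\tau-k^3\rangle^{1/2}\widehat u(k,\tau)\|_{L^2(dk\,d\tau)}+\|\widehat u(k,\tau)\|_{L^2(dk)L^1(d\tau)}.$$
   Formalization: The H^s bound is stated for t ≥ 0 only; for t → −∞ it is false (f = v_xxx + γv + v v_x with v = A cos x, 0 < A < 2γ, u_0 = 0 gives an unbounded solution). Continuity in H^s is for all real t. *)

theory Defs
  imports "HOL-Analysis.Analysis"
begin

text \<open>
  A function on the torus \<open>\<real> / 2\<pi>\<int>\<close> is a \<open>2\<pi>\<close>-periodic function on the real line; elements of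
  \<open>L\<^sup>2\<close> are given by Borel representatives, and equality in \<open>L\<^sup>2\<close> is equality almost everywhere.
  All functions are real valued.
\<close>

definition periodic_2pi :: "(real \<Rightarrow> real) \<Rightarrow> bool" where
  "periodic_2pi g \<longleftrightarrow> (\<forall>x. g (x + 2 * pi) = g x)"

definition L2_torus :: "(real \<Rightarrow> real) \<Rightarrow> bool" where
  "L2_torus g \<longleftrightarrow> periodic_2pi g \<and> g \<in> borel_measurable borel \<and>
     set_integrable lborel {0..2 * pi} (\<lambda>x. (g x)\<^sup>2)"

definition L2_mean_zero :: "(real \<Rightarrow> real) \<Rightarrow> bool" where
  "L2_mean_zero g \<longleftrightarrow> L2_torus g \<and> (LINT x:{0..2 * pi}|lborel. g x) = 0"

definition L2_norm :: "(real \<Rightarrow> real) \<Rightarrow> real" where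
  "L2_norm g = sqrt (LINT x:{0..2 * pi}|lborel. (g x)\<^sup>2)"

definition fourier_coeff :: "(real \<Rightarrow> real) \<Rightarrow> int \<Rightarrow> complex" where
  "fourier_coeff g k =
     (1 / (2 * pi)) *\<^sub>R (LINT x:{0..2 * pi}|lborel. of_real (g x) * cis (- (of_int k * x)))"

text \<open>
  \<open>H\<^sup>s\<close> is used for mean-zero functions and \<open>s > 0\<close> only, with the norm \<open>\<parallel>|k|\<^sup>s g\<^sub>k\<parallel>\<close> in \<open>\<ell>\<^sup>2\<close>.
\<close>

definition Hs_mean_zero :: "real \<Rightarrow> (real \<Rightarrow> real) \<Rightarrow> bool" where
  "Hs_mean_zero s g \<longleftrightarrow> L2_mean_zero g \<and>
     (\<lambda>k::int. (\<bar>of_int k\<bar> powr s * cmod (fourier_coeff g k))\<^sup>2) summable_on UNIV"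

definition Hs_norm :: "real \<Rightarrow> (real \<Rightarrow> real) \<Rightarrow> real" where
  "Hs_norm s g =
     sqrt (\<Sum>\<^sub>\<infinity>k::int. (\<bar>of_int k\<bar> powr s * cmod (fourier_coeff g k))\<^sup>2)"

definition continuous_in_time :: "((real \<Rightarrow> real) \<Rightarrow> real) \<Rightarrow> (real \<Rightarrow> real \<Rightarrow> real) \<Rightarrow> bool" where
  "continuous_in_time N v \<longleftrightarrow> (\<forall>t. ((\<lambda>r. N (\<lambda>x. v r x - v t x)) \<longlongrightarrow> 0) (at t))"

text \<open>
  The Fourier multiplier \<open>e\<^sup>t\<^sup>L\<close>, \<open>L = - \<partial>\<^sub>x\<^sup>3\<close>. For \<open>g\<close> in \<open>L\<^sup>2\<close> a real function with the prescribed
  coefficients exists (the symbol is unimodular and its values at \<open>k\<close> and \<open>-k\<close> are conjugate) and is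
  unique up to a null set; the choice operator picks a representative.
\<close>

definition airy_flow :: "real \<Rightarrow> (real \<Rightarrow> real) \<Rightarrow> real \<Rightarrow> real" where
  "airy_flow t g =
     (SOME h. L2_torus h \<and> (\<forall>k. fourier_coeff h k = cis (of_int (k ^ 3) * t) * fourier_coeff g k))"

text \<open>
  Space-time functions are written \<open>U t x\<close>. That \<open>w\<close> is the space-time Fourier transform of \<open>U\<close> is
  expressed by Fourier inversion in time: a function in \<open>Y\<^sup>0\<close> need not be integrable in time, whereas
  each \<open>w k\<close> is integrable in \<open>\<tau>\<close> by the second part of the \<open>Y\<^sup>0\<close> norm. The normalisation is
  \<open>w k \<tau> = (2\<pi>)\<^sup>-\<^sup>1 \<integral> U\<^sub>k(t) e\<^sup>-\<^sup>i\<^sup>\<tau>\<^sup>t dt\<close>.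
\<close>

definition has_spacetime_fourier :: "(real \<Rightarrow> real \<Rightarrow> real) \<Rightarrow> (int \<Rightarrow> real \<Rightarrow> complex) \<Rightarrow> bool" where
  "has_spacetime_fourier U w \<longleftrightarrow>
     (\<forall>k. integrable lborel (w k)) \<and>
     (\<forall>k t. fourier_coeff (U t) k = (LINT \<tau>|lborel. w k \<tau> * cis (\<tau> * t)))"

text \<open>
  The two conditions on \<open>w\<close> say that the squares of the two summands of the \<open>Y\<^sup>0\<close> norm are finite.
  The modes \<open>k\<close> carry counting measure.
\<close>

definition in_Y0 :: "(real \<Rightarrow> real \<Rightarrow> real) \<Rightarrow> bool" where
  "in_Y0 U \<longleftrightarrow> (\<forall>t. L2_torus (U t)) \<and>
     (\<exists>w. has_spacetime_fourier U w \<and>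
        (\<integral>\<^sup>+k. (\<integral>\<^sup>+\<tau>. ennreal (((1 + \<bar>\<tau> - of_int (k ^ 3)\<bar>) powr (1/2) * cmod (w k \<tau>))\<^sup>2) \<partial>lborel)
           \<partial>count_space (UNIV :: int set)) < \<infinity> \<and>
        (\<integral>\<^sup>+k. (\<integral>\<^sup>+\<tau>. ennreal (cmod (w k \<tau>)) \<partial>lborel)\<^sup>2 \<partial>count_space (UNIV :: int set)) < \<infinity>)"

definition locally_Y0 :: "(real \<Rightarrow> real \<Rightarrow> real) \<Rightarrow> bool" where
  "locally_Y0 u \<longleftrightarrow>
     (\<forall>t0. \<exists>\<delta>>0. \<exists>U. in_Y0 U \<and> (\<forall>t\<in>{t0 - \<delta>..t0 + \<delta>}. AE x in lborel. u t x = U t x))"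

definition test_function :: "(real \<Rightarrow> real) \<Rightarrow> bool" where
  "test_function \<phi> \<longleftrightarrow> periodic_2pi \<phi> \<and> (\<forall>n x. (deriv ^^ n) \<phi> differentiable (at x))"

text \<open>
  \<open>u\<^sub>t + u\<^sub>x\<^sub>x\<^sub>x + \<gamma> u + u u\<^sub>x = f\<close> in the sense of distributions, with \<open>u u\<^sub>x = (u\<^sup>2 / 2)\<^sub>x\<close>. For \<open>u\<close>
  continuous in time with values in \<open>L\<^sup>2\<close> the right-hand side below is continuous in \<open>t\<close>, so the time
  derivative may be taken classically after pairing with test functions of \<open>x\<close>.
\<close>

definition weak_kdv :: "real \<Rightarrow> (real \<Rightarrow> real) \<Rightarrow> (real \<Rightarrow> real \<Rightarrow> real) \<Rightarrow> bool" where
  "weak_kdv \<gamma> f u \<longleftrightarrow>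
     (\<forall>\<phi> t. test_function \<phi> \<longrightarrow>
        ((\<lambda>r. LINT x:{0..2 * pi}|lborel. u r x * \<phi> x) has_real_derivative
           (LINT x:{0..2 * pi}|lborel.
              u t x * (deriv ^^ 3) \<phi> x - \<gamma> * u t x * \<phi> x + (u t x)\<^sup>2 / 2 * deriv \<phi> x + f x * \<phi> x))
        (at t))"

definition kdv_solution ::
  "real \<Rightarrow> (real \<Rightarrow> real) \<Rightarrow> (real \<Rightarrow> real) \<Rightarrow> (real \<Rightarrow> real \<Rightarrow> real) \<Rightarrow> bool" where
  "kdv_solution \<gamma> f u0 u \<longleftrightarrow>
     (\<forall>t. L2_mean_zero (u t)) \<and> continuous_in_time L2_norm u \<and> locally_Y0 u \<and>
     weak_kdv \<gamma> f u \<and> (AE x in lborel. u 0 x = u0 x)"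

end

theory Submission
  imports Defs
begin

text \<open>
  Write \<open>v\<^sub>k(t) = e\<^sup>-\<^sup>i\<^sup>k\<^sup>3\<^sup>t u\<^sub>k(t)\<close>. The phase of the interaction \<open>k = p + q\<close> is \<open>3kpq\<close>, never zero, so
  the nonlinearity can be differentiated by parts in time. This yields a bilinear boundary term, a
  trilinear resonant term \<open>|v\<^sub>k|\<^sup>2 v\<^sub>k / k\<close> (the other resonances cancel by oddness), and a nonresonant
  trilinear term with phase \<open>3(p+q)(k-p)(k-q)\<close>, which is differentiated by parts once more. In the
  remaining quadrilinear term one pair of factors is kept together as a Fourier coefficient \<open>w\<^sub>j\<close> of \<open>u\<^sup>2\<close>.

  With only \<open>|w\<^sub>j| \<le> \<parallel>u\<parallel>\<^sup>2\<close> the terms are \<open>O(1/k)\<close>. Hence \<open>u\<close> is a free wave, which is in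
  \<open>L\<^sup>4\<^sub>t\<^sub>x\<close> by orthogonality in time, plus a function with coefficients \<open>O(1/k)\<close>, which is in \<open>L\<^sup>4\<^sub>x\<close>; so \<open>w\<close> is in
  \<open>L\<^sup>2\<^sub>t \<ell>\<^sup>2\<close>. With this the same terms are bounded in \<open>H\<^sup>1\<close> by the Cauchy-Schwarz inequality. It also makes
  the energy flux through frequency \<open>N\<close> (differentiated by parts) vanish as \<open>N \<rightarrow> \<infinity>\<close>, which gives
  \<open>\<parallel>u(t)\<parallel>\<^sup>2 \<le> \<parallel>u\<^sub>0\<parallel>\<^sup>2 + \<parallel>f\<parallel>\<^sup>2 / \<gamma>\<^sup>2\<close> and uniformity in time. Continuity in \<open>H\<^sup>s\<close> for \<open>s < 1\<close> follows by
  interpolation.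
\<close>

section \<open>Sums over square-summable modes\<close>

text \<open>Infinite convolutions are never differentiated termwise. Each differentiation by parts
  is done exactly on the finite sets \<open>modes N\<close>; the only defect is
  \<open>w - quad\<close>, bounded by the l^2 tail of v times a factor depending on k but not on N.
  For fixed k it disappears as N tends to infinity, after integration in time, by dominated
  convergence. Every other constant must therefore be free of N, and \<open>l2le\<close>, which
  bounds all finite sums of squares at once, is the form in which l^2 bounds are passed on. The
  damping yields the kernel exp(-\<gamma>(t-r)) of mass at most 1/\<gamma>; time integrals are taken
  against it, so bounds do not grow with t. The mass bound M has two roles. Continuity of the mass
  gives some M on each compact interval; with it the energy inequality is proved, and M drops out of
  the conclusion. Only then is M replaced by a quantity depending on the data. The initial time a
  stays free because the formulas run forward in time: negative times are reached from a =
  -T.\<close>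

definition l2le :: "(int \<Rightarrow> real) \<Rightarrow> real \<Rightarrow> bool" where
  "l2le \<alpha> M \<longleftrightarrow> (\<forall>F. finite F \<longrightarrow> (\<Sum>k\<in>F. (\<alpha> k)\<^sup>2) \<le> M)"

lemma l2leD: "l2le \<alpha> M \<Longrightarrow> finite F \<Longrightarrow> (\<Sum>k\<in>F. (\<alpha> k)\<^sup>2) \<le> M"
  by (simp add: l2le_def)

lemma l2le_nonneg: "l2le \<alpha> M \<Longrightarrow> 0 \<le> M"
  using l2leD[of \<alpha> M "{}"] by simp

lemma l2le_pointwise: "l2le \<alpha> M \<Longrightarrow> (\<alpha> k)\<^sup>2 \<le> M"
  using l2leD[of \<alpha> M "{k}"] by simp

lemma l2le_mono: "l2le \<beta> M \<Longrightarrow> (\<And>k. \<bar>\<alpha> k\<bar> \<le> \<bar>\<beta> k\<bar>) \<Longrightarrow> M \<le> M' \<Longrightarrow> l2le \<alpha> M'"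
  unfolding l2le_def
  by (intro allI impI, rule order_trans[OF sum_mono[of _ "\<lambda>k. (\<alpha> k)\<^sup>2" "\<lambda>k. (\<beta> k)\<^sup>2"]])
     (auto simp: abs_le_square_iff intro: order_trans)

lemma square_sum_le: "((x::real) + y)\<^sup>2 \<le> 2 * x\<^sup>2 + 2 * y\<^sup>2"
  using sum_squares_bound[of x y] by (simp add: power2_sum)

lemma finite_int_bounded:
  assumes "finite F"
  obtains N :: nat where "F \<subseteq> {- int N..int N}"
proof
  show "F \<subseteq> {- int (nat (Max (insert 0 (abs ` F))))..int (nat (Max (insert 0 (abs ` F))))}"
  proof
    fix x assume "x \<in> F"
    then have "\<bar>x\<bar> \<le> Max (insert 0 (abs ` F))" using assms by (intro Max_ge) auto
    then show "x \<in> {- int (nat (Max (insert 0 (abs ` F))))..int (nat (Max (insert 0 (abs ` F))))}" by auto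
  qed
qed

lemma l2le_uminus:
  assumes "l2le \<alpha> M"
  shows "l2le (\<lambda>k. \<alpha> (- k)) M"
  unfolding l2le_def
proof (intro allI impI)
  fix F :: "int set" assume "finite F"
  then have "(\<Sum>k\<in>uminus ` F. (\<alpha> k)\<^sup>2) \<le> M" by (intro l2leD[OF assms]) auto
  then show "(\<Sum>k\<in>F. (\<alpha> (- k))\<^sup>2) \<le> M" by (subst (asm) sum.reindex) auto
qed

lemma l2le_add:
  assumes "l2le \<alpha> M" "l2le \<beta> N"
  shows "l2le (\<lambda>k. \<alpha> k + \<beta> k) (2 * M + 2 * N)"
  unfolding l2le_def
proof (intro allI impI)
  fix F :: "int set" assume F: "finite F"
  have "(\<Sum>k\<in>F. (\<alpha> k + \<beta> k)\<^sup>2) \<le> (\<Sum>k\<in>F. 2 * (\<alpha> k)\<^sup>2 + 2 * (\<beta> k)\<^sup>2)"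
    by (intro sum_mono square_sum_le)
  also have "\<dots> = 2 * (\<Sum>k\<in>F. (\<alpha> k)\<^sup>2) + 2 * (\<Sum>k\<in>F. (\<beta> k)\<^sup>2)"
    by (simp add: sum.distrib sum_distrib_left)
  also have "\<dots> \<le> 2 * M + 2 * N"
    using l2leD[OF assms(1) F] l2leD[OF assms(2) F] by simp
  finally show "(\<Sum>k\<in>F. (\<alpha> k + \<beta> k)\<^sup>2) \<le> 2 * M + 2 * N" .
qed

text \<open>Telescoping with 1/(n+1)^2 <= 1/n - 1/(n+1); the term -1/N makes the induction close. At
  N = 0 the convention 1/0 = 0 leaves the true bound 2.\<close>

lemma sum_inverse_squares_nat: "(\<Sum>n=1..N. 1 / (real n)\<^sup>2) \<le> 2 - 1 / real N"
proof (induction N)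
  case (Suc N)
  have "1 / (real (Suc N))\<^sup>2 \<le> 1 / real N - 1 / real (Suc N)" if "N > 0"
    using that by (simp add: divide_simps power2_eq_square)
  then show ?case using Suc by (cases "N = 0") auto
qed simp

text \<open>Twice the bound 2 for the positive integers. The mode 0 contributes nothing because 1/0
  = 0, so sums over arbitrary sets of integers may be bounded by it.\<close>

lemma l2le_inverse: "l2le (\<lambda>n. 1 / of_int n) 4"
  unfolding l2le_def
proof (intro allI impI)
  fix F :: "int set" assume F: "finite F"
  obtain N where sub: "F \<subseteq> {-int N..int N}" using finite_int_bounded[OF F] .
  have split: "{-int N..int N} = insert 0 (int ` {1..N} \<union> (\<lambda>n. - int n) ` {1..N})"
  proof (intro equalityI subsetI)
    fix x assume x: "x \<in> {-int N..int N}"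
    show "x \<in> insert 0 (int ` {1..N} \<union> (\<lambda>n. - int n) ` {1..N})"
    proof (cases x "0::int" rule: linorder_cases)
      case less
      then have "x = - int (nat (-x))" "nat (-x) \<in> {1..N}" using x by auto
      then show ?thesis by blast
    next
      case greater
      then have "x = int (nat x)" "nat x \<in> {1..N}" using x by auto
      then show ?thesis by blast
    qed auto
  qed auto
  have "(\<Sum>k\<in>F. (1 / real_of_int k)\<^sup>2) \<le> (\<Sum>k\<in>{-int N..int N}. (1 / real_of_int k)\<^sup>2)"
    by (rule sum_mono2) (use sub in auto)
  also have "\<dots> = (\<Sum>k\<in>int ` {1..N} \<union> (\<lambda>n. - int n) ` {1..N}. (1 / real_of_int k)\<^sup>2)"
    unfolding split by (subst sum.insert) auto
  also have "\<dots> = (\<Sum>k\<in>int ` {1..N}. (1 / real_of_int k)\<^sup>2) + (\<Sum>k\<in>(\<lambda>n. - int n) ` {1..N}. (1 / real_of_int k)\<^sup>2)"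
    by (rule sum.union_disjoint) auto
  also have "\<dots> = 2 * (\<Sum>n=1..N. 1 / (real n)\<^sup>2)"
    by (subst sum.reindex, force simp: inj_on_def)+ (simp add: power_divide)
  also have "\<dots> \<le> 4" using sum_inverse_squares_nat[of N] by (smt (verit) divide_nonneg_nonneg of_nat_0_le_iff)
  finally show "(\<Sum>k\<in>F. (1 / real_of_int k)\<^sup>2) \<le> 4" .
qed

text \<open>Injectivity of z -> (x z, y z) says that the two arguments are independent coordinates
  on T; T then embeds into a product of finite sets, over which the nonnegative sum
  factorises.\<close>

lemma sum_prod2_le:
  fixes x y :: "'a \<Rightarrow> int"
  assumes \<alpha>: "l2le \<alpha> M" and \<beta>: "l2le \<beta> N" and T: "finite T" and inj: "inj_on (\<lambda>z. (x z, y z)) T"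
  shows "(\<Sum>z\<in>T. (\<alpha> (x z) * \<beta> (y z))\<^sup>2) \<le> M * N"
proof -
  have "(\<Sum>z\<in>T. (\<alpha> (x z) * \<beta> (y z))\<^sup>2) = (\<Sum>(i,j)\<in>(\<lambda>z. (x z, y z)) ` T. (\<alpha> i)\<^sup>2 * (\<beta> j)\<^sup>2)"
    by (subst sum.reindex[OF inj]) (simp add: power_mult_distrib)
  also have "\<dots> \<le> (\<Sum>(i,j)\<in>x ` T \<times> y ` T. (\<alpha> i)\<^sup>2 * (\<beta> j)\<^sup>2)"
    by (rule sum_mono2) (use T in auto)
  also have "\<dots> = (\<Sum>i\<in>x ` T. (\<alpha> i)\<^sup>2) * (\<Sum>j\<in>y ` T. (\<beta> j)\<^sup>2)"
    by (simp add: sum_product sum.cartesian_product)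
  also have "\<dots> \<le> M * N"
    by (intro mult_mono l2leD[OF \<alpha>] l2leD[OF \<beta>] sum_nonneg l2le_nonneg[OF \<alpha>]) (use T in auto)
  finally show ?thesis .
qed

lemma sum_prod3_le:
  fixes x y m :: "'a \<Rightarrow> int"
  assumes \<alpha>: "l2le \<alpha> M" and \<beta>: "l2le \<beta> N" and \<delta>: "l2le \<delta> L" and T: "finite T"
    and inj: "inj_on (\<lambda>z. (x z, y z, m z)) T"
  shows "(\<Sum>z\<in>T. (\<alpha> (x z) * \<beta> (y z) * \<delta> (m z))\<^sup>2) \<le> M * N * L"
proof -
  have "(\<Sum>z\<in>T. (\<alpha> (x z) * \<beta> (y z) * \<delta> (m z))\<^sup>2) =
      (\<Sum>(i,j,l)\<in>(\<lambda>z. (x z, y z, m z)) ` T. (\<alpha> i)\<^sup>2 * ((\<beta> j)\<^sup>2 * (\<delta> l)\<^sup>2))"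
    by (subst sum.reindex[OF inj]) (simp add: power_mult_distrib mult.assoc)
  also have "\<dots> \<le> (\<Sum>(i,j,l)\<in>x ` T \<times> y ` T \<times> m ` T. (\<alpha> i)\<^sup>2 * ((\<beta> j)\<^sup>2 * (\<delta> l)\<^sup>2))"
    by (rule sum_mono2) (use T in auto)
  also have "\<dots> = (\<Sum>i\<in>x ` T. (\<alpha> i)\<^sup>2) * ((\<Sum>j\<in>y ` T. (\<beta> j)\<^sup>2) * (\<Sum>l\<in>m ` T. (\<delta> l)\<^sup>2))"
    unfolding sum_product sum.cartesian_product by (simp add: sum_distrib_left split_def)
  also have "\<dots> \<le> M * (N * L)"
    by (intro mult_mono l2leD[OF \<alpha>] l2leD[OF \<beta>] l2leD[OF \<delta>] sum_nonneg mult_nonneg_nonneg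
          l2le_nonneg[OF \<alpha>] l2le_nonneg[OF \<beta>]) (use T in auto)
  finally show ?thesis by (simp add: mult.assoc)
qed

text \<open>Cauchy-Schwarz in p for each k, with the kernel square summable uniformly in k; what
  remains is a double sum in the independent coordinates p and k - p.\<close>

lemma bilinear_l2_bound:
  fixes ker :: "int \<Rightarrow> int \<Rightarrow> real"
  assumes \<alpha>: "l2le \<alpha> M" and \<beta>: "l2le \<beta> N" and K: "finite K" and S: "\<And>k. k \<in> K \<Longrightarrow> finite (S k)"
    and ker: "\<And>k. k \<in> K \<Longrightarrow> (\<Sum>p\<in>S k. (ker k p)\<^sup>2) \<le> c" and c: "0 \<le> c"
  shows "(\<Sum>k\<in>K. (\<Sum>p\<in>S k. ker k p * (\<alpha> p * \<beta> (k - p)))\<^sup>2) \<le> c * (M * N)"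
proof -
  have "(\<Sum>k\<in>K. (\<Sum>p\<in>S k. ker k p * (\<alpha> p * \<beta> (k - p)))\<^sup>2)
      \<le> (\<Sum>k\<in>K. c * (\<Sum>p\<in>S k. (\<alpha> p * \<beta> (k - p))\<^sup>2))"
    by (intro sum_mono order_trans[OF Cauchy_Schwarz_ineq_sum] mult_right_mono ker sum_nonneg) auto
  also have "\<dots> = c * (\<Sum>(k,p)\<in>Sigma K S. (\<alpha> p * \<beta> (k - p))\<^sup>2)"
    by (simp add: sum_distrib_left[symmetric] sum.Sigma K S)
  also have "\<dots> \<le> c * (M * N)"
    using sum_prod2_le[OF \<alpha> \<beta>, of "Sigma K S" snd "\<lambda>z. fst z - snd z"] K S c
    by (intro mult_left_mono) (auto simp: split_def inj_on_def)
  finally show ?thesis .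
qed

text \<open>The same scheme with (k, p, q) -> (p, q, k - p - q) injective. It takes all three
  factors in l^2; where one of them is merely bounded, the pointwise kernel bounds below replace it,
  at the cost of summability in k.\<close>

lemma trilinear_l2_bound:
  fixes ker :: "int \<Rightarrow> int \<times> int \<Rightarrow> real"
  assumes \<alpha>: "l2le \<alpha> M" and \<beta>: "l2le \<beta> N" and \<delta>: "l2le \<delta> L" and K: "finite K"
    and T: "\<And>k. k \<in> K \<Longrightarrow> finite (T k)"
    and ker: "\<And>k. k \<in> K \<Longrightarrow> (\<Sum>z\<in>T k. (ker k z)\<^sup>2) \<le> c" and c: "0 \<le> c"
  shows "(\<Sum>k\<in>K. (\<Sum>z\<in>T k. ker k z * (\<alpha> (fst z) * \<beta> (snd z) * \<delta> (k - fst z - snd z)))\<^sup>2) \<le> c * (M * N * L)"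
proof -
  have "(\<Sum>k\<in>K. (\<Sum>z\<in>T k. ker k z * (\<alpha> (fst z) * \<beta> (snd z) * \<delta> (k - fst z - snd z)))\<^sup>2)
      \<le> (\<Sum>k\<in>K. c * (\<Sum>z\<in>T k. (\<alpha> (fst z) * \<beta> (snd z) * \<delta> (k - fst z - snd z))\<^sup>2))"
    by (intro sum_mono order_trans[OF Cauchy_Schwarz_ineq_sum] mult_right_mono ker sum_nonneg) auto
  also have "\<dots> = c * (\<Sum>(k,z)\<in>Sigma K T. (\<alpha> (fst z) * \<beta> (snd z) * \<delta> (k - fst z - snd z))\<^sup>2)"
    by (simp add: sum_distrib_left[symmetric] sum.Sigma K T)
  also have "\<dots> \<le> c * (M * N * L)"
    using sum_prod3_le[OF \<alpha> \<beta> \<delta>, of "Sigma K T" "\<lambda>z. fst (snd z)" "\<lambda>z. snd (snd z)"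
        "\<lambda>z. fst z - fst (snd z) - snd (snd z)"] K T c
    by (intro mult_left_mono) (auto simp: split_def inj_on_def prod_eq_iff)
  finally show ?thesis .
qed

text \<open>
  With \<open>a = p + q\<close>, \<open>b = k - p\<close>, \<open>c = k - q\<close> the kernel dominates \<open>|k| / |abc|\<close> and \<open>|k| |q| / |p a b c|\<close>
  because \<open>2k = a + b + c\<close>, \<open>k = p + b\<close>, \<open>q = a - p\<close>. Each summand involves two independent coordinates
  of \<open>(p, q)\<close>, so it is square summable. Division by \<open>0\<close> gives \<open>0\<close>.
\<close>

definition cubic_kernel :: "int \<Rightarrow> int \<times> int \<Rightarrow> real" where
  "cubic_kernel k z = (let p = fst z; q = snd z in
     2 * (1 / \<bar>of_int (p + q)\<bar> * (1 / \<bar>of_int (k - p)\<bar>) + 1 / \<bar>of_int (k - q)\<bar> * (1 / \<bar>of_int (k - p)\<bar>)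
        + 1 / \<bar>of_int (p + q)\<bar> * (1 / \<bar>of_int (k - q)\<bar>) + 1 / \<bar>of_int (k - q)\<bar> * (1 / \<bar>of_int p\<bar>)))"

lemma cubic_kernel_nonneg: "0 \<le> cubic_kernel k z"
  unfolding cubic_kernel_def Let_def by (intro mult_nonneg_nonneg add_nonneg_nonneg) auto

lemma l2le_inverse_abs: "l2le (\<lambda>n. 1 / \<bar>of_int n\<bar>) 4"
  using l2le_inverse by (simp add: l2le_def power_divide)

lemma sum4_square_le: "((a::real) + b + c + d)\<^sup>2 \<le> 4 * (a\<^sup>2 + b\<^sup>2 + c\<^sup>2 + d\<^sup>2)"
proof -
  have "4 * (a\<^sup>2 + b\<^sup>2 + c\<^sup>2 + d\<^sup>2) - (a + b + c + d)\<^sup>2 =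
      (a-b)\<^sup>2 + (a-c)\<^sup>2 + (a-d)\<^sup>2 + (b-c)\<^sup>2 + (b-d)\<^sup>2 + (c-d)\<^sup>2"
    by (simp add: power2_eq_square algebra_simps)
  then show ?thesis by (smt (verit) zero_le_power2)
qed

text \<open>The constant is 4 from the squared prefactor 2, times 4 from the square of a sum of four
  terms, times four products each bounded by 4 * 4.\<close>

lemma sum_cubic_kernel:
  assumes T: "finite T"
  shows "(\<Sum>z\<in>T. (cubic_kernel k z)\<^sup>2) \<le> 1024"
proof -
  let ?i = "\<lambda>n::int. 1 / \<bar>real_of_int n\<bar>"
  have "(\<Sum>z\<in>T. (cubic_kernel k z)\<^sup>2) \<le> (\<Sum>z\<in>T. 16 * (
      (?i (fst z + snd z) * ?i (k - fst z))\<^sup>2 + (?i (k - snd z) * ?i (k - fst z))\<^sup>2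
      + (?i (fst z + snd z) * ?i (k - snd z))\<^sup>2 + (?i (k - snd z) * ?i (fst z))\<^sup>2))"
    unfolding cubic_kernel_def Let_def power_mult_distrib[of 2]
    by (intro sum_mono order_trans[OF mult_left_mono[OF sum4_square_le]]) auto
  also have "\<dots> = 16 * ((\<Sum>z\<in>T. (?i (fst z + snd z) * ?i (k - fst z))\<^sup>2) + (\<Sum>z\<in>T. (?i (k - snd z) * ?i (k - fst z))\<^sup>2)
      + (\<Sum>z\<in>T. (?i (fst z + snd z) * ?i (k - snd z))\<^sup>2) + (\<Sum>z\<in>T. (?i (k - snd z) * ?i (fst z))\<^sup>2))"
    by (simp only: sum_distrib_left[symmetric] sum.distrib)
  also have "\<dots> \<le> 16 * (4 * 4 + 4 * 4 + 4 * 4 + 4 * 4)"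
    by (intro mult_left_mono add_mono sum_prod2_le[OF l2le_inverse_abs l2le_inverse_abs T])
       (auto simp: inj_on_def)
  finally show ?thesis by simp
qed

text \<open>The two forms answer to the two positions of a time derivative in the cubic boundary
  term with weight 1/p: on the factor p it produces |p| and cancels the weight, on the factor q it
  leaves |q|/|p|.\<close>

lemma cubic_kernel_ge:
  assumes "p \<noteq> 0" "k - p \<noteq> 0" "k - q \<noteq> 0" "p + q \<noteq> 0"
  shows "\<bar>of_int k\<bar> / \<bar>of_int ((k - p) * (k - q) * (p + q))\<bar> \<le> cubic_kernel k (p, q)" (is ?t1)
    and "\<bar>of_int k\<bar> * \<bar>of_int q\<bar> / (\<bar>of_int p\<bar> * \<bar>of_int ((k - p) * (k - q) * (p + q))\<bar>) \<le> cubic_kernel k (p, q)" (is ?t2)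
proof -
  define P where "P = \<bar>real_of_int p\<bar>"
  define a where "a = \<bar>real_of_int (p + q)\<bar>"
  define b where "b = \<bar>real_of_int (k - p)\<bar>"
  define c where "c = \<bar>real_of_int (k - q)\<bar>"
  define Q where "Q = \<bar>real_of_int q\<bar>"
  define \<kappa> where "\<kappa> = \<bar>real_of_int k\<bar>"
  have pos: "P > 0" "a > 0" "b > 0" "c > 0" using assms by (auto simp: P_def a_def b_def c_def simp del: of_int_add of_int_diff)
  have nn: "Q \<ge> 0" "\<kappa> \<ge> 0" by (auto simp: Q_def \<kappa>_def)
  have k1: "2 * \<kappa> \<le> a + b + c" unfolding \<kappa>_def a_def b_def c_def by simp
  have k2: "\<kappa> \<le> P + b" unfolding \<kappa>_def P_def b_def by simp
  have q: "Q \<le> P + a" unfolding Q_def P_def a_def by simp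
  have prod: "\<bar>real_of_int ((k - p) * (k - q) * (p + q))\<bar> = b * c * a"
    unfolding a_def b_def c_def by (simp add: abs_mult)
  have ck: "cubic_kernel k (p, q) = 2 * (1 / a * (1 / b) + 1 / c * (1 / b) + 1 / a * (1 / c) + 1 / c * (1 / P))"
    unfolding cubic_kernel_def Let_def a_def b_def c_def P_def by simp
  \<comment> \<open>This is \<open>k1\<close> divided by 2abc: each of a, b, c cancels one of the
    three reciprocals.\<close>
  have t1: "\<kappa> / (b * c * a) \<le> (1 / a * (1 / b) + 1 / c * (1 / b) + 1 / a * (1 / c)) / 2"
    using pos k1 by (simp add: field_simps)
  have half: "(x + y + z) / 2 \<le> 2 * (x + y + z + u)"
    and half': "(x + y + z) / 2 + (y + u) \<le> 2 * (x + y + z + u)"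
    if "0 \<le> x" "0 \<le> y" "0 \<le> z" "0 \<le> u" for x y z u :: real
    using that by auto
  have nn4: "0 \<le> 1 / a * (1 / b)" "0 \<le> 1 / c * (1 / b)" "0 \<le> 1 / a * (1 / c)" "0 \<le> 1 / c * (1 / P)"
    using pos by auto
  show ?t1 unfolding prod ck \<kappa>_def[symmetric]
    by (rule order_trans[OF t1]) (rule half[OF nn4])
  \<comment> \<open>Replacing Q by P + a splits the fraction: P cancels in one part, which is the
    first estimate, and a in the other, which is then treated with \<kappa> \<le> P + b.\<close>
  have "\<kappa> * Q / (P * (b * c * a)) \<le> \<kappa> * (P + a) / (P * (b * c * a))"
    using q nn pos by (intro divide_right_mono mult_left_mono) auto
  also have "\<dots> = \<kappa> / (b * c * a) + \<kappa> / (P * b * c)"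
    using pos by (simp add: field_simps)
  also have "\<kappa> / (P * b * c) \<le> (P + b) / (P * b * c)"
    using k2 pos by (intro divide_right_mono) auto
  also have "(P + b) / (P * b * c) = 1 / c * (1 / b) + 1 / c * (1 / P)"
    using pos by (simp add: divide_simps)
  finally have "\<kappa> * Q / (P * (b * c * a)) \<le> \<kappa> / (b * c * a) + (1 / c * (1 / b) + 1 / c * (1 / P))" by simp
  also have "\<dots> \<le> cubic_kernel k (p, q)" unfolding ck using add_right_mono[OF t1] half'[OF nn4] by (rule order_trans)
  finally show ?t2 unfolding prod \<kappa>_def[symmetric] P_def[symmetric] Q_def[symmetric] .
qed

lemma sum_amgm:
  fixes g h :: "'a \<Rightarrow> real"
  assumes "(\<Sum>z\<in>T. (g z)\<^sup>2) \<le> G" "(\<Sum>z\<in>T. (h z)\<^sup>2) \<le> G"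
  shows "(\<Sum>z\<in>T. g z * h z) \<le> G"
proof -
  have "(\<Sum>z\<in>T. g z * h z) \<le> (\<Sum>z\<in>T. ((g z)\<^sup>2 + (h z)\<^sup>2) / 2)"
    by (intro sum_mono) (use sum_squares_bound in \<open>simp add: field_simps\<close>)
  also have "\<dots> = ((\<Sum>z\<in>T. (g z)\<^sup>2) + (\<Sum>z\<in>T. (h z)\<^sup>2)) / 2"
    by (simp add: sum_divide_distrib[symmetric] sum.distrib)
  finally show ?thesis using assms by simp
qed

text \<open>For the case where the middle factor is merely bounded. Two l^2 factors remain; each is
  paired with one of the two reciprocals of a kernel term so that its two arguments are independent,
  and the arithmetic-geometric mean finishes.\<close>

lemma cubic_kernel_pointwise:
  assumes T: "finite T" and \<alpha>: "l2le \<alpha> M" and \<delta>: "l2le \<delta> M"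
  shows "(\<Sum>z\<in>T. cubic_kernel k z * (\<alpha> (fst z) * \<delta> (k - fst z - snd z))) \<le> 32 * M"
proof -
  let ?i = "\<lambda>n::int. 1 / \<bar>real_of_int n\<bar>"
  let ?\<alpha> = "\<lambda>z::int\<times>int. \<alpha> (fst z)" and ?\<delta> = "\<lambda>z::int\<times>int. \<delta> (k - fst z - snd z)"
  have "(\<Sum>z\<in>T. cubic_kernel k z * (?\<alpha> z * ?\<delta> z)) =
    2 * ((\<Sum>z\<in>T. (?\<alpha> z * ?i (fst z + snd z)) * (?\<delta> z * ?i (k - fst z)))
       + (\<Sum>z\<in>T. (?\<alpha> z * ?i (k - snd z)) * (?\<delta> z * ?i (k - fst z)))
       + (\<Sum>z\<in>T. (?\<alpha> z * ?i (fst z + snd z)) * (?\<delta> z * ?i (k - snd z)))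
       + (\<Sum>z\<in>T. (?\<alpha> z * ?i (k - snd z)) * (?\<delta> z * ?i (fst z))))"
    unfolding cubic_kernel_def Let_def sum.distrib[symmetric] sum_distrib_left
    by (intro sum.cong refl) (simp only: algebra_simps)
  also have "\<dots> \<le> 2 * (M * 4 + M * 4 + M * 4 + M * 4)"
    by (intro mult_left_mono add_mono sum_amgm sum_prod2_le[OF \<alpha> l2le_inverse_abs T] sum_prod2_le[OF \<delta> l2le_inverse_abs T])
       (auto simp: inj_on_def)
  finally show ?thesis by simp
qed

text \<open>The case of a bounded first factor. The reciprocals are distributed differently from the
  previous case, since \<open>\<beta>\<close> at q cannot be combined with 1/(k - q): the two
  arguments would not be independent.\<close>

lemma cubic_kernel_pointwise':
  assumes T: "finite T" and \<beta>: "l2le \<beta> M" and \<delta>: "l2le \<delta> M"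
  shows "(\<Sum>z\<in>T. cubic_kernel k z * (\<beta> (snd z) * \<delta> (k - fst z - snd z))) \<le> 32 * M"
proof -
  let ?i = "\<lambda>n::int. 1 / \<bar>real_of_int n\<bar>"
  let ?\<beta> = "\<lambda>z::int\<times>int. \<beta> (snd z)" and ?\<delta> = "\<lambda>z::int\<times>int. \<delta> (k - fst z - snd z)"
  have "(\<Sum>z\<in>T. cubic_kernel k z * (?\<beta> z * ?\<delta> z)) =
    2 * ((\<Sum>z\<in>T. (?\<beta> z * ?i (fst z + snd z)) * (?\<delta> z * ?i (k - fst z)))
       + (\<Sum>z\<in>T. (?\<beta> z * ?i (k - fst z)) * (?\<delta> z * ?i (k - snd z)))
       + (\<Sum>z\<in>T. (?\<beta> z * ?i (fst z + snd z)) * (?\<delta> z * ?i (k - snd z)))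
       + (\<Sum>z\<in>T. (?\<beta> z * ?i (fst z)) * (?\<delta> z * ?i (k - snd z))))"
    unfolding cubic_kernel_def Let_def sum.distrib[symmetric] sum_distrib_left
    by (intro sum.cong refl) (simp only: algebra_simps)
  also have "\<dots> \<le> 2 * (M * 4 + M * 4 + M * 4 + M * 4)"
    by (intro mult_left_mono add_mono sum_amgm sum_prod2_le[OF \<beta> l2le_inverse_abs T] sum_prod2_le[OF \<delta> l2le_inverse_abs T])
       (auto simp: inj_on_def)
  finally show ?thesis by simp
qed

text \<open>From |k| <= |p| + |k - p| the kernel is at most 1/|p| + 1/|k - p|, which is square
  summable in p uniformly in k.\<close>

lemma sum_quadratic_kernel:
  assumes "finite T" "\<And>p. p \<in> T \<Longrightarrow> p \<noteq> 0 \<and> k - p \<noteq> 0"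
  shows "(\<Sum>p\<in>T. (\<bar>of_int k\<bar> / (\<bar>of_int p\<bar> * \<bar>of_int (k - p)\<bar>))\<^sup>2) \<le> (16::real)"
proof -
  have "(\<Sum>p\<in>T. (\<bar>real_of_int k\<bar> / (\<bar>of_int p\<bar> * \<bar>of_int (k - p)\<bar>))\<^sup>2)
     \<le> (\<Sum>p\<in>T. (1 / \<bar>of_int p\<bar> + 1 / \<bar>of_int (k - p)\<bar>)\<^sup>2)"
  proof (intro sum_mono power_mono)
    fix p assume "p \<in> T"
    then have "\<bar>real_of_int p\<bar> > 0" "\<bar>real_of_int (k - p)\<bar> > 0" using assms(2)[of p] by auto
    then have "1 / \<bar>real_of_int p\<bar> + 1 / \<bar>real_of_int (k - p)\<bar> =
        (\<bar>real_of_int p\<bar> + \<bar>real_of_int (k - p)\<bar>) / (\<bar>of_int p\<bar> * \<bar>of_int (k - p)\<bar>)"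
      by (simp add: field_simps)
    moreover have "\<bar>real_of_int k\<bar> \<le> \<bar>real_of_int p\<bar> + \<bar>real_of_int (k - p)\<bar>" by simp
    ultimately show "\<bar>real_of_int k\<bar> / (\<bar>of_int p\<bar> * \<bar>of_int (k - p)\<bar>) \<le> 1 / \<bar>of_int p\<bar> + 1 / \<bar>of_int (k - p)\<bar>"
      by (simp only:) (intro divide_right_mono; simp)
  qed auto
  also have "\<dots> \<le> (\<Sum>p\<in>T. 2 * (1 / \<bar>of_int p\<bar>)\<^sup>2 + 2 * (1 / \<bar>of_int (k - p)\<bar>)\<^sup>2)"
    by (intro sum_mono square_sum_le)
  also have "\<dots> = 2 * (\<Sum>p\<in>T. (1 / \<bar>of_int p\<bar>)\<^sup>2) + 2 * (\<Sum>p\<in>(\<lambda>p. k - p) ` T. (1 / \<bar>of_int p\<bar>)\<^sup>2)"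
    by (subst sum.reindex) (auto simp: inj_on_def sum.distrib sum_distrib_left)
  also have "\<dots> \<le> 2 * 4 + 2 * 4"
    by (intro add_mono mult_left_mono l2leD[OF l2le_inverse_abs]) (use assms in auto)
  finally show ?thesis by simp
qed

section \<open>The normal form\<close>

text \<open>The sign is that of the passage to the interaction picture: multiplication by
  \<open>osc (k ^ 3)\<close> undoes the free evolution of the k-th coefficient.\<close>

definition osc :: "int \<Rightarrow> real \<Rightarrow> complex" where
  "osc n t = cis (- (of_int n * t))"

lemma osc_add: "osc m t * osc n t = osc (m + n) t"
  by (simp add: osc_def cis_mult algebra_simps)

lemma cmod_osc [simp]: "cmod (osc n t) = 1"
  by (simp add: osc_def)

lemma osc_has_vector_derivative:
  "(osc n has_vector_derivative (- \<i> * of_int n * osc n t)) (at t)"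
  unfolding osc_def has_vector_derivative_def
  by (auto intro!: derivative_eq_intros simp: fun_eq_iff scaleR_conv_of_real algebra_simps)

lemma continuous_on_osc [continuous_intros]: "continuous_on A (osc n)"
  unfolding osc_def by (intro continuous_intros)

definition modes :: "nat \<Rightarrow> int set" where
  "modes N = {-int N..int N} - {0}"

lemma finite_modes [simp]: "finite (modes N)"
  by (simp add: modes_def)

lemma in_modes: "k \<in> modes N \<longleftrightarrow> k \<noteq> 0 \<and> \<bar>k\<bar> \<le> int N"
  by (auto simp: modes_def)

lemma uminus_in_modes [simp]: "- k \<in> modes N \<longleftrightarrow> k \<in> modes N"
  by (auto simp: in_modes)

lemma modes_mono: "M \<le> N \<Longrightarrow> modes M \<subseteq> modes N"
  by (auto simp: in_modes)

text \<open>Includes the frequency 0, unlike \<open>modes\<close>: Fourier partial sums run over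
  this set, the normal form over \<open>modes\<close>, and for mean zero the two sums agree.\<close>

definition freqs :: "nat \<Rightarrow> int set" where
  "freqs N = {- int N..int N}"

lemma finite_freqs [simp]: "finite (freqs N)" by (simp add: freqs_def)

lemma freqs_mono: "N \<le> L \<Longrightarrow> freqs N \<subseteq> freqs L" by (auto simp: freqs_def)

lemma sum_freqs_modes:
  assumes "a 0 = 0"
  shows "(\<Sum>k\<in>freqs N. a k) = (\<Sum>k\<in>modes N. a k)"
  using assms by (intro sum.mono_neutral_right) (auto simp: modes_def freqs_def)

lemma freqs_tendsto:
  assumes "(a has_sum S) UNIV"
  shows "(\<lambda>N. \<Sum>k\<in>freqs N. a k) \<longlonglongrightarrow> (S::real)"
proof (rule LIMSEQ_I)
  fix e :: real assume "e > 0"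
  then obtain F where F: "finite F" "\<And>Y. finite Y \<Longrightarrow> F \<subseteq> Y \<Longrightarrow> dist (sum a Y) S < e"
    using assms unfolding has_sum_def tendsto_iff eventually_finite_subsets_at_top by (metis top_greatest)
  obtain N0 where "F \<subseteq> {- int N0..int N0}" using finite_int_bounded[OF F(1)] .
  then have "F \<subseteq> freqs N" if "N \<ge> N0" for N
    using that by (force simp: freqs_def)
  then show "\<exists>no. \<forall>N\<ge>no. norm ((\<Sum>k\<in>freqs N. a k) - S) < e"
    using F(2) by (intro exI[of _ N0]) (auto simp: dist_norm)
qed

definition pairs :: "nat \<Rightarrow> int \<Rightarrow> int set" where
  "pairs N k = {p \<in> modes N. k - p \<in> modes N}"

definition triples :: "nat \<Rightarrow> int \<Rightarrow> (int \<times> int) set" where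
  "triples N k = (SIGMA p:pairs N k. pairs N (k - p))"

text \<open>Within \<open>triples\<close> the factor k - p is already nonzero, so this is exactly
  the set where the cubic phase does not vanish.\<close>

definition nonres :: "nat \<Rightarrow> int \<Rightarrow> (int \<times> int) set" where
  "nonres N k = {z \<in> triples N k. fst z + snd z \<noteq> 0 \<and> k - snd z \<noteq> 0}"

lemma finite_pairs [simp]: "finite (pairs N k)"
  by (simp add: pairs_def)

lemma finite_triples [simp]: "finite (triples N k)"
  by (simp add: triples_def)

lemma finite_nonres [simp]: "finite (nonres N k)"
  by (simp add: nonres_def)

lemma sum_pairs_swap: "(\<Sum>p\<in>pairs N k. g p (k - p)) = (\<Sum>p\<in>pairs N k. g (k - p) p)"
  by (rule sum.reindex_bij_witness[of _ "\<lambda>p. k - p" "\<lambda>p. k - p"]) (auto simp: pairs_def)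

lemma sum_nonres_swap:
  "(\<Sum>z\<in>nonres N k. g (fst z) (snd z) (k - fst z - snd z)) = (\<Sum>z\<in>nonres N k. g (fst z) (k - fst z - snd z) (snd z))"
  by (rule sum.reindex_bij_witness[of _ "\<lambda>z. (fst z, k - fst z - snd z)" "\<lambda>z. (fst z, k - fst z - snd z)"])
     (auto simp: nonres_def triples_def pairs_def algebra_simps)

text \<open>Equal to k^3 - p^3 - q^3 - (k-p-q)^3, the sum of the phases of the interactions k = p +
  (k-p) and k - p = q + (k-p-q).\<close>

definition phase :: "int \<Rightarrow> int \<Rightarrow> int \<Rightarrow> int" where
  "phase k p q = 3 * ((k - p) * (k - q) * (p + q))"

text \<open>The argument a is left free because free waves and deviations from them are inserted as
  well as v itself.\<close>

definition quad :: "nat \<Rightarrow> int \<Rightarrow> real \<Rightarrow> (int \<Rightarrow> complex) \<Rightarrow> complex" where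
  "quad N k t a = (\<Sum>p\<in>pairs N k. osc (3 * k * p * (k - p)) t * (a p * a (k - p)))"

text \<open>
  The evolution in the interaction picture: \<open>v k t\<close> and \<open>w k t\<close> are \<open>e\<^sup>-\<^sup>i\<^sup>k\<^sup>3\<^sup>t\<close> times the Fourier coefficients
  of \<open>u(t)\<close> and \<open>u(t)\<^sup>2\<close>, and \<open>m\<close> is \<open>\<parallel>u(t)\<parallel>\<^sup>2 / 2\<pi>\<close>. Convergence of the convolution to \<open>w\<close> is measured by
  the \<open>\<ell>\<^sup>2\<close> tail of \<open>v\<close>, uniformly in \<open>k\<close>, which makes all later sums finite.
\<close>

locale kdv_modes =
  fixes \<gamma> P :: real and f :: "int \<Rightarrow> complex" and v w :: "int \<Rightarrow> real \<Rightarrow> complex" and m :: "real \<Rightarrow> real"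
  assumes \<gamma>_pos: "0 < \<gamma>"
    and v_zero: "v 0 t = 0"
    and hermitian: "v (- k) t = cnj (v k t)"
    and v_deriv: "(v k has_vector_derivative
      (osc (k ^ 3) t * f k - of_real \<gamma> * v k t - \<i> * of_int k / 2 * w k t)) (at t)"
    and w_cont: "continuous_on UNIV (w k)"
    and mass: "((\<lambda>k. (cmod (v k t))\<^sup>2) has_sum m t) UNIV"
    and mass_cont: "continuous_on UNIV m"
    and w_approx: "cmod (w k t - quad N k t (\<lambda>p. v p t)) \<le>
      2 * sqrt (m t) * sqrt (m t - (\<Sum>k\<in>modes N. (cmod (v k t))\<^sup>2))"
    and w_bound: "cmod (w k t) \<le> m t"
    and f_bound: "l2le (\<lambda>k. cmod (f k)) P"
begin

definition tail :: "nat \<Rightarrow> real \<Rightarrow> real" where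
  "tail N t = sqrt (m t - (\<Sum>k\<in>modes N. (cmod (v k t))\<^sup>2))"

definition forcing :: "int \<Rightarrow> real \<Rightarrow> complex" where
  "forcing k t = osc (k ^ 3) t * f k - of_real \<gamma> * v k t"

definition vdot :: "int \<Rightarrow> real \<Rightarrow> complex" where
  "vdot k t = forcing k t - \<i> * of_int k / 2 * w k t"

lemma v_vdot: "(v k has_vector_derivative vdot k t) (at t)"
  using v_deriv by (simp add: vdot_def forcing_def)

lemma continuous_on_v [continuous_intros]: "continuous_on A (v k)"
  by (meson continuous_at_imp_continuous_on has_vector_derivative_continuous v_vdot)

lemma continuous_on_w [continuous_intros]: "continuous_on A (w k)"
  using w_cont continuous_on_subset by blast

text \<open>The weight is -ik/2, the factor of the quadratic term in the equation, divided by the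
  factor -3ikp(k-p) that differentiation of the oscillation produces.\<close>

definition bd2 :: "nat \<Rightarrow> int \<Rightarrow> real \<Rightarrow> complex" where
  "bd2 N k t = (1 / 6) * (\<Sum>p\<in>pairs N k. osc (3 * k * p * (k - p)) t * (v p t * v (k - p) t) / (of_int p * of_int (k - p)))"

text \<open>Differentiation of the oscillation multiplies the weight by -i times the phase and so
  turns it into 1/p, the weight of the trilinear term.\<close>

definition bd3 :: "nat \<Rightarrow> int \<Rightarrow> real \<Rightarrow> complex" where
  "bd3 N k t = (\<Sum>z\<in>nonres N k. \<i> / (of_int (fst z) * of_int (phase k (fst z) (snd z))) *
     (osc (phase k (fst z) (snd z)) t * (v (fst z) t * v (snd z) t * v (k - fst z - snd z) t)))"

text \<open>The product rule gives two sums that coincide under p -> k - p, whence 1/3 in place of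
  1/6; the oscillation gives back the quadratic term.\<close>

lemma bd2_deriv:
  assumes "k \<noteq> 0"
  shows "(bd2 N k has_vector_derivative
    (- (\<i> * of_int k / 2) * quad N k t (\<lambda>p. v p t)
      + (1 / 3) * (\<Sum>p\<in>pairs N k. osc (3 * k * p * (k - p)) t * (v p t * vdot (k - p) t) / (of_int p * of_int (k - p))))) (at t)"
proof -
  let ?o = "\<lambda>p. osc (3 * k * p * (k - p)) t"
  have "(bd2 N k has_vector_derivative (1 / 6) * (\<Sum>p\<in>pairs N k.
     (?o p * (v p t * vdot (k - p) t + vdot p t * v (k - p) t)
       + (- \<i> * of_int (3 * k * p * (k - p)) * ?o p) * (v p t * v (k - p) t)) / (of_int p * of_int (k - p)))) (at t)"
    unfolding bd2_def
    by (intro has_vector_derivative_mult_right has_vector_derivative_sum has_vector_derivative_divide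
        has_vector_derivative_mult osc_has_vector_derivative v_vdot)
  also have "(\<Sum>p\<in>pairs N k.
     (?o p * (v p t * vdot (k - p) t + vdot p t * v (k - p) t)
       + (- \<i> * of_int (3 * k * p * (k - p)) * ?o p) * (v p t * v (k - p) t)) / (of_int p * of_int (k - p)))
     = (\<Sum>p\<in>pairs N k. ?o p * (v p t * vdot (k - p) t) / (of_int p * of_int (k - p)))
      + (\<Sum>p\<in>pairs N k. ?o p * (vdot p t * v (k - p) t) / (of_int p * of_int (k - p)))
      + (- 3 * \<i> * of_int k) * quad N k t (\<lambda>p. v p t)"
    unfolding quad_def sum_distrib_left sum.distrib[symmetric]
  proof (intro sum.cong refl)
    fix p assume "p \<in> pairs N k"
    then have nz: "of_int p \<noteq> (0::complex)" "of_int (k - p) \<noteq> (0::complex)"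
      by (auto simp: pairs_def in_modes simp flip: of_int_diff)
    have "(c * (A + B) + (- \<i> * (3 * K * x * y) * c) * W) / (x * y) = c * A / (x * y) + c * B / (x * y) + - 3 * \<i> * K * (c * W)"
      if "x \<noteq> 0" "y \<noteq> 0" for c A B K x y W :: complex
      using that by (simp add: field_simps)
    from this[OF nz, of "?o p" "v p t * vdot (k - p) t" "vdot p t * v (k - p) t" "of_int k" "v p t * v (k - p) t"]
    show "(?o p * (v p t * vdot (k - p) t + vdot p t * v (k - p) t)
       + (- \<i> * of_int (3 * k * p * (k - p)) * ?o p) * (v p t * v (k - p) t)) / (of_int p * of_int (k - p))
      = ?o p * (v p t * vdot (k - p) t) / (of_int p * of_int (k - p)) + ?o p * (vdot p t * v (k - p) t) / (of_int p * of_int (k - p))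
      + - 3 * \<i> * of_int k * (?o p * (v p t * v (k - p) t))"
      by (simp only: of_int_mult of_int_numeral)
  qed
  also have "(\<Sum>p\<in>pairs N k. ?o p * (vdot p t * v (k - p) t) / (of_int p * of_int (k - p)))
     = (\<Sum>p\<in>pairs N k. ?o p * (v p t * vdot (k - p) t) / (of_int p * of_int (k - p)))"
    using sum_pairs_swap[of "\<lambda>p q. osc (3 * k * p * q) t * (vdot p t * v q t) / (of_int p * of_int q)" k N]
    by (simp add: ac_simps)
  finally show ?thesis by (rule back_subst) (simp add: algebra_simps)
qed

text \<open>Weight and phase are symmetric in the second and third frequency, so these two
  derivatives merge into a factor 2; the weight 1/p keeps the derivative of the first factor
  separate.\<close>

lemma bd3_deriv:
  "(bd3 N k has_vector_derivative
    ((\<Sum>z\<in>nonres N k. osc (phase k (fst z) (snd z)) t * (v (fst z) t * v (snd z) t * v (k - fst z - snd z) t) / of_int (fst z))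
      + (\<Sum>z\<in>nonres N k. \<i> / (of_int (fst z) * of_int (phase k (fst z) (snd z))) *
     (osc (phase k (fst z) (snd z)) t * (vdot (fst z) t * v (snd z) t * v (k - fst z - snd z) t
        + 2 * (v (fst z) t * vdot (snd z) t * v (k - fst z - snd z) t)))))) (at t)"
proof -
  let ?o = "\<lambda>z. osc (phase k (fst z) (snd z)) t"
  let ?c = "\<lambda>z. \<i> / (of_int (fst z) * of_int (phase k (fst z) (snd z)))"
  have "(bd3 N k has_vector_derivative (\<Sum>z\<in>nonres N k. ?c z *
      (?o z * ((v (fst z) t * v (snd z) t) * vdot (k - fst z - snd z) t + (v (fst z) t * vdot (snd z) t + vdot (fst z) t * v (snd z) t) * v (k - fst z - snd z) t)
       + (- \<i> * of_int (phase k (fst z) (snd z)) * ?o z) * (v (fst z) t * v (snd z) t * v (k - fst z - snd z) t)))) (at t)"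
    unfolding bd3_def
    by (intro has_vector_derivative_mult_right has_vector_derivative_sum
        has_vector_derivative_mult osc_has_vector_derivative v_vdot)
  also have "(\<Sum>z\<in>nonres N k. ?c z *
      (?o z * ((v (fst z) t * v (snd z) t) * vdot (k - fst z - snd z) t + (v (fst z) t * vdot (snd z) t + vdot (fst z) t * v (snd z) t) * v (k - fst z - snd z) t)
       + (- \<i> * of_int (phase k (fst z) (snd z)) * ?o z) * (v (fst z) t * v (snd z) t * v (k - fst z - snd z) t)))
    = (\<Sum>z\<in>nonres N k. ?c z * (?o z * (v (fst z) t * v (snd z) t * vdot (k - fst z - snd z) t)))
     + (\<Sum>z\<in>nonres N k. ?c z * (?o z * (vdot (fst z) t * v (snd z) t * v (k - fst z - snd z) t + v (fst z) t * vdot (snd z) t * v (k - fst z - snd z) t)))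
     + (\<Sum>z\<in>nonres N k. ?o z * (v (fst z) t * v (snd z) t * v (k - fst z - snd z) t) / of_int (fst z))"
    unfolding sum.distrib[symmetric]
  proof (intro sum.cong refl)
    fix z assume z: "z \<in> nonres N k"
    then have nz: "of_int (fst z) \<noteq> (0::complex)" "of_int (phase k (fst z) (snd z)) \<noteq> (0::complex)"
      by (auto simp: nonres_def triples_def pairs_def in_modes phase_def simp flip: of_int_diff of_int_add)
    have "\<i> / (x * y) * (o1 * (X + (Y + Z)) + (- \<i> * y * o1) * W) = \<i> / (x * y) * (o1 * X) + \<i> / (x * y) * (o1 * (Z + Y)) + o1 * W / x"
      if "x \<noteq> 0" "y \<noteq> 0" for x y o1 X Y Z W :: complex
      using that by (simp add: field_simps)
    from this[OF nz] show "?c z *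
      (?o z * ((v (fst z) t * v (snd z) t) * vdot (k - fst z - snd z) t + (v (fst z) t * vdot (snd z) t + vdot (fst z) t * v (snd z) t) * v (k - fst z - snd z) t)
       + (- \<i> * of_int (phase k (fst z) (snd z)) * ?o z) * (v (fst z) t * v (snd z) t * v (k - fst z - snd z) t))
    = ?c z * (?o z * (v (fst z) t * v (snd z) t * vdot (k - fst z - snd z) t))
     + ?c z * (?o z * (vdot (fst z) t * v (snd z) t * v (k - fst z - snd z) t + v (fst z) t * vdot (snd z) t * v (k - fst z - snd z) t))
     + ?o z * (v (fst z) t * v (snd z) t * v (k - fst z - snd z) t) / of_int (fst z)"
      by (simp only: distrib_right)
  qed
  also have "(\<Sum>z\<in>nonres N k. ?c z * (?o z * (v (fst z) t * v (snd z) t * vdot (k - fst z - snd z) t)))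
     = (\<Sum>z\<in>nonres N k. ?c z * (?o z * (v (fst z) t * vdot (snd z) t * v (k - fst z - snd z) t)))"
    using sum_nonres_swap[of "\<lambda>p q r. \<i> / (of_int p * of_int (3 * ((k - p) * (p + r) * (p + q)))) * (osc (3 * ((k - p) * (p + r) * (p + q))) t * (v p t * v q t * vdot r t))" k N]
    by (simp add: phase_def ac_simps)
  finally show ?thesis
    by (rule back_subst) (simp add: sum.distrib algebra_simps sum_distrib_left)
qed

text \<open>The factor 1/(k - p) of \<open>bd2\<close> has been cancelled by the factor k - p in the
  equation for the mode k - p, which leaves 1/p; the phases of the two successive interactions add
  up to \<open>phase\<close>.\<close>

lemma quad_quad:
  "(\<Sum>p\<in>pairs N k. osc (3 * k * p * (k - p)) t * (v p t * quad N (k - p) t (\<lambda>p. v p t)) / of_int p)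
   = (\<Sum>z\<in>triples N k. osc (phase k (fst z) (snd z)) t * (v (fst z) t * v (snd z) t * v (k - fst z - snd z) t) / of_int (fst z))"
proof -
  have "osc (3 * k * p * (k - p)) t * (v p t * (osc (3 * (k - p) * q * (k - p - q)) t * (v q t * v (k - p - q) t))) / of_int p
     = osc (phase k p q) t * (v p t * v q t * v (k - p - q) t) / of_int p" for p q
  proof -
    have ph: "phase k p q = 3 * k * p * (k - p) + 3 * (k - p) * q * (k - p - q)"
      by (simp add: phase_def algebra_simps)
    show ?thesis unfolding ph osc_add[symmetric] by simp
  qed
  then show ?thesis
    unfolding quad_def triples_def sum_distrib_left sum_divide_distrib
    by (subst sum.Sigma) (auto simp: split_def intro!: sum.cong)
qed

definition resonant :: "nat \<Rightarrow> int \<Rightarrow> real \<Rightarrow> complex" where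
  "resonant N k t = (\<Sum>z\<in>triples N k - nonres N k.
     osc (phase k (fst z) (snd z)) t * (v (fst z) t * v (snd z) t * v (k - fst z - snd z) t) / of_int (fst z))"

definition rem :: "nat \<Rightarrow> int \<Rightarrow> real \<Rightarrow> complex" where
  "rem N k t = - (1 / 3) * (\<Sum>p\<in>pairs N k. osc (3 * k * p * (k - p)) t * (v p t * forcing (k - p) t) / (of_int p * of_int (k - p)))
     + \<i> / 6 * resonant N k t
     - \<i> / 6 * (\<Sum>z\<in>nonres N k. \<i> / (of_int (fst z) * of_int (phase k (fst z) (snd z))) *
     (osc (phase k (fst z) (snd z)) t * (vdot (fst z) t * v (snd z) t * v (k - fst z - snd z) t
        + 2 * (v (fst z) t * vdot (snd z) t * v (k - fst z - snd z) t))))"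

text \<open>Two replacements of w by the truncated convolution are recorded: one in the equation for
  the mode k, one in the derivative of \<open>bd2\<close>. In the derivative of \<open>bd3\<close> w
  is kept.\<close>

definition err :: "nat \<Rightarrow> int \<Rightarrow> real \<Rightarrow> complex" where
  "err N k t = - (\<i> * of_int k / 2) * (w k t - quad N k t (\<lambda>p. v p t))
     + \<i> / 6 * (\<Sum>p\<in>pairs N k. osc (3 * k * p * (k - p)) t * (v p t * (w (k - p) t - quad N (k - p) t (\<lambda>p. v p t))) / of_int p)"

text \<open>The first term treats the forcing like a nonlinear term: f is constant in time, so its
  oscillation is integrated exactly and gains k^3.\<close>

definition bdry :: "nat \<Rightarrow> int \<Rightarrow> real \<Rightarrow> complex" where
  "bdry N k t = \<i> / of_int (k ^ 3) * (osc (k ^ 3) t * f k) + bd2 N k t + \<i> / 6 * bd3 N k t"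

text \<open>An exact identity for every N. The quadratic term is expanded twice; the second
  derivative by parts leaves \<open>vdot\<close>, and with it w, unexpanded inside
  \<open>rem\<close>.\<close>

lemma normal_form:
  assumes k: "k \<noteq> 0"
  shows "((\<lambda>t. v k t - bdry N k t) has_vector_derivative (- of_real \<gamma> * v k t + rem N k t + err N k t)) (at t)"
proof -
  let ?o = "\<lambda>p. osc (3 * k * p * (k - p)) t"
  let ?q = "\<lambda>k. quad N k t (\<lambda>p. v p t)"
  define X where "X = (\<Sum>p\<in>pairs N k. ?o p * (v p t * forcing (k - p) t) / (of_int p * of_int (k - p)))"
  define Y where "Y = (\<Sum>p\<in>pairs N k. ?o p * (v p t * w (k - p) t) / of_int p)"
  define Z where "Z = (\<Sum>p\<in>pairs N k. ?o p * (v p t * ?q (k - p)) / of_int p)"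
  define NR where "NR = (\<Sum>z\<in>nonres N k. osc (phase k (fst z) (snd z)) t * (v (fst z) t * v (snd z) t * v (k - fst z - snd z) t) / of_int (fst z))"
  define V where "V = (\<Sum>z\<in>nonres N k. \<i> / (of_int (fst z) * of_int (phase k (fst z) (snd z))) *
     (osc (phase k (fst z) (snd z)) t * (vdot (fst z) t * v (snd z) t * v (k - fst z - snd z) t
        + 2 * (v (fst z) t * vdot (snd z) t * v (k - fst z - snd z) t))))"
  have "(\<Sum>p\<in>pairs N k. ?o p * (v p t * vdot (k - p) t) / (of_int p * of_int (k - p))) = X - \<i> / 2 * Y"
    unfolding X_def Y_def sum_distrib_left sum_subtractf[symmetric]
  proof (intro sum.cong refl)
    fix p assume "p \<in> pairs N k"
    then have nz: "of_int p \<noteq> (0::complex)" "of_int (k - p) \<noteq> (0::complex)"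
      by (auto simp: pairs_def in_modes simp flip: of_int_diff)
    have "c * (a * (F - \<i> * y / 2 * W)) / (x * y) = c * (a * F) / (x * y) - \<i> / 2 * (c * (a * W) / x)"
      if "x \<noteq> 0" "y \<noteq> 0" for c a F y W x :: complex
      using that by (simp add: field_simps)
    from this[OF nz] show "?o p * (v p t * vdot (k - p) t) / (of_int p * of_int (k - p)) =
      ?o p * (v p t * forcing (k - p) t) / (of_int p * of_int (k - p)) - \<i> / 2 * (?o p * (v p t * w (k - p) t) / of_int p)"
      unfolding vdot_def .
  qed
  then have d2: "(bd2 N k has_vector_derivative (- (\<i> * of_int k / 2) * ?q k + (1 / 3) * (X - \<i> / 2 * Y))) (at t)"
    using bd2_deriv[OF k, of N t] by simp
  have d3: "(bd3 N k has_vector_derivative (NR + V)) (at t)"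
    using bd3_deriv[of N k t] by (simp add: NR_def V_def)
  have Z: "Z = resonant N k t + NR"
    unfolding Z_def NR_def quad_quad resonant_def
    by (rule sum.subset_diff) (auto simp: nonres_def)
  have e: "err N k t = - (\<i> * of_int k / 2) * (w k t - ?q k) + \<i> / 6 * (Y - Z)"
    unfolding err_def Y_def Z_def sum_subtractf[symmetric] by (simp add: algebra_simps diff_divide_distrib)
  have r: "rem N k t = - (1 / 3) * X + \<i> / 6 * resonant N k t - \<i> / 6 * V"
    by (simp add: rem_def X_def V_def)
  have "((\<lambda>t. v k t - bdry N k t) has_vector_derivative
     (vdot k t - (\<i> / of_int (k ^ 3) * ((- \<i> * of_int (k ^ 3) * osc (k ^ 3) t) * f k)
        + (- (\<i> * of_int k / 2) * ?q k + (1 / 3) * (X - \<i> / 2 * Y)) + \<i> / 6 * (NR + V)))) (at t)"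
    unfolding bdry_def
    by (intro has_vector_derivative_diff has_vector_derivative_add has_vector_derivative_mult_right
        has_vector_derivative_mult_left v_vdot d2 d3 osc_has_vector_derivative)
  also have "\<i> / of_int (k ^ 3) * ((- \<i> * of_int (k ^ 3) * osc (k ^ 3) t) * f k) = osc (k ^ 3) t * f k"
    using k by simp
  finally show ?thesis
    by (rule back_subst) (simp add: e r Z vdot_def forcing_def algebra_simps)
qed

lemma sum_le_m: "finite F \<Longrightarrow> (\<Sum>k\<in>F. (cmod (v k t))\<^sup>2) \<le> m t"
  using has_sum_finite_neutralI finite_sum_le_has_sum[OF mass, of F] by auto

lemma l2le_v: "m t \<le> M \<Longrightarrow> l2le (\<lambda>k. cmod (v k t)) M"
  unfolding l2le_def using sum_le_m order_trans by blast

lemma m_nonneg: "0 \<le> m t"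
  using sum_le_m[of "{}"] by simp

lemma cmod_v_le: "m t \<le> M \<Longrightarrow> cmod (v k t) \<le> sqrt M"
  using l2le_pointwise[OF l2le_v] real_le_rsqrt by blast

lemma l2le_forcing:
  assumes "m t \<le> M"
  shows "l2le (\<lambda>k. cmod (forcing k t)) (2 * P + 2 * (\<gamma>\<^sup>2 * M))"
proof -
  have "l2le (\<lambda>k. \<gamma> * cmod (v k t)) (\<gamma>\<^sup>2 * M)"
    using l2le_v[OF assms] unfolding l2le_def
    by (auto simp: power_mult_distrib simp flip: sum_distrib_left intro!: mult_left_mono)
  from l2le_add[OF f_bound this] show ?thesis
    by (rule l2le_mono) (auto simp: forcing_def norm_mult \<gamma>_pos less_imp_le intro!: order_trans[OF norm_triangle_ineq4])
qed

lemma hermitian_cmod: "cmod (v (- k) t) = cmod (v k t)"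
  by (simp add: hermitian)

text \<open>The range \<open>0 < |p| < |k|\<close> is symmetric, so it contributes nothing; elsewhere \<open>|k| \<le> |p|\<close>.\<close>

lemma resonant_coeff_bound:
  assumes N: "N \<ge> 2 * nat \<bar>k\<bar>" and k: "k \<noteq> 0" and M: "m t \<le> M"
  shows "\<bar>of_int k\<bar> * \<bar>\<Sum>p\<in>pairs N k. (cmod (v p t))\<^sup>2 / of_int p\<bar> \<le> M"
proof -
  let ?g = "\<lambda>p. (cmod (v p t))\<^sup>2 / real_of_int p"
  define I where "I = {p::int. 0 < \<bar>p\<bar> \<and> \<bar>p\<bar> < \<bar>k\<bar>}"
  have I: "I \<subseteq> pairs N k"
    using N by (auto simp: I_def pairs_def in_modes)
  have "(\<Sum>p\<in>I. ?g p) = (\<Sum>p\<in>I. ?g (- p))"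
    by (rule sum.reindex_bij_witness[of _ uminus uminus]) (auto simp: I_def)
  also have "\<dots> = - (\<Sum>p\<in>I. ?g p)"
    by (simp add: hermitian_cmod sum_negf)
  finally have 0: "(\<Sum>p\<in>I. ?g p) = 0" by simp
  have "(\<Sum>p\<in>pairs N k. ?g p) = (\<Sum>p\<in>pairs N k - I. ?g p)"
    using sum.subset_diff[OF I, of ?g] 0 by simp
  then have "\<bar>of_int k\<bar> * \<bar>\<Sum>p\<in>pairs N k. ?g p\<bar> \<le> \<bar>of_int k\<bar> * (\<Sum>p\<in>pairs N k - I. \<bar>?g p\<bar>)"
    by (simp only:) (intro mult_left_mono sum_abs abs_ge_zero)
  also have "\<dots> \<le> (\<Sum>p\<in>pairs N k - I. (cmod (v p t))\<^sup>2)"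
    unfolding sum_distrib_left
  proof (intro sum_mono)
    fix p assume "p \<in> pairs N k - I"
    then have p: "p \<noteq> 0" "\<bar>k\<bar> \<le> \<bar>p\<bar>" by (auto simp: I_def pairs_def in_modes)
    then have "\<bar>real_of_int k\<bar> / \<bar>of_int p\<bar> \<le> 1" by (simp add: divide_le_eq)
    then have "\<bar>real_of_int k\<bar> / \<bar>of_int p\<bar> * (cmod (v p t))\<^sup>2 \<le> 1 * (cmod (v p t))\<^sup>2"
      by (intro mult_right_mono) auto
    then show "\<bar>real_of_int k\<bar> * \<bar>?g p\<bar> \<le> (cmod (v p t))\<^sup>2" by (simp add: abs_mult)
  qed
  also have "\<dots> \<le> M" using sum_le_m[of "pairs N k - I" t] M by simp
  finally show ?thesis .
qed

text \<open>The resonant pairs are q = k and q = -p, overlapping at most in (-k, k). Each line gives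
  v_k times the sum of |v_p|^2 / p, since v_p v_{-p} = |v_p|^2; two lines and the overlap account
  for 3M. The lower bound on N keeps the cancelling range of p complete.\<close>

lemma resonant_bound:
  assumes N: "N \<ge> 2 * nat \<bar>k\<bar>" and k: "k \<noteq> 0" and M: "m t \<le> M"
  shows "\<bar>of_int k\<bar> * cmod (resonant N k t) \<le> 3 * M * cmod (v k t)"
proof -
  let ?h = "\<lambda>z. osc (phase k (fst z) (snd z)) t * (v (fst z) t * v (snd z) t * v (k - fst z - snd z) t) / of_int (fst z)"
  let ?A = "(\<lambda>p. (p, k)) ` pairs N k" and ?B = "(\<lambda>p. (p, -p)) ` pairs N k"
  define C where "C = (\<Sum>p\<in>pairs N k. complex_of_real ((cmod (v p t))\<^sup>2 / of_int p))"
  have kN: "\<bar>k\<bar> \<le> int N" using N by simp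
  have eq: "triples N k - nonres N k = ?A \<union> ?B"
    using k kN by (auto simp: triples_def nonres_def pairs_def in_modes image_iff)
  have AB: "?A \<inter> ?B \<subseteq> {(-k, k)}" by auto
  have vv: "v p t * v (- p) t = (of_real (cmod (v p t)))\<^sup>2" for p
    using complex_norm_square[of "v p t"] by (simp add: hermitian)
  have A: "sum ?h ?A = v k t * C"
    unfolding C_def sum_distrib_left
    by (subst sum.reindex) (auto simp: inj_on_def phase_def osc_def vv[symmetric] ac_simps intro!: sum.cong)
  have B: "sum ?h ?B = v k t * C"
    unfolding C_def sum_distrib_left
    by (subst sum.reindex) (auto simp: inj_on_def phase_def osc_def vv[symmetric] ac_simps intro!: sum.cong)
  have "resonant N k t = sum ?h ?A + sum ?h ?B - sum ?h (?A \<inter> ?B)"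
    unfolding resonant_def eq by (subst sum_Un) auto
  then have R: "resonant N k t = 2 * (v k t * C) - sum ?h (?A \<inter> ?B)"
    unfolding A B by simp
  have C: "\<bar>of_int k\<bar> * cmod C \<le> M"
    using resonant_coeff_bound[OF N k M] unfolding C_def of_real_sum[symmetric] norm_of_real .
  have D: "\<bar>of_int k\<bar> * cmod (sum ?h (?A \<inter> ?B)) \<le> M * cmod (v k t)"
  proof -
    have "cmod (sum ?h (?A \<inter> ?B)) \<le> (\<Sum>z\<in>?A \<inter> ?B. cmod (?h z))" by (rule norm_sum)
    also have "\<dots> \<le> (\<Sum>z\<in>{(-k, k)}. cmod (?h z))"
      by (rule sum_mono2) (use AB in auto)
    also have "\<dots> = cmod (v k t) * (cmod (v k t))\<^sup>2 / \<bar>of_int k\<bar>"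
      by (simp add: norm_mult norm_divide hermitian_cmod power2_eq_square)
    finally have "\<bar>of_int k\<bar> * cmod (sum ?h (?A \<inter> ?B)) \<le> \<bar>real_of_int k\<bar> * (cmod (v k t) * (cmod (v k t))\<^sup>2 / \<bar>of_int k\<bar>)"
      by (rule mult_left_mono) simp
    also have "\<dots> = (cmod (v k t))\<^sup>2 * cmod (v k t)" using k by simp
    also have "\<dots> \<le> M * cmod (v k t)"
      using l2le_pointwise[OF l2le_v[OF M], of k] by (intro mult_right_mono) auto
    finally show ?thesis .
  qed
  have "\<bar>of_int k\<bar> * cmod (resonant N k t) \<le> \<bar>of_int k\<bar> * (2 * (cmod (v k t) * cmod C) + cmod (sum ?h (?A \<inter> ?B)))"
    unfolding R by (intro mult_left_mono order_trans[OF norm_triangle_ineq4]) (auto simp: norm_mult)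
  also have "\<dots> = 2 * (cmod (v k t) * (\<bar>of_int k\<bar> * cmod C)) + \<bar>of_int k\<bar> * cmod (sum ?h (?A \<inter> ?B))"
    by (simp add: algebra_simps)
  also have "\<dots> \<le> 2 * (cmod (v k t) * M) + M * cmod (v k t)"
    by (intro add_mono mult_left_mono C D) auto
  finally show ?thesis by (simp add: algebra_simps)
qed

end

text \<open>The majorants carry the weight |k|, so that each bound for a term of the normal form is
  an H^1 bound; l^2 or sup information on the sequences is inserted last.\<close>

definition maj2 :: "nat \<Rightarrow> int \<Rightarrow> (int \<Rightarrow> real) \<Rightarrow> (int \<Rightarrow> real) \<Rightarrow> real" where
  "maj2 N k \<alpha> \<beta> = (\<Sum>p\<in>pairs N k. \<bar>of_int k\<bar> / (\<bar>of_int p\<bar> * \<bar>of_int (k - p)\<bar>) * (\<alpha> p * \<beta> (k - p)))"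

definition maj3 :: "nat \<Rightarrow> int \<Rightarrow> (int \<Rightarrow> real) \<Rightarrow> (int \<Rightarrow> real) \<Rightarrow> (int \<Rightarrow> real) \<Rightarrow> real" where
  "maj3 N k \<alpha> \<beta> \<delta> = (\<Sum>z\<in>nonres N k. cubic_kernel k z * (\<alpha> (fst z) * \<beta> (snd z) * \<delta> (k - fst z - snd z)))"

lemma maj2_l2:
  assumes "l2le \<alpha> M" "l2le \<beta> L" "finite K"
  shows "(\<Sum>k\<in>K. (maj2 N k \<alpha> \<beta>)\<^sup>2) \<le> 16 * (M * L)"
  unfolding maj2_def
  by (intro bilinear_l2_bound assms finite_pairs sum_quadratic_kernel) (auto simp: pairs_def in_modes)

lemma maj3_l2:
  assumes "l2le \<alpha> M" "l2le \<beta> L" "l2le \<delta> L'" "finite K"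
  shows "(\<Sum>k\<in>K. (maj3 N k \<alpha> \<beta> \<delta>)\<^sup>2) \<le> 1024 * (M * L * L')"
  unfolding maj3_def
  by (intro trilinear_l2_bound assms finite_nonres sum_cubic_kernel) auto

text \<open>Here \<open>\<omega>\<close> is bounded but not assumed in l^2, the situation of w
  before the quartic estimate; the result is a bound for each k separately.\<close>

lemma maj3_pointwise:
  assumes "l2le \<alpha> M" "l2le \<delta> M" "\<And>k. 0 \<le> \<alpha> k" "\<And>k. 0 \<le> \<delta> k" "\<And>k. \<omega> k \<le> W" "0 \<le> W"
  shows "maj3 N k \<omega> \<alpha> \<delta> \<le> 32 * M * W" "maj3 N k \<alpha> \<omega> \<delta> \<le> 32 * M * W"
proof -
  have "maj3 N k \<omega> \<alpha> \<delta> \<le> (\<Sum>z\<in>nonres N k. W * (cubic_kernel k z * (\<alpha> (snd z) * \<delta> (k - fst z - snd z))))"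
    unfolding maj3_def
  proof (intro sum_mono)
    fix z
    have "\<omega> (fst z) * (cubic_kernel k z * (\<alpha> (snd z) * \<delta> (k - fst z - snd z)))
      \<le> W * (cubic_kernel k z * (\<alpha> (snd z) * \<delta> (k - fst z - snd z)))"
      by (intro mult_right_mono assms mult_nonneg_nonneg cubic_kernel_nonneg)
    then show "cubic_kernel k z * (\<omega> (fst z) * \<alpha> (snd z) * \<delta> (k - fst z - snd z))
      \<le> W * (cubic_kernel k z * (\<alpha> (snd z) * \<delta> (k - fst z - snd z)))" by (simp add: ac_simps)
  qed
  also have "\<dots> \<le> W * (32 * M)"
    unfolding sum_distrib_left[symmetric]
    by (intro mult_left_mono cubic_kernel_pointwise' assms finite_nonres)
  finally show "maj3 N k \<omega> \<alpha> \<delta> \<le> 32 * M * W" by (simp add: ac_simps)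
  have "maj3 N k \<alpha> \<omega> \<delta> \<le> (\<Sum>z\<in>nonres N k. W * (cubic_kernel k z * (\<alpha> (fst z) * \<delta> (k - fst z - snd z))))"
    unfolding maj3_def
  proof (intro sum_mono)
    fix z
    have "\<omega> (snd z) * (cubic_kernel k z * (\<alpha> (fst z) * \<delta> (k - fst z - snd z)))
      \<le> W * (cubic_kernel k z * (\<alpha> (fst z) * \<delta> (k - fst z - snd z)))"
      by (intro mult_right_mono assms mult_nonneg_nonneg cubic_kernel_nonneg)
    then show "cubic_kernel k z * (\<alpha> (fst z) * \<omega> (snd z) * \<delta> (k - fst z - snd z))
      \<le> W * (cubic_kernel k z * (\<alpha> (fst z) * \<delta> (k - fst z - snd z)))" by (simp add: ac_simps)
  qed
  also have "\<dots> \<le> W * (32 * M)"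
    unfolding sum_distrib_left[symmetric]
    by (intro mult_left_mono cubic_kernel_pointwise assms finite_nonres)
  finally show "maj3 N k \<alpha> \<omega> \<delta> \<le> 32 * M * W" by (simp add: ac_simps)
qed

lemma nonresD:
  assumes "z \<in> nonres N k"
  shows "fst z \<in> modes N" "snd z \<in> modes N" "k - fst z \<noteq> 0" "k - snd z \<noteq> 0" "fst z + snd z \<noteq> 0"
    "fst z \<noteq> 0" "snd z \<noteq> 0"
  using assms by (auto simp: nonres_def triples_def pairs_def in_modes)

lemma abs_int_ge_1: "(p::int) \<noteq> 0 \<Longrightarrow> 1 \<le> \<bar>real_of_int p\<bar>"
  by linarith

text \<open>The phase is 3abc and the gain 1/3 is discarded; the third form follows from the first
  by |p| >= 1.\<close>

lemma cubic_kernel_ge':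
  assumes "z \<in> nonres N k"
  shows "\<bar>of_int k\<bar> / \<bar>of_int (phase k (fst z) (snd z))\<bar> \<le> cubic_kernel k z"
    and "\<bar>of_int k\<bar> * \<bar>of_int (snd z)\<bar> / (\<bar>of_int (fst z)\<bar> * \<bar>of_int (phase k (fst z) (snd z))\<bar>) \<le> cubic_kernel k z"
    and "\<bar>of_int k\<bar> / (\<bar>of_int (fst z)\<bar> * \<bar>of_int (phase k (fst z) (snd z))\<bar>) \<le> cubic_kernel k z"
proof -
  note nz = nonresD[OF assms]
  note ge = cubic_kernel_ge[OF nz(6) nz(3) nz(4) nz(5)]
  let ?abc = "real_of_int ((k - fst z) * (k - snd z) * (fst z + snd z))"
  have ph: "\<bar>real_of_int (phase k (fst z) (snd z))\<bar> = 3 * \<bar>?abc\<bar>"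
    unfolding phase_def by (simp add: abs_mult)
  have "(k - fst z) * (k - snd z) * (fst z + snd z) \<noteq> 0" using nz by simp
  then have abc: "0 < \<bar>?abc\<bar>" by (simp only: of_int_eq_0_iff zero_less_abs_iff not_False_eq_True)
  have p: "1 \<le> \<bar>real_of_int (fst z)\<bar>" "1 \<le> \<bar>real_of_int (snd z)\<bar>" using nz by (auto intro!: abs_int_ge_1)
  have "\<bar>of_int k\<bar> / \<bar>of_int (phase k (fst z) (snd z))\<bar> \<le> \<bar>of_int k\<bar> / \<bar>?abc\<bar>"
    unfolding ph using abc by (intro divide_left_mono) auto
  then show 1: "\<bar>of_int k\<bar> / \<bar>of_int (phase k (fst z) (snd z))\<bar> \<le> cubic_kernel k z"
    using ge(1) by simp
  have "\<bar>of_int k\<bar> * \<bar>of_int (snd z)\<bar> / (\<bar>of_int (fst z)\<bar> * \<bar>of_int (phase k (fst z) (snd z))\<bar>)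
     \<le> \<bar>of_int k\<bar> * \<bar>of_int (snd z)\<bar> / (\<bar>of_int (fst z)\<bar> * \<bar>?abc\<bar>)"
    unfolding ph using abc p by (intro divide_left_mono mult_left_mono mult_pos_pos) auto
  then show "\<bar>of_int k\<bar> * \<bar>of_int (snd z)\<bar> / (\<bar>of_int (fst z)\<bar> * \<bar>of_int (phase k (fst z) (snd z))\<bar>) \<le> cubic_kernel k z"
    using ge(2) by simp
  have "\<bar>real_of_int k\<bar> / (\<bar>of_int (fst z)\<bar> * \<bar>of_int (phase k (fst z) (snd z))\<bar>) \<le> \<bar>of_int k\<bar> / (1 * \<bar>of_int (phase k (fst z) (snd z))\<bar>)"
    using abc p ph by (intro divide_left_mono mult_right_mono mult_pos_pos) auto
  then show "\<bar>of_int k\<bar> / (\<bar>of_int (fst z)\<bar> * \<bar>of_int (phase k (fst z) (snd z))\<bar>) \<le> cubic_kernel k z"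
    using 1 by simp
qed

context kdv_modes begin

text \<open>In the order of \<open>bdry\<close>: |k|/|k|^3 <= 1 leaves f itself, the quadratic
  kernel appears as it stands, and the cubic term uses the weakest kernel estimate because no
  derivative falls on a factor.\<close>

lemma cmod_bdry:
  assumes k: "k \<noteq> 0"
  shows "\<bar>of_int k\<bar> * cmod (bdry N k t) \<le> cmod (f k) + maj2 N k (\<lambda>k. cmod (v k t)) (\<lambda>k. cmod (v k t))
     + maj3 N k (\<lambda>k. cmod (v k t)) (\<lambda>k. cmod (v k t)) (\<lambda>k. cmod (v k t))"
proof -
  have k1: "1 \<le> \<bar>real_of_int k\<bar>" using k by (rule abs_int_ge_1)
  have "\<bar>real_of_int k\<bar> * cmod (\<i> / of_int (k ^ 3) * (osc (k ^ 3) t * f k)) = cmod (f k) / \<bar>real_of_int k\<bar>\<^sup>2"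
    using k by (simp add: norm_mult norm_divide norm_power field_simps power2_eq_square power3_eq_cube)
  also have "\<dots> \<le> cmod (f k) / 1"
    using one_le_power[OF k1, of 2] by (intro divide_left_mono) auto
  finally have 1: "\<bar>real_of_int k\<bar> * cmod (\<i> / of_int (k ^ 3) * (osc (k ^ 3) t * f k)) \<le> cmod (f k)" by simp
  have "\<bar>real_of_int k\<bar> * cmod (bd2 N k t) \<le> \<bar>real_of_int k\<bar> *
     (\<Sum>p\<in>pairs N k. cmod (osc (3 * k * p * (k - p)) t * (v p t * v (k - p) t) / (of_int p * of_int (k - p))))"
  proof (rule mult_left_mono)
    let ?s = "\<Sum>p\<in>pairs N k. osc (3 * k * p * (k - p)) t * (v p t * v (k - p) t) / (of_int p * of_int (k - p))"
    have "cmod (bd2 N k t) = cmod ?s / 6" unfolding bd2_def by (simp add: norm_mult norm_divide del: of_int_diff)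
    also have "\<dots> \<le> cmod ?s" by simp
    also note norm_sum
    finally show "cmod (bd2 N k t) \<le> (\<Sum>p\<in>pairs N k. cmod (osc (3 * k * p * (k - p)) t * (v p t * v (k - p) t) / (of_int p * of_int (k - p))))" .
  qed simp
  also have "\<dots> = maj2 N k (\<lambda>k. cmod (v k t)) (\<lambda>k. cmod (v k t))"
    unfolding maj2_def sum_distrib_left
    by (intro sum.cong refl) (simp add: norm_mult norm_divide flip: of_int_diff)
  finally have 2: "\<bar>real_of_int k\<bar> * cmod (bd2 N k t) \<le> maj2 N k (\<lambda>k. cmod (v k t)) (\<lambda>k. cmod (v k t))" .
  have "\<bar>real_of_int k\<bar> * cmod (\<i> / 6 * bd3 N k t) \<le> \<bar>real_of_int k\<bar> * cmod (bd3 N k t)"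
    by (intro mult_left_mono) (auto simp: norm_mult norm_divide)
  also have "\<dots> \<le> (\<Sum>z\<in>nonres N k. \<bar>real_of_int k\<bar> * cmod (\<i> / (of_int (fst z) * of_int (phase k (fst z) (snd z))) *
     (osc (phase k (fst z) (snd z)) t * (v (fst z) t * v (snd z) t * v (k - fst z - snd z) t))))"
    unfolding bd3_def sum_distrib_left[symmetric] by (intro mult_left_mono norm_sum) auto
  also have "\<dots> \<le> maj3 N k (\<lambda>k. cmod (v k t)) (\<lambda>k. cmod (v k t)) (\<lambda>k. cmod (v k t))"
    unfolding maj3_def
  proof (intro sum_mono)
    fix z assume z: "z \<in> nonres N k"
    have "\<bar>real_of_int k\<bar> * cmod (\<i> / (of_int (fst z) * of_int (phase k (fst z) (snd z))) *
     (osc (phase k (fst z) (snd z)) t * (v (fst z) t * v (snd z) t * v (k - fst z - snd z) t)))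
     = \<bar>of_int k\<bar> / (\<bar>of_int (fst z)\<bar> * \<bar>of_int (phase k (fst z) (snd z))\<bar>) * (cmod (v (fst z) t) * cmod (v (snd z) t) * cmod (v (k - fst z - snd z) t))"
      by (simp add: norm_mult norm_divide)
    also have "\<dots> \<le> cubic_kernel k z * (cmod (v (fst z) t) * cmod (v (snd z) t) * cmod (v (k - fst z - snd z) t))"
      by (intro mult_right_mono cubic_kernel_ge'(3)[OF z]) auto
    finally show "\<bar>real_of_int k\<bar> * cmod (\<i> / (of_int (fst z) * of_int (phase k (fst z) (snd z))) *
     (osc (phase k (fst z) (snd z)) t * (v (fst z) t * v (snd z) t * v (k - fst z - snd z) t))) \<le>
      cubic_kernel k z * (cmod (v (fst z) t) * cmod (v (snd z) t) * cmod (v (k - fst z - snd z) t))" .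
  qed
  finally have 3: "\<bar>real_of_int k\<bar> * cmod (\<i> / 6 * bd3 N k t) \<le> maj3 N k (\<lambda>k. cmod (v k t)) (\<lambda>k. cmod (v k t)) (\<lambda>k. cmod (v k t))" .
  have "\<bar>of_int k\<bar> * cmod (bdry N k t) \<le> \<bar>of_int k\<bar> * (cmod (\<i> / of_int (k ^ 3) * (osc (k ^ 3) t * f k)) + cmod (bd2 N k t) + cmod (\<i> / 6 * bd3 N k t))"
    unfolding bdry_def by (intro mult_left_mono order_trans[OF norm_triangle_ineq] add_mono norm_triangle_ineq) auto
  then show ?thesis using 1 2 3 by (simp add: distrib_left)
qed

text \<open>Since |k| >= 1 the forcing may carry the factor |k| as well, so both parts of
  \<open>vdot\<close> are described by one sequence.\<close>

lemma cmod_vdot: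
  assumes "k \<noteq> 0"
  shows "cmod (vdot k t) \<le> \<bar>of_int k\<bar> * (cmod (forcing k t) + cmod (w k t))"
proof -
  have k1: "1 \<le> \<bar>real_of_int k\<bar>" using assms by (rule abs_int_ge_1)
  have "cmod (vdot k t) \<le> 1 * cmod (forcing k t) + \<bar>of_int k\<bar> / 2 * cmod (w k t)"
    unfolding vdot_def by (rule order_trans[OF norm_triangle_ineq4]) (simp add: norm_mult norm_divide)
  also have "\<dots> \<le> \<bar>of_int k\<bar> * cmod (forcing k t) + \<bar>of_int k\<bar> * cmod (w k t)"
    using k1 by (intro add_mono mult_right_mono) auto
  finally show ?thesis by (simp add: distrib_left)
qed

text \<open>\<open>\<theta>\<close> is a free majorant of forcing plus w: with the sup bound of w it
  gives decay of each mode, with w in l^2 the H^1 bound. It is required on \<open>modes N\<close>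
  only, which permits cutting w off.\<close>

lemma cmod_rem:
  assumes k: "k \<noteq> 0" and N: "N \<ge> 2 * nat \<bar>k\<bar>" and M: "m t \<le> M"
    and \<theta>: "\<And>j. j \<in> modes N \<Longrightarrow> cmod (forcing j t) + cmod (w j t) \<le> \<theta> j"
  shows "\<bar>of_int k\<bar> * cmod (rem N k t) \<le> maj2 N k (\<lambda>k. cmod (v k t)) (\<lambda>k. cmod (forcing k t)) + M * cmod (v k t)
     + (maj3 N k \<theta> (\<lambda>k. cmod (v k t)) (\<lambda>k. cmod (v k t)) + maj3 N k (\<lambda>k. cmod (v k t)) \<theta> (\<lambda>k. cmod (v k t)))"
proof -
  let ?\<alpha> = "\<lambda>k. cmod (v k t)"
  let ?X = "\<Sum>p\<in>pairs N k. osc (3 * k * p * (k - p)) t * (v p t * forcing (k - p) t) / (of_int p * of_int (k - p))"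
  let ?V = "\<Sum>z\<in>nonres N k. \<i> / (of_int (fst z) * of_int (phase k (fst z) (snd z))) *
     (osc (phase k (fst z) (snd z)) t * (vdot (fst z) t * v (snd z) t * v (k - fst z - snd z) t
        + 2 * (v (fst z) t * vdot (snd z) t * v (k - fst z - snd z) t)))"
  have "\<bar>real_of_int k\<bar> * cmod ?X \<le> \<bar>real_of_int k\<bar> *
     (\<Sum>p\<in>pairs N k. cmod (osc (3 * k * p * (k - p)) t * (v p t * forcing (k - p) t) / (of_int p * of_int (k - p))))"
    by (intro mult_left_mono norm_sum) auto
  also have "\<dots> = maj2 N k ?\<alpha> (\<lambda>k. cmod (forcing k t))"
    unfolding maj2_def sum_distrib_left
    by (intro sum.cong refl) (simp add: norm_mult norm_divide flip: of_int_diff)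
  finally have 1: "\<bar>real_of_int k\<bar> * cmod ?X \<le> maj2 N k ?\<alpha> (\<lambda>k. cmod (forcing k t))" .
  have "\<bar>real_of_int k\<bar> * cmod ?V \<le> (\<Sum>z\<in>nonres N k. \<bar>real_of_int k\<bar> * cmod (\<i> / (of_int (fst z) * of_int (phase k (fst z) (snd z))) *
     (osc (phase k (fst z) (snd z)) t * (vdot (fst z) t * v (snd z) t * v (k - fst z - snd z) t
        + 2 * (v (fst z) t * vdot (snd z) t * v (k - fst z - snd z) t)))))"
    unfolding sum_distrib_left[symmetric] by (intro mult_left_mono norm_sum) auto
  also have "\<dots> \<le> (\<Sum>z\<in>nonres N k. cubic_kernel k z * (\<theta> (fst z) * ?\<alpha> (snd z) * ?\<alpha> (k - fst z - snd z))
      + 2 * (cubic_kernel k z * (?\<alpha> (fst z) * \<theta> (snd z) * ?\<alpha> (k - fst z - snd z))))"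
  proof (intro sum_mono)
    fix z assume z: "z \<in> nonres N k"
    note nz = nonresD[OF z]
    define x where "x = fst z" define y where "y = snd z" define u where "u = k - x - y"
    define \<phi> where "\<phi> = phase k x y"
    have x1: "1 \<le> \<bar>real_of_int x\<bar>" using nz by (auto simp: x_def intro!: abs_int_ge_1)
    have "\<bar>real_of_int k\<bar> * cmod (\<i> / (of_int x * of_int \<phi>) * (osc \<phi> t * (vdot x t * v y t * v u t + 2 * (v x t * vdot y t * v u t))))
      = \<bar>real_of_int k\<bar> / (\<bar>of_int x\<bar> * \<bar>of_int \<phi>\<bar>) * cmod (vdot x t * v y t * v u t + 2 * (v x t * vdot y t * v u t))"
      by (simp add: norm_mult norm_divide)
    also have "\<dots> \<le> \<bar>real_of_int k\<bar> / (\<bar>of_int x\<bar> * \<bar>of_int \<phi>\<bar>) * ((\<bar>of_int x\<bar> * \<theta> x) * ?\<alpha> y * ?\<alpha> u + 2 * (?\<alpha> x * (\<bar>of_int y\<bar> * \<theta> y) * ?\<alpha> u))"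
    proof (intro mult_left_mono order_trans[OF norm_triangle_ineq] add_mono)
      have vd: "cmod (vdot j t) \<le> \<bar>of_int j\<bar> * \<theta> j" if "j \<in> modes N" for j
        using cmod_vdot[of j t] \<theta>[OF that] that
        by (smt (verit) in_modes mult_left_mono)
      show "cmod (vdot x t * v y t * v u t) \<le> \<bar>real_of_int x\<bar> * \<theta> x * cmod (v y t) * cmod (v u t)"
        unfolding norm_mult using vd[of x] nz by (intro mult_right_mono) (auto simp: x_def)
      have "cmod (v x t) * cmod (vdot y t) * cmod (v u t) \<le> cmod (v x t) * (\<bar>of_int y\<bar> * \<theta> y) * cmod (v u t)"
        using vd[of y] nz by (intro mult_right_mono mult_left_mono) (auto simp: y_def)
      then show "cmod (2 * (v x t * vdot y t * v u t)) \<le> 2 * (cmod (v x t) * (\<bar>real_of_int y\<bar> * \<theta> y) * cmod (v u t))"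
        by (simp add: norm_mult)
    qed auto
    \<comment> \<open>The factor |x| from \<open>vdot x\<close> cancels the weight 1/|x| and leaves
      the first kernel estimate; |y| from \<open>vdot y\<close> leaves |y|/|x|, the second.\<close>
    also have "\<dots> = \<bar>real_of_int k\<bar> / \<bar>of_int \<phi>\<bar> * (\<theta> x * ?\<alpha> y * ?\<alpha> u) + 2 * (\<bar>real_of_int k\<bar> * \<bar>of_int y\<bar> / (\<bar>of_int x\<bar> * \<bar>of_int \<phi>\<bar>) * (?\<alpha> x * \<theta> y * ?\<alpha> u))"
    proof -
      have "K / (X * F) * ((X * a) * b * c + 2 * (d * (Y * e) * g)) = K / F * (a * b * c) + 2 * (K * Y / (X * F) * (d * e * g))"
        if "X \<noteq> 0" for K X F a b c d Y e g :: real
        using that by (cases "F = 0") (simp_all add: field_simps)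
      from this[of "\<bar>real_of_int x\<bar>"] x1 show ?thesis by simp
    qed
    also have "\<dots> \<le> cubic_kernel k z * (\<theta> x * ?\<alpha> y * ?\<alpha> u) + 2 * (cubic_kernel k z * (?\<alpha> x * \<theta> y * ?\<alpha> u))"
    proof -
      have th: "0 \<le> \<theta> j" if "j \<in> modes N" for j using \<theta>[OF that] by (smt (verit) norm_ge_zero)
      have "0 \<le> \<theta> x * ?\<alpha> y * ?\<alpha> u" "0 \<le> ?\<alpha> x * \<theta> y * ?\<alpha> u"
        using th[of x] th[of y] nz by (auto simp: x_def y_def)
      then show ?thesis
        by (intro add_mono mult_right_mono mult_left_mono cubic_kernel_ge'(1)[OF z, folded x_def y_def, folded \<phi>_def]
            cubic_kernel_ge'(2)[OF z, folded x_def y_def, folded \<phi>_def]) simp_all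
    qed
    finally show "\<bar>real_of_int k\<bar> * cmod (\<i> / (of_int (fst z) * of_int (phase k (fst z) (snd z))) *
     (osc (phase k (fst z) (snd z)) t * (vdot (fst z) t * v (snd z) t * v (k - fst z - snd z) t
        + 2 * (v (fst z) t * vdot (snd z) t * v (k - fst z - snd z) t)))) \<le>
      cubic_kernel k z * (\<theta> (fst z) * ?\<alpha> (snd z) * ?\<alpha> (k - fst z - snd z))
      + 2 * (cubic_kernel k z * (?\<alpha> (fst z) * \<theta> (snd z) * ?\<alpha> (k - fst z - snd z)))"
      unfolding x_def y_def u_def \<phi>_def .
  qed
  also have "\<dots> = maj3 N k \<theta> ?\<alpha> ?\<alpha> + 2 * maj3 N k ?\<alpha> \<theta> ?\<alpha>"
    unfolding maj3_def sum.distrib sum_distrib_left ..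
  finally have 3: "\<bar>real_of_int k\<bar> * cmod ?V \<le> maj3 N k \<theta> ?\<alpha> ?\<alpha> + 2 * maj3 N k ?\<alpha> \<theta> ?\<alpha>" .
  have th: "0 \<le> \<theta> j" if "j \<in> modes N" for j using \<theta>[OF that] by (smt (verit) norm_ge_zero)
  have nn: "0 \<le> maj3 N k \<theta> ?\<alpha> ?\<alpha>" "0 \<le> maj3 N k ?\<alpha> \<theta> ?\<alpha>"
    unfolding maj3_def using th nonresD by (auto intro!: sum_nonneg mult_nonneg_nonneg cubic_kernel_nonneg)
  have nn2: "0 \<le> maj2 N k ?\<alpha> (\<lambda>k. cmod (forcing k t))" unfolding maj2_def by (intro sum_nonneg) auto
  have "cmod (rem N k t) \<le> cmod (- (1 / 3) * ?X) + cmod (\<i> / 6 * resonant N k t) + cmod (\<i> / 6 * ?V)"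
    unfolding rem_def by (intro order_trans[OF norm_triangle_ineq4] add_mono norm_triangle_ineq) auto
  also have "\<dots> = cmod ?X / 3 + cmod (resonant N k t) / 6 + cmod ?V / 6"
    by (simp add: norm_mult norm_divide del: of_int_diff)
  finally have "\<bar>real_of_int k\<bar> * cmod (rem N k t) \<le> \<bar>real_of_int k\<bar> * (cmod ?X / 3 + cmod (resonant N k t) / 6 + cmod ?V / 6)"
    by (rule mult_left_mono) simp
  also have "\<dots> = (\<bar>real_of_int k\<bar> * cmod ?X) / 3 + (\<bar>real_of_int k\<bar> * cmod (resonant N k t)) / 6 + (\<bar>real_of_int k\<bar> * cmod ?V) / 6"
    by (simp add: algebra_simps)
  also have "\<dots> \<le> maj2 N k ?\<alpha> (\<lambda>k. cmod (forcing k t)) / 3 + (3 * M * cmod (v k t)) / 6 + (maj3 N k \<theta> ?\<alpha> ?\<alpha> + 2 * maj3 N k ?\<alpha> \<theta> ?\<alpha>) / 6"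
    by (intro add_mono divide_right_mono 1 3 resonant_bound N k M) auto
  also have "\<dots> \<le> maj2 N k ?\<alpha> (\<lambda>k. cmod (forcing k t)) + M * cmod (v k t) + (maj3 N k \<theta> ?\<alpha> ?\<alpha> + maj3 N k ?\<alpha> \<theta> ?\<alpha>)"
  proof -
    have 0: "0 \<le> M * cmod (v k t)" using m_nonneg[of t] M by simp
    have "X / 3 + 3 * Y / 6 + (A + 2 * B) / 6 \<le> X + Y + (A + B)"
      if "0 \<le> X" "0 \<le> Y" "0 \<le> A" "0 \<le> B" for X Y A B :: real
      using that by (intro add_mono) (auto simp: divide_simps)
    from this[OF nn2 0 nn] show ?thesis by (simp only: mult.assoc)
  qed
  finally show ?thesis .
qed

text \<open>The approximation of w is uniform in its frequency, so the sum over p costs only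
  Cauchy-Schwarz with 1/|p|.\<close>

lemma cmod_err:
  assumes M: "m t \<le> M"
  shows "cmod (err N k t) \<le> (\<bar>of_int k\<bar> * sqrt M + M) * tail N t"
proof -
  have tn: "0 \<le> tail N t" unfolding tail_def using sum_le_m[of "modes N" t] by simp
  have M0: "0 \<le> M" using m_nonneg[of t] M by simp
  have wq: "cmod (w j t - quad N j t (\<lambda>p. v p t)) \<le> 2 * sqrt M * tail N t" for j
  proof -
    have "cmod (w j t - quad N j t (\<lambda>p. v p t)) \<le> 2 * sqrt (m t) * tail N t"
      unfolding tail_def by (rule w_approx)
    also have "\<dots> \<le> 2 * sqrt M * tail N t" using M tn by (intro mult_right_mono) auto
    finally show ?thesis .
  qed
  have "(\<Sum>p\<in>pairs N k. cmod (v p t) * (1 / \<bar>of_int p\<bar>))\<^sup>2 \<le> M * 4"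
    by (rule order_trans[OF Cauchy_Schwarz_ineq_sum])
       (intro mult_mono l2leD[OF l2le_v[OF M]] l2leD[OF l2le_inverse_abs] sum_nonneg M0; simp)
  then have S: "(\<Sum>p\<in>pairs N k. cmod (v p t) * (1 / \<bar>of_int p\<bar>)) \<le> 2 * sqrt M"
    using real_le_rsqrt[of _ "M * 4"] by (simp add: real_sqrt_mult mult.commute)
  have "cmod (\<Sum>p\<in>pairs N k. osc (3 * k * p * (k - p)) t * (v p t * (w (k - p) t - quad N (k - p) t (\<lambda>p. v p t))) / of_int p)
     \<le> (\<Sum>p\<in>pairs N k. cmod (v p t) * (1 / \<bar>of_int p\<bar>) * (2 * sqrt M * tail N t))"
  proof (intro order_trans[OF norm_sum] sum_mono)
    fix p
    have "cmod (osc (3 * k * p * (k - p)) t * (v p t * (w (k - p) t - quad N (k - p) t (\<lambda>p. v p t))) / of_int p)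
      = cmod (v p t) * (1 / \<bar>of_int p\<bar>) * cmod (w (k - p) t - quad N (k - p) t (\<lambda>p. v p t))"
      by (simp add: norm_mult norm_divide)
    also have "\<dots> \<le> cmod (v p t) * (1 / \<bar>of_int p\<bar>) * (2 * sqrt M * tail N t)"
      by (intro mult_left_mono wq) auto
    finally show "cmod (osc (3 * k * p * (k - p)) t * (v p t * (w (k - p) t - quad N (k - p) t (\<lambda>p. v p t))) / of_int p)
      \<le> cmod (v p t) * (1 / \<bar>of_int p\<bar>) * (2 * sqrt M * tail N t)" .
  qed
  also have "\<dots> \<le> 2 * sqrt M * (2 * sqrt M * tail N t)"
    unfolding sum_distrib_right[symmetric] using M0 tn by (intro mult_right_mono S) auto
  also have "\<dots> = 4 * M * tail N t" using M0 by simp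
  finally have 2: "cmod (\<Sum>p\<in>pairs N k. osc (3 * k * p * (k - p)) t * (v p t * (w (k - p) t - quad N (k - p) t (\<lambda>p. v p t))) / of_int p) \<le> 4 * M * tail N t" .
  have "cmod (err N k t) \<le> \<bar>of_int k\<bar> / 2 * cmod (w k t - quad N k t (\<lambda>p. v p t)) +
      1 / 6 * cmod (\<Sum>p\<in>pairs N k. osc (3 * k * p * (k - p)) t * (v p t * (w (k - p) t - quad N (k - p) t (\<lambda>p. v p t))) / of_int p)"
    unfolding err_def by (rule order_trans[OF norm_triangle_ineq]) (simp add: norm_mult norm_divide)
  also have "\<dots> \<le> \<bar>of_int k\<bar> / 2 * (2 * sqrt M * tail N t) + 1 / 6 * (4 * M * tail N t)"
    by (intro add_mono mult_left_mono wq 2) auto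
  also have "\<dots> \<le> (\<bar>of_int k\<bar> * sqrt M + M) * tail N t"
    using M0 tn by (simp add: algebra_simps)
  finally show ?thesis .
qed

end

section \<open>Duhamel formula and pointwise decay\<close>

lemma maj2_pointwise:
  assumes "l2le \<alpha> M" "l2le \<beta> L"
  shows "maj2 N k \<alpha> \<beta> \<le> 4 * sqrt (M * L)"
  using maj2_l2[OF assms, of "{k}" N] real_le_rsqrt[of "maj2 N k \<alpha> \<beta>" "16 * (M * L)"]
  by (simp add: real_sqrt_mult)

lemma maj3_l2_pointwise:
  assumes "l2le \<alpha> M" "l2le \<beta> L" "l2le \<delta> L'"
  shows "maj3 N k \<alpha> \<beta> \<delta> \<le> 32 * sqrt (M * L * L')"
proof -
  have "sqrt 1024 = 32" by (rule real_sqrt_unique) auto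
  then show ?thesis
    using maj3_l2[OF assms, of "{k}" N] real_le_rsqrt[of "maj3 N k \<alpha> \<beta> \<delta>" "1024 * (M * L * L')"]
    by (simp add: real_sqrt_mult)
qed

lemma maj3_add:
  "maj3 N k (\<lambda>j. \<alpha> j + \<alpha>' j) \<beta> \<delta> = maj3 N k \<alpha> \<beta> \<delta> + maj3 N k \<alpha>' \<beta> \<delta>"
  "maj3 N k \<alpha> (\<lambda>j. \<beta> j + \<beta>' j) \<delta> = maj3 N k \<alpha> \<beta> \<delta> + maj3 N k \<alpha> \<beta>' \<delta>"
  by (simp_all add: maj3_def algebra_simps sum.distrib)

definition forcing_mass :: "real \<Rightarrow> real \<Rightarrow> real \<Rightarrow> real" where
  "forcing_mass \<gamma> P M = 2 * P + 2 * (\<gamma>\<^sup>2 * M)"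

definition bdry_const :: "real \<Rightarrow> real \<Rightarrow> real" where
  "bdry_const P M = sqrt P + 4 * sqrt (M * M) + 32 * sqrt (M * M * M)"

text \<open>The terms with \<open>forcing_mass\<close> use the l^2 bound of the forcing; the term 32
  * M * M uses |w_j| \<le> M.\<close>

definition rem_const :: "real \<Rightarrow> real \<Rightarrow> real \<Rightarrow> real" where
  "rem_const \<gamma> P M = 4 * sqrt (M * forcing_mass \<gamma> P M) + M * sqrt M
     + 2 * (32 * sqrt (M * M * forcing_mass \<gamma> P M) + 32 * M * M)"

text \<open>Boundary terms at both ends of the time interval, then the remainder and
  \<open>\<gamma>\<close> times the boundary term, integrated against a kernel of mass at most
  1/\<open>\<gamma>\<close>.\<close>

definition decay_const :: "real \<Rightarrow> real \<Rightarrow> real \<Rightarrow> real" where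
  "decay_const \<gamma> P M = 2 * bdry_const P M + (rem_const \<gamma> P M + \<gamma> * bdry_const P M) / \<gamma>"

text \<open>Cauchy-Schwarz for the measure exp(-\<gamma>(t-r)) dr on [a, t], of mass at most
  1/\<gamma>. It is obtained from 2 l g <= l^2 + g^2 with a constant l, the best choice being l =
  \<gamma> I.\<close>

lemma weighted_Cauchy_Schwarz:
  fixes g :: "real \<Rightarrow> real"
  assumes "0 < \<gamma>" "a \<le> t" and g: "continuous_on {a..t} g"
  shows "(exp (- \<gamma> * t) * integral {a..t} (\<lambda>r. exp (\<gamma> * r) * g r))\<^sup>2
    \<le> 1 / \<gamma> * (exp (- \<gamma> * t) * integral {a..t} (\<lambda>r. exp (\<gamma> * r) * (g r)\<^sup>2))"
proof -
  define I where "I = exp (- \<gamma> * t) * integral {a..t} (\<lambda>r. exp (\<gamma> * r) * g r)"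
  define Q where "Q = exp (- \<gamma> * t) * integral {a..t} (\<lambda>r. exp (\<gamma> * r) * (g r)\<^sup>2)"
  have e: "((\<lambda>r. exp (\<gamma> * r)) has_integral (exp (\<gamma> * t) / \<gamma> - exp (\<gamma> * a) / \<gamma>)) {a..t}"
    using assms by (intro fundamental_theorem_of_calculus) (auto intro!: derivative_eq_intros simp flip: has_real_derivative_iff_has_vector_derivative)
  have J: "exp (- \<gamma> * t) * integral {a..t} (\<lambda>r. exp (\<gamma> * r)) \<le> 1 / \<gamma>"
  proof -
    have "exp (- \<gamma> * t) * integral {a..t} (\<lambda>r. exp (\<gamma> * r)) \<le> exp (- \<gamma> * t) * (exp (\<gamma> * t) / \<gamma>)"
      using integral_unique[OF e] assms by (intro mult_left_mono) auto
    then show ?thesis by (simp add: exp_minus)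
  qed
  have "2 * l * I \<le> l\<^sup>2 / \<gamma> + Q" for l
  proof -
    have "integral {a..t} (\<lambda>r. 2 * l * (exp (\<gamma> * r) * g r)) \<le> integral {a..t} (\<lambda>r. l\<^sup>2 * exp (\<gamma> * r) + exp (\<gamma> * r) * (g r)\<^sup>2)"
    proof (rule integral_le)
      fix r
      have "exp (\<gamma> * r) * (2 * l * g r) \<le> exp (\<gamma> * r) * (l\<^sup>2 + (g r)\<^sup>2)"
        by (intro mult_left_mono sum_squares_bound) auto
      then show "2 * l * (exp (\<gamma> * r) * g r) \<le> l\<^sup>2 * exp (\<gamma> * r) + exp (\<gamma> * r) * (g r)\<^sup>2"
        by (simp add: algebra_simps)
    qed (intro integrable_continuous_real continuous_intros g)+
    also have "\<dots> = l\<^sup>2 * integral {a..t} (\<lambda>r. exp (\<gamma> * r)) + integral {a..t} (\<lambda>r. exp (\<gamma> * r) * (g r)\<^sup>2)"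
      by (subst integral_add) (auto intro!: integrable_continuous_real continuous_intros g)
    finally have "exp (- \<gamma> * t) * (2 * l * integral {a..t} (\<lambda>r. exp (\<gamma> * r) * g r)) \<le>
      exp (- \<gamma> * t) * (l\<^sup>2 * integral {a..t} (\<lambda>r. exp (\<gamma> * r)) + integral {a..t} (\<lambda>r. exp (\<gamma> * r) * (g r)\<^sup>2))"
      by (intro mult_left_mono) auto
    also have "\<dots> = l\<^sup>2 * (exp (- \<gamma> * t) * integral {a..t} (\<lambda>r. exp (\<gamma> * r))) + Q"
      by (simp add: Q_def algebra_simps)
    also have "\<dots> \<le> l\<^sup>2 * (1 / \<gamma>) + Q" by (intro add_mono mult_left_mono J) auto
    finally show ?thesis by (simp add: I_def algebra_simps)
  qed
  from this[of "\<gamma> * I"] have "\<gamma> * I\<^sup>2 \<le> Q" using assms by (simp add: power2_eq_square algebra_simps)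
  then show ?thesis unfolding I_def[symmetric] Q_def[symmetric] using assms by (simp add: field_simps)
qed

lemma weighted_integral_le:
  fixes g :: "real \<Rightarrow> real"
  assumes "0 < \<gamma>" "a \<le> t" and g: "continuous_on {a..t} g" and C: "\<And>r. r \<in> {a..t} \<Longrightarrow> g r \<le> C" "0 \<le> C"
  shows "exp (- \<gamma> * t) * integral {a..t} (\<lambda>r. exp (\<gamma> * r) * g r) \<le> C / \<gamma>"
proof -
  have e: "((\<lambda>r. exp (\<gamma> * r) * C) has_integral (exp (\<gamma> * t) / \<gamma> * C - exp (\<gamma> * a) / \<gamma> * C)) {a..t}"
    using assms by (intro fundamental_theorem_of_calculus) (auto intro!: derivative_eq_intros simp flip: has_real_derivative_iff_has_vector_derivative)
  have "integral {a..t} (\<lambda>r. exp (\<gamma> * r) * g r) \<le> integral {a..t} (\<lambda>r. exp (\<gamma> * r) * C)"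
    using C by (intro integral_le integrable_continuous_real continuous_intros g) auto
  also have "\<dots> \<le> exp (\<gamma> * t) / \<gamma> * C" using integral_unique[OF e] assms by simp
  finally have "exp (- \<gamma> * t) * integral {a..t} (\<lambda>r. exp (\<gamma> * r) * g r) \<le> exp (- \<gamma> * t) * (exp (\<gamma> * t) / \<gamma> * C)"
    by (rule mult_left_mono) simp
  then show ?thesis by (simp add: exp_minus field_simps)
qed

context kdv_modes begin

lemma continuous_on_m [continuous_intros]: "continuous_on A m"
  using mass_cont continuous_on_subset by blast

lemma continuous_on_tail [continuous_intros]: "continuous_on A (tail N)"
  unfolding tail_def by (intro continuous_intros)

lemma continuous_on_forcing [continuous_intros]: "continuous_on A (forcing k)"
  unfolding forcing_def by (intro continuous_intros)

lemma continuous_on_vdot [continuous_intros]: "continuous_on A (vdot k)"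
  unfolding vdot_def by (intro continuous_intros) auto

lemma continuous_on_quad [continuous_intros]: "continuous_on A (\<lambda>t. quad N k t (\<lambda>p. v p t))"
  unfolding quad_def by (intro continuous_intros)

lemma continuous_on_bdry [continuous_intros]: "continuous_on A (bdry N k)"
  unfolding bdry_def bd2_def bd3_def
  by (intro continuous_intros) (auto simp: pairs_def in_modes simp flip: of_int_diff)

lemma continuous_on_rem [continuous_intros]: "continuous_on A (rem N k)"
  unfolding rem_def resonant_def
  by (intro continuous_intros) (auto simp: pairs_def triples_def in_modes simp flip: of_int_diff)

lemma continuous_on_err [continuous_intros]: "continuous_on A (err N k)"
  unfolding err_def
  by (intro continuous_intros) (auto simp: pairs_def in_modes)

lemma tail_nonneg: "0 \<le> tail N t"
  unfolding tail_def using sum_le_m[of "modes N" t] by simp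

lemma tail_le: "m t \<le> M \<Longrightarrow> tail N t \<le> sqrt M"
  unfolding tail_def using sum_nonneg[of "modes N" "\<lambda>k. (cmod (v k t))\<^sup>2"] by simp

lemma tail_tendsto: "(\<lambda>N. tail N t) \<longlonglongrightarrow> 0"
proof -
  have "(\<lambda>N. \<Sum>k\<in>modes N. (cmod (v k t))\<^sup>2) \<longlonglongrightarrow> m t"
    using freqs_tendsto[OF mass[of t]] sum_freqs_modes[of "\<lambda>k. (cmod (v k t))\<^sup>2"] by (simp add: v_zero)
  then have "(\<lambda>N. tail N t) \<longlonglongrightarrow> sqrt (m t - m t)"
    unfolding tail_def by (intro tendsto_intros)
  then show ?thesis by simp
qed

text \<open>The tails tend to 0 at each time and are at most sqrt M, so dominated convergence
  applies; uniformity in time is not asserted. The exponent is written \<open>Suc n\<close> to keep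
  it positive.\<close>

lemma tail_integral_tendsto:
  assumes M: "\<And>r. r \<in> {a..t} \<Longrightarrow> m r \<le> M" and g: "continuous_on {a..t} g"
  shows "(\<lambda>N. integral {a..t} (\<lambda>r. g r * (tail N r) ^ Suc n)) \<longlonglongrightarrow> 0"
proof -
  have "(\<lambda>N. integral {a..t} (\<lambda>r. g r * (tail N r) ^ Suc n)) \<longlonglongrightarrow> integral {a..t} (\<lambda>r. 0)"
  proof (rule dominated_convergence(2))
    show "(\<lambda>r. g r * (tail N r) ^ Suc n) integrable_on {a..t}" for N
      by (intro integrable_continuous_real continuous_intros g)
    show "(\<lambda>r. \<bar>g r\<bar> * sqrt M ^ Suc n) integrable_on {a..t}"
      by (intro integrable_continuous_real continuous_intros g)
    show "norm (g r * (tail N r) ^ Suc n) \<le> \<bar>g r\<bar> * sqrt M ^ Suc n" if "r \<in> {a..t}" for r N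
      using tail_le[OF M[OF that]] tail_nonneg m_nonneg[of r] M[OF that]
      by (auto simp: abs_mult power_abs intro!: mult_left_mono mult_mono power_mono)
    show "(\<lambda>N. g r * (tail N r) ^ Suc n) \<longlonglongrightarrow> 0" if "r \<in> {a..t}" for r
      using tendsto_mult_right_zero[OF tendsto_null_power[OF tail_tendsto]] by blast
  qed
  then show ?thesis by simp
qed

text \<open>Up to a unimodular factor, the k-th coefficient of u(t) minus the damped free evolution
  of u(a) from time a.\<close>

definition dev :: "real \<Rightarrow> int \<Rightarrow> real \<Rightarrow> complex" where
  "dev a k t = v k t - of_real (exp (- \<gamma> * (t - a))) * v k a"

text \<open>The integrating factor exp(\<gamma> r) is applied to \<open>v - bdry\<close>: it cancels
  -\<gamma> v and leaves -\<gamma> times \<open>bdry\<close>. The left-hand side does not contain N,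
  which allows the limit in N later.\<close>

lemma duhamel:
  assumes k: "k \<noteq> 0" and t: "a \<le> t"
  shows "dev a k t = bdry N k t - of_real (exp (- \<gamma> * (t - a))) * bdry N k a
    + of_real (exp (- \<gamma> * t)) * integral {a..t} (\<lambda>r. of_real (exp (\<gamma> * r)) * (rem N k r + err N k r - of_real \<gamma> * bdry N k r))"
proof -
  have "((\<lambda>r. of_real (exp (\<gamma> * r)) * (rem N k r + err N k r - of_real \<gamma> * bdry N k r)) has_integral
     (of_real (exp (\<gamma> * t)) * (v k t - bdry N k t) - of_real (exp (\<gamma> * a)) * (v k a - bdry N k a))) {a..t}"
  proof (rule fundamental_theorem_of_calculus[OF t])
    fix r assume "r \<in> {a..t}"
    have "((\<lambda>r. complex_of_real (exp (\<gamma> * r))) has_vector_derivative of_real (\<gamma> * exp (\<gamma> * r))) (at r)"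
      by (auto intro!: derivative_eq_intros has_vector_derivative_of_real simp flip: has_real_derivative_iff_has_vector_derivative)
    then have "((\<lambda>r. of_real (exp (\<gamma> * r)) * (v k r - bdry N k r)) has_vector_derivative
      (of_real (exp (\<gamma> * r)) * (- of_real \<gamma> * v k r + rem N k r + err N k r) + of_real (\<gamma> * exp (\<gamma> * r)) * (v k r - bdry N k r))) (at r)"
      by (intro has_vector_derivative_mult normal_form k)
    then have "((\<lambda>r. of_real (exp (\<gamma> * r)) * (v k r - bdry N k r)) has_vector_derivative
      of_real (exp (\<gamma> * r)) * (rem N k r + err N k r - of_real \<gamma> * bdry N k r)) (at r)"
      by (rule back_subst) (simp add: algebra_simps)
    then show "((\<lambda>r. of_real (exp (\<gamma> * r)) * (v k r - bdry N k r)) has_vector_derivative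
      of_real (exp (\<gamma> * r)) * (rem N k r + err N k r - of_real \<gamma> * bdry N k r)) (at r within {a..t})"
      by (rule has_vector_derivative_at_within)
  qed
  note I = integral_unique[OF this]
  have e1: "complex_of_real (exp (- \<gamma> * t)) * of_real (exp (\<gamma> * t)) = 1"
    by (simp flip: of_real_mult exp_add)
  have e2: "complex_of_real (exp (- \<gamma> * t)) * of_real (exp (\<gamma> * a)) = of_real (exp (- \<gamma> * (t - a)))"
    by (simp add: algebra_simps flip: of_real_mult exp_add)
  show ?thesis unfolding I dev_def
    unfolding right_diff_distrib mult.assoc[symmetric] e1 e2 by simp
qed

lemma cmod_dev:
  assumes k: "k \<noteq> 0" and t: "a \<le> t"
  shows "cmod (dev a k t) \<le> cmod (bdry N k t) + cmod (bdry N k a)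
    + exp (- \<gamma> * t) * integral {a..t} (\<lambda>r. exp (\<gamma> * r) * (cmod (rem N k r) + \<gamma> * cmod (bdry N k r)))
    + exp (- \<gamma> * t) * integral {a..t} (\<lambda>r. exp (\<gamma> * r) * cmod (err N k r))"
proof -
  let ?I = "integral {a..t} (\<lambda>r. complex_of_real (exp (\<gamma> * r)) * (rem N k r + err N k r - of_real \<gamma> * bdry N k r))"
  have "cmod ?I \<le> integral {a..t} (\<lambda>r. exp (\<gamma> * r) * (cmod (rem N k r) + \<gamma> * cmod (bdry N k r)) + exp (\<gamma> * r) * cmod (err N k r))"
  proof (rule integral_norm_bound_integral)
    fix r
    have "cmod (rem N k r + err N k r - of_real \<gamma> * bdry N k r) \<le> cmod (rem N k r) + cmod (err N k r) + cmod (of_real \<gamma> * bdry N k r)"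
      by (intro order_trans[OF norm_triangle_ineq4] add_mono norm_triangle_ineq) auto
    then have "exp (\<gamma> * r) * cmod (rem N k r + err N k r - of_real \<gamma> * bdry N k r)
      \<le> exp (\<gamma> * r) * (cmod (rem N k r) + cmod (err N k r) + cmod (of_real \<gamma> * bdry N k r))"
      by (rule mult_left_mono) simp
    then show "cmod (complex_of_real (exp (\<gamma> * r)) * (rem N k r + err N k r - of_real \<gamma> * bdry N k r))
      \<le> exp (\<gamma> * r) * (cmod (rem N k r) + \<gamma> * cmod (bdry N k r)) + exp (\<gamma> * r) * cmod (err N k r)"
      using \<gamma>_pos by (simp only: norm_mult norm_of_real abs_exp_cancel) (simp add: distrib_left ac_simps)
  qed (intro integrable_continuous_real continuous_intros)+
  also have "\<dots> = integral {a..t} (\<lambda>r. exp (\<gamma> * r) * (cmod (rem N k r) + \<gamma> * cmod (bdry N k r)))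
    + integral {a..t} (\<lambda>r. exp (\<gamma> * r) * cmod (err N k r))"
    by (rule integral_add) (intro integrable_continuous_real continuous_intros)+
  finally have I: "exp (- \<gamma> * t) * cmod ?I \<le> exp (- \<gamma> * t) * (integral {a..t} (\<lambda>r. exp (\<gamma> * r) * (cmod (rem N k r) + \<gamma> * cmod (bdry N k r)))
    + integral {a..t} (\<lambda>r. exp (\<gamma> * r) * cmod (err N k r)))"
    by (rule mult_left_mono) simp
  have e: "exp (- \<gamma> * (t - a)) * cmod (bdry N k a) \<le> 1 * cmod (bdry N k a)"
    using t \<gamma>_pos by (intro mult_right_mono) auto
  have "cmod (dev a k t) \<le> cmod (bdry N k t) + cmod (of_real (exp (- \<gamma> * (t - a))) * bdry N k a) + cmod (of_real (exp (- \<gamma> * t)) * ?I)"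
    unfolding duhamel[OF k t, of N] by (intro order_trans[OF norm_triangle_ineq] add_mono norm_triangle_ineq4) auto
  also have "\<dots> = cmod (bdry N k t) + exp (- \<gamma> * (t - a)) * cmod (bdry N k a) + exp (- \<gamma> * t) * cmod ?I"
    by (simp add: norm_mult)
  finally show ?thesis using I e unfolding distrib_left by linarith
qed

text \<open>Here k is fixed, so the growth of the error bound in |k| is harmless.\<close>

lemma err_integral_tendsto:
  assumes M: "\<And>r. r \<in> {a..t} \<Longrightarrow> m r \<le> M"
  shows "(\<lambda>N. exp (- \<gamma> * t) * integral {a..t} (\<lambda>r. exp (\<gamma> * r) * cmod (err N k r))) \<longlonglongrightarrow> 0"
proof (rule tendsto_sandwich[OF _ _ tendsto_const])
  show "\<forall>\<^sub>F N in sequentially. 0 \<le> exp (- \<gamma> * t) * integral {a..t} (\<lambda>r. exp (\<gamma> * r) * cmod (err N k r))"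
    by (intro always_eventually allI mult_nonneg_nonneg integral_nonneg integrable_continuous_real continuous_intros) auto
  show "\<forall>\<^sub>F N in sequentially. exp (- \<gamma> * t) * integral {a..t} (\<lambda>r. exp (\<gamma> * r) * cmod (err N k r))
     \<le> exp (- \<gamma> * t) * integral {a..t} (\<lambda>r. (exp (\<gamma> * r) * (\<bar>of_int k\<bar> * sqrt M + M)) * tail N r ^ Suc 0)"
  proof (intro always_eventually allI mult_left_mono integral_le)
    fix N r assume r: "r \<in> {a..t}"
    have "exp (\<gamma> * r) * cmod (err N k r) \<le> exp (\<gamma> * r) * ((\<bar>of_int k\<bar> * sqrt M + M) * tail N r)"
      by (intro mult_left_mono cmod_err M r) auto
    then show "exp (\<gamma> * r) * cmod (err N k r) \<le> (exp (\<gamma> * r) * (\<bar>of_int k\<bar> * sqrt M + M)) * tail N r ^ Suc 0"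
      by (simp add: mult.assoc)
  qed (intro integrable_continuous_real continuous_intros | simp)+
  show "(\<lambda>N. exp (- \<gamma> * t) * integral {a..t} (\<lambda>r. (exp (\<gamma> * r) * (\<bar>of_int k\<bar> * sqrt M + M)) * tail N r ^ Suc 0)) \<longlonglongrightarrow> 0"
    by (intro tendsto_mult_right_zero tail_integral_tendsto[OF M] continuous_intros)
qed

lemma bdry_pointwise:
  assumes k: "k \<noteq> 0" and M: "m t \<le> M"
  shows "\<bar>of_int k\<bar> * cmod (bdry N k t) \<le> bdry_const P M"
  unfolding bdry_const_def
  by (intro order_trans[OF cmod_bdry[OF k]] add_mono maj2_pointwise maj3_l2_pointwise l2le_v M real_le_rsqrt l2le_pointwise[OF f_bound])

text \<open>\<open>\<theta>\<close> is taken as forcing plus w and split by \<open>maj3_add\<close>: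
  the forcing is measured in l^2, w in the sup norm.\<close>

lemma rem_pointwise:
  assumes k: "k \<noteq> 0" and N: "N \<ge> 2 * nat \<bar>k\<bar>" and M: "m t \<le> M"
  shows "\<bar>of_int k\<bar> * cmod (rem N k t) \<le> rem_const \<gamma> P M"
proof -
  have M0: "0 \<le> M" using m_nonneg[of t] M by simp
  let ?Q = "forcing_mass \<gamma> P M" and ?\<alpha> = "\<lambda>k. cmod (v k t)" and ?\<phi> = "\<lambda>k. cmod (forcing k t)" and ?\<omega> = "\<lambda>k. cmod (w k t)"
  have Q: "l2le ?\<phi> ?Q" unfolding forcing_mass_def by (rule l2le_forcing[OF M])
  have W: "?\<omega> j \<le> M" for j using w_bound M order_trans by blast
  note \<alpha> = l2le_v[OF M]
  have t1: "maj3 N k (\<lambda>j. ?\<phi> j + ?\<omega> j) ?\<alpha> ?\<alpha> \<le> 32 * sqrt (?Q * M * M) + 32 * M * M"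
    unfolding maj3_add by (intro add_mono maj3_l2_pointwise maj3_pointwise \<alpha> Q W M0) auto
  have t2: "maj3 N k ?\<alpha> (\<lambda>j. ?\<phi> j + ?\<omega> j) ?\<alpha> \<le> 32 * sqrt (M * ?Q * M) + 32 * M * M"
    unfolding maj3_add by (intro add_mono maj3_l2_pointwise maj3_pointwise \<alpha> Q W M0) auto
  have t3: "maj2 N k ?\<alpha> ?\<phi> \<le> 4 * sqrt (M * ?Q)" by (intro maj2_pointwise \<alpha> Q)
  have t4: "M * cmod (v k t) \<le> M * sqrt M" by (intro mult_left_mono cmod_v_le M M0)
  have "\<bar>of_int k\<bar> * cmod (rem N k t) \<le> 4 * sqrt (M * ?Q) + M * sqrt M + ((32 * sqrt (?Q * M * M) + 32 * M * M) + (32 * sqrt (M * ?Q * M) + 32 * M * M))"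
    by (rule order_trans[OF cmod_rem[OF k N M order_refl]]) (intro add_mono t1 t2 t3 t4)
  also have "\<dots> = rem_const \<gamma> P M"
    unfolding rem_const_def by (simp add: ac_simps)
  finally show ?thesis .
qed

text \<open>The input of the quartic estimate: decay 1/|k| of the deviation from the bound M on the
  mass, which also bounds w. The inequality holds for all large N up to the truncation error, which
  vanishes in the limit.\<close>

lemma dev_decay:
  assumes k: "k \<noteq> 0" and t: "a \<le> t" and M: "\<And>r. r \<in> {a..t} \<Longrightarrow> m r \<le> M"
  shows "\<bar>of_int k\<bar> * cmod (dev a k t) \<le> decay_const \<gamma> P M"
proof -
  let ?K = "\<bar>real_of_int k\<bar>"
  let ?E = "\<lambda>N. exp (- \<gamma> * t) * integral {a..t} (\<lambda>r. exp (\<gamma> * r) * cmod (err N k r))"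
  have ev: "?K * cmod (dev a k t) \<le> decay_const \<gamma> P M + ?K * ?E N" if N: "N \<ge> 2 * nat \<bar>k\<bar>" for N
  proof -
    let ?I = "\<lambda>g. exp (- \<gamma> * t) * integral {a..t} (\<lambda>r. exp (\<gamma> * r) * g r)"
    have "?K * ?I (\<lambda>r. cmod (rem N k r) + \<gamma> * cmod (bdry N k r)) = ?I (\<lambda>r. ?K * cmod (rem N k r) + \<gamma> * (?K * cmod (bdry N k r)))"
      by (simp add: algebra_simps flip: integral_mult_right)
    also have "\<dots> \<le> (rem_const \<gamma> P M + \<gamma> * bdry_const P M) / \<gamma>"
    proof (rule weighted_integral_le[OF \<gamma>_pos t])
      show le: "?K * cmod (rem N k r) + \<gamma> * (?K * cmod (bdry N k r)) \<le> rem_const \<gamma> P M + \<gamma> * bdry_const P M"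
        if "r \<in> {a..t}" for r
        using \<gamma>_pos by (intro add_mono mult_left_mono rem_pointwise bdry_pointwise k N M that) auto
      \<comment> \<open>Nonnegativity of the constant is read off from the bound itself at r =
        t.\<close>
      have "0 \<le> ?K * cmod (rem N k t) + \<gamma> * (?K * cmod (bdry N k t))" using \<gamma>_pos by simp
      with le[of t] t show "0 \<le> rem_const \<gamma> P M + \<gamma> * bdry_const P M" by simp
    qed (intro continuous_intros)
    finally have I: "?K * ?I (\<lambda>r. cmod (rem N k r) + \<gamma> * cmod (bdry N k r)) \<le> (rem_const \<gamma> P M + \<gamma> * bdry_const P M) / \<gamma>" .
    have b: "?K * cmod (bdry N k t) \<le> bdry_const P M" "?K * cmod (bdry N k a) \<le> bdry_const P M"
      using t by (auto intro!: bdry_pointwise k M)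
    have "?K * cmod (dev a k t) \<le> ?K * (cmod (bdry N k t) + cmod (bdry N k a) + ?I (\<lambda>r. cmod (rem N k r) + \<gamma> * cmod (bdry N k r)) + ?E N)"
      by (intro mult_left_mono cmod_dev k t) auto
    also have "\<dots> = ?K * cmod (bdry N k t) + ?K * cmod (bdry N k a) + ?K * ?I (\<lambda>r. cmod (rem N k r) + \<gamma> * cmod (bdry N k r)) + ?K * ?E N"
      by (simp only: distrib_left)
    also have "\<dots> \<le> bdry_const P M + bdry_const P M + (rem_const \<gamma> P M + \<gamma> * bdry_const P M) / \<gamma> + ?K * ?E N"
      by (intro add_mono b I order_refl)
    finally show ?thesis unfolding decay_const_def by simp
  qed
  have "(\<lambda>N. decay_const \<gamma> P M + ?K * ?E N) \<longlonglongrightarrow> decay_const \<gamma> P M + ?K * 0"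
    by (intro tendsto_intros err_integral_tendsto[OF M])
  then show ?thesis
    by (intro LIMSEQ_le_const[of "\<lambda>N. decay_const \<gamma> P M + ?K * ?E N"]) (use ev in auto)
qed

end

section \<open>The quartic estimate\<close>

lemma cis_int_periodic: "cis (of_int n * (x + 2 * pi)) = cis (of_int n * x)"
proof -
  have "cis (of_int n * (2 * pi)) = 1"
    using cis_multiple_2pi[of "of_int n"] by (simp add: ac_simps)
  then show ?thesis by (simp add: distrib_left flip: cis_mult)
qed

lemma cis_has_integral:
  "((\<lambda>x. cis (of_int n * x)) has_integral (if n = 0 then 2 * pi else 0)) {c..c + 2 * pi}"
proof (cases "n = 0")
  case True
  then show ?thesis using has_integral_const_real[of "1::complex" c "c + 2 * pi"]
    by (simp add: scaleR_conv_of_real)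
next
  case False
  have "((\<lambda>x. cis (of_int n * x)) has_integral
     (cis (of_int n * (c + 2 * pi)) / (\<i> * of_int n) - cis (of_int n * c) / (\<i> * of_int n))) {c..c + 2 * pi}"
  proof (rule fundamental_theorem_of_calculus)
    fix x
    show "((\<lambda>x. cis (of_int n * x) / (\<i> * of_int n)) has_vector_derivative cis (of_int n * x)) (at x within {c..c + 2 * pi})"
      unfolding has_vector_derivative_def using False
      by (auto intro!: derivative_eq_intros simp: fun_eq_iff scaleR_conv_of_real field_simps)
  qed simp
  then show ?thesis using False by (simp add: cis_int_periodic)
qed

text \<open>Frequencies of different indices may coincide, hence the double sum; this matters for
  integration in time, where p and k - p give the same phase.\<close>

lemma trig_square_has_integral:
  fixes n :: "'a \<Rightarrow> int" and g :: "'a \<Rightarrow> complex"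
  assumes K: "finite K"
  shows "((\<lambda>x. (cmod (\<Sum>k\<in>K. g k * cis (of_int (n k) * x)))\<^sup>2) has_integral
    2 * pi * Re (\<Sum>j\<in>K. \<Sum>k\<in>K. if n j = n k then g j * cnj (g k) else 0)) {c..c + 2 * pi}"
proof -
  have "((\<lambda>x. \<Sum>j\<in>K. \<Sum>k\<in>K. g j * cnj (g k) * cis (of_int (n j - n k) * x)) has_integral
     (\<Sum>j\<in>K. \<Sum>k\<in>K. g j * cnj (g k) * (if n j - n k = 0 then 2 * pi else 0))) {c..c + 2 * pi}"
    by (intro has_integral_sum K has_integral_mult_right cis_has_integral)
  also have "(\<lambda>x. \<Sum>j\<in>K. \<Sum>k\<in>K. g j * cnj (g k) * cis (of_int (n j - n k) * x)) =
      (\<lambda>x. complex_of_real ((cmod (\<Sum>k\<in>K. g k * cis (of_int (n k) * x)))\<^sup>2))"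
  proof
    fix x
    have "complex_of_real ((cmod (\<Sum>k\<in>K. g k * cis (of_int (n k) * x)))\<^sup>2) =
       (\<Sum>j\<in>K. g j * cis (of_int (n j) * x)) * (\<Sum>k\<in>K. cnj (g k) * cis (- (of_int (n k) * x)))"
      unfolding complex_norm_square by (simp add: cis_cnj)
    also have "\<dots> = (\<Sum>j\<in>K. \<Sum>k\<in>K. g j * cnj (g k) * cis (of_int (n j - n k) * x))"
      unfolding sum_product
    proof (intro sum.cong refl)
      fix j k
      have c: "cis (of_int (n j) * x) * cis (- (of_int (n k) * x)) = cis (of_int (n j - n k) * x)"
        by (simp add: cis_mult left_diff_distrib)
      show "g j * cis (of_int (n j) * x) * (cnj (g k) * cis (- (of_int (n k) * x))) = g j * cnj (g k) * cis (of_int (n j - n k) * x)"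
        unfolding c[symmetric] by (simp only: ac_simps)
    qed
    finally show "(\<Sum>j\<in>K. \<Sum>k\<in>K. g j * cnj (g k) * cis (of_int (n j - n k) * x)) =
      complex_of_real ((cmod (\<Sum>k\<in>K. g k * cis (of_int (n k) * x)))\<^sup>2)" ..
  qed
  also have "(\<Sum>j\<in>K. \<Sum>k\<in>K. g j * cnj (g k) * (if n j - n k = 0 then 2 * pi else 0)) =
     of_real (2 * pi) * (\<Sum>j\<in>K. \<Sum>k\<in>K. if n j = n k then g j * cnj (g k) else 0)"
    unfolding sum_distrib_left by (intro sum.cong refl) auto
  finally have "((\<lambda>x. Re (complex_of_real ((cmod (\<Sum>k\<in>K. g k * cis (of_int (n k) * x)))\<^sup>2))) has_integral
     Re (of_real (2 * pi) * (\<Sum>j\<in>K. \<Sum>k\<in>K. if n j = n k then g j * cnj (g k) else 0))) {c..c + 2 * pi}"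
    by (rule has_integral_linear[OF _ bounded_linear_Re, unfolded o_def])
  moreover have "Re (of_real (2 * pi) * z) = 2 * pi * Re z" for z by simp
  ultimately show ?thesis by (simp only: Re_complex_of_real)
qed

lemma trig_parseval:
  assumes K: "finite K"
  shows "((\<lambda>x. (cmod (\<Sum>k\<in>K. g k * cis (of_int k * x)))\<^sup>2) has_integral 2 * pi * (\<Sum>k\<in>K. (cmod (g k))\<^sup>2)) {c..c + 2 * pi}"
proof -
  have "Re (\<Sum>j\<in>K. \<Sum>k\<in>K. if j = k then g j * cnj (g k) else 0) = (\<Sum>k\<in>K. (cmod (g k))\<^sup>2)"
    using K by (simp flip: complex_norm_square)
  then show ?thesis using trig_square_has_integral[OF K, of g "\<lambda>k. k" c] by simp
qed

lemma fourth_power_sum_le: "((x::real) + y) ^ 4 \<le> 8 * (x ^ 4 + y ^ 4)"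
proof -
  have "(x + y)\<^sup>2 \<le> 2 * (x\<^sup>2 + y\<^sup>2)"
    using sum_squares_bound[of x y] by (simp add: power2_sum)
  then have "((x + y)\<^sup>2)\<^sup>2 \<le> (2 * (x\<^sup>2 + y\<^sup>2))\<^sup>2" by (intro power_mono) auto
  also have "\<dots> \<le> 8 * ((x\<^sup>2)\<^sup>2 + (y\<^sup>2)\<^sup>2)"
    using sum_squares_bound[of "x\<^sup>2" "y\<^sup>2"] by (simp add: power_mult_distrib power2_sum)
  finally show ?thesis by (simp flip: power_mult)
qed

text \<open>Contains every p + q with p, q in \<open>modes N\<close>, hence all frequencies of the
  square of a truncated function.\<close>

definition all_modes :: "nat \<Rightarrow> int set" where
  "all_modes N = {- int (2 * N)..int (2 * N)}"

lemma finite_all_modes [simp]: "finite (all_modes N)"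
  by (simp add: all_modes_def)

text \<open>The function of x with interaction-picture coefficients b at time t. The coefficients of
  its square are given by \<open>quad\<close> up to unimodular factors, so the l^2 norm of
  \<open>quad\<close> is an L^4 norm.\<close>

definition wave :: "nat \<Rightarrow> real \<Rightarrow> (int \<Rightarrow> complex) \<Rightarrow> real \<Rightarrow> complex" where
  "wave N t b x = (\<Sum>p\<in>modes N. osc (- (p ^ 3)) t * b p * cis (of_int p * x))"

lemma wave_square:
  "(wave N t b x)\<^sup>2 = (\<Sum>k\<in>all_modes N. osc (- (k ^ 3)) t * quad N k t b * cis (of_int k * x))"
proof -
  let ?h = "\<lambda>p. osc (- (p ^ 3)) t * b p * cis (of_int p * x)"
  have "(wave N t b x)\<^sup>2 = (\<Sum>z\<in>modes N \<times> modes N. ?h (fst z) * ?h (snd z))"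
    unfolding wave_def power2_eq_square sum_product sum.cartesian_product by (simp add: split_def)
  also have "\<dots> = (\<Sum>z\<in>Sigma (all_modes N) (pairs N). ?h (snd z) * ?h (fst z - snd z))"
    by (rule sum.reindex_bij_witness[of _ "\<lambda>z. (snd z, fst z - snd z)" "\<lambda>z. (fst z + snd z, fst z)"])
       (auto simp: all_modes_def pairs_def in_modes)
  also have "\<dots> = (\<Sum>k\<in>all_modes N. \<Sum>p\<in>pairs N k. ?h p * ?h (k - p))"
    by (subst sum.Sigma) (auto simp: split_def)
  also have "\<dots> = (\<Sum>k\<in>all_modes N. osc (- (k ^ 3)) t * quad N k t b * cis (of_int k * x))"
    unfolding quad_def sum_distrib_left sum_distrib_right
  proof (intro sum.cong refl)
    fix k p
    have "osc (- (p ^ 3)) t * osc (- ((k - p) ^ 3)) t = osc (- (k ^ 3)) t * osc (3 * k * p * (k - p)) t"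
      unfolding osc_add by (rule arg_cong[of _ _ "\<lambda>n. osc n t"]) (simp add: power3_eq_cube algebra_simps)
    moreover have "cis (of_int p * x) * cis (of_int (k - p) * x) = cis (of_int k * x)"
      by (simp add: cis_mult algebra_simps)
    moreover have "(a * c * d) * (a' * c' * d') = (a * a') * (c * c') * (d * d')" for a c d a' c' d' :: complex
      by (simp add: ac_simps)
    ultimately show "?h p * ?h (k - p) = osc (- (k ^ 3)) t * (osc (3 * k * p * (k - p)) t * (b p * b (k - p))) * cis (of_int k * x)"
      by (simp add: ac_simps)
  qed
  finally show ?thesis .
qed

lemma wave_fourth:
  "((\<lambda>x. (cmod (wave N t b x)) ^ 4) has_integral 2 * pi * (\<Sum>k\<in>all_modes N. (cmod (quad N k t b))\<^sup>2)) {0..0 + 2 * pi}"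
proof -
  have "(cmod (wave N t b x)) ^ 4 = (cmod (\<Sum>k\<in>all_modes N. (osc (- (k ^ 3)) t * quad N k t b) * cis (of_int k * x)))\<^sup>2" for x
    by (simp add: norm_power flip: wave_square power_mult)
  then show ?thesis using trig_parseval[OF finite_all_modes, of "\<lambda>k. osc (- (k ^ 3)) t * quad N k t b" N 0]
    by (simp add: norm_mult)
qed

text \<open>\<open>quad\<close> is quadratic, not additive; its argument is split inside the L^4
  norm of the wave, where (x+y)^4 <= 8 (x^4 + y^4) applies.\<close>

lemma quad_add_le:
  "(\<Sum>k\<in>all_modes N. (cmod (quad N k t (\<lambda>p. b p + d p)))\<^sup>2)
    \<le> 8 * ((\<Sum>k\<in>all_modes N. (cmod (quad N k t b))\<^sup>2) + (\<Sum>k\<in>all_modes N. (cmod (quad N k t d))\<^sup>2))"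
proof -
  let ?S = "\<lambda>b. \<Sum>k\<in>all_modes N. (cmod (quad N k t b))\<^sup>2"
  have "2 * pi * ?S (\<lambda>p. b p + d p) \<le> 8 * (2 * pi * ?S b + 2 * pi * ?S d)"
  proof (rule has_integral_le[OF wave_fourth has_integral_mult_right[OF has_integral_add[OF wave_fourth wave_fourth]]])
    fix x
    have "wave N t (\<lambda>p. b p + d p) x = wave N t b x + wave N t d x"
      by (simp add: wave_def algebra_simps sum.distrib)
    then have "(cmod (wave N t (\<lambda>p. b p + d p) x)) ^ 4 \<le> (cmod (wave N t b x) + cmod (wave N t d x)) ^ 4"
      by (simp add: power_mono norm_triangle_ineq)
    also note fourth_power_sum_le
    finally show "(cmod (wave N t (\<lambda>p. b p + d p) x)) ^ 4 \<le> 8 * ((cmod (wave N t b x)) ^ 4 + (cmod (wave N t d x)) ^ 4)" .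
  qed
  then have "2 * pi * ?S (\<lambda>p. b p + d p) \<le> 2 * pi * (8 * (?S b + ?S d))" by (simp add: algebra_simps)
  then show ?thesis by (rule mult_left_le_imp_le) simp
qed

text \<open>As a function of p the phase 3kp(k-p) takes each value only at p and k - p, two indices
  with equal coefficients. Orthogonality over one period in time therefore costs only a factor 2. At
  k = 0 all phases vanish, which is why that mode is excluded.\<close>

lemma quad_square_integral_le:
  assumes k: "k \<noteq> 0"
  shows "integral {c..c + 2 * pi} (\<lambda>t. (cmod (quad N k t b))\<^sup>2) \<le> 4 * pi * (\<Sum>p\<in>pairs N k. (cmod (b p) * cmod (b (k - p)))\<^sup>2)"
proof -
  let ?n = "\<lambda>p. - (3 * k * p * (k - p))" and ?g = "\<lambda>p. b p * b (k - p)"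
  have eq: "?n p = ?n q \<longleftrightarrow> q = p \<or> q = k - p" for p q
  proof -
    have "?n p = ?n q \<longleftrightarrow> k * ((q - p) * (q + p - k)) = 0" by algebra
    also have "\<dots> \<longleftrightarrow> q = p \<or> q = k - p" using k by auto
    finally show ?thesis .
  qed
  have "quad N k t b = (\<Sum>p\<in>pairs N k. ?g p * cis (of_int (?n p) * t))" for t
    unfolding quad_def osc_def by (intro sum.cong refl) (simp add: mult.commute)
  then have "integral {c..c + 2 * pi} (\<lambda>t. (cmod (quad N k t b))\<^sup>2) =
     2 * pi * Re (\<Sum>p\<in>pairs N k. \<Sum>q\<in>pairs N k. if ?n p = ?n q then ?g p * cnj (?g q) else 0)"
    using integral_unique[OF trig_square_has_integral[OF finite_pairs[of N k], of ?g ?n c]] by (simp only:)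
  also have "\<dots> \<le> 2 * pi * (\<Sum>p\<in>pairs N k. 2 * (cmod (b p) * cmod (b (k - p)))\<^sup>2)"
  proof (rule mult_left_mono)
    show "Re (\<Sum>p\<in>pairs N k. \<Sum>q\<in>pairs N k. if ?n p = ?n q then ?g p * cnj (?g q) else 0)
     \<le> (\<Sum>p\<in>pairs N k. 2 * (cmod (b p) * cmod (b (k - p)))\<^sup>2)"
    unfolding Re_sum
  proof (intro sum_mono)
    fix p assume p: "p \<in> pairs N k"
    have "(\<Sum>q\<in>pairs N k. Re (if ?n p = ?n q then ?g p * cnj (?g q) else 0)) \<le> (\<Sum>q\<in>pairs N k. if q \<in> {p, k - p} then (cmod (?g p))\<^sup>2 else 0)"
    proof (intro sum_mono)
      fix q
      show "Re (if ?n p = ?n q then ?g p * cnj (?g q) else 0) \<le> (if q \<in> {p, k - p} then (cmod (?g p))\<^sup>2 else 0)"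
      proof (cases "q \<in> {p, k - p}")
        case True
        then have "?g q = ?g p" by auto
        then show ?thesis using True by (auto simp: eq simp flip: complex_norm_square simp del: complex_cnj_mult)
      next
        case False
        then have "(?n p = ?n q) = False" using eq by blast
        then show ?thesis using False by (simp only: if_False) simp
      qed
    qed
    also have "\<dots> = (\<Sum>q\<in>pairs N k \<inter> {p, k - p}. (cmod (?g p))\<^sup>2)"
      by (rule sum.inter_restrict[symmetric]) simp
    also have "\<dots> \<le> 2 * (cmod (?g p))\<^sup>2"
    proof -
      have "card (pairs N k \<inter> {p, k - p}) \<le> card {p, k - p}" by (rule card_mono) auto
      also have "\<dots> \<le> 2" by (simp add: card_insert_if)
      finally show ?thesis by (simp add: mult_right_mono)
    qed
    finally show "(\<Sum>q\<in>pairs N k. Re (if ?n p = ?n q then ?g p * cnj (?g q) else 0)) \<le> 2 * (cmod (b p) * cmod (b (k - p)))\<^sup>2"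
      by (simp add: norm_mult)
    qed
  qed simp
  finally show ?thesis unfolding sum_distrib_left[symmetric] by simp
qed

lemma continuous_on_quad_const [continuous_intros]: "continuous_on A (\<lambda>t. quad N k t b)"
  unfolding quad_def by (intro continuous_intros)

text \<open>Here 6 pi = 2 pi + 4 pi: the mode k = 0 does not oscillate and is bounded by M at each
  time; for the other modes orthogonality leaves a sum in the independent coordinates p and k -
  p.\<close>

lemma linear_strichartz:
  assumes b: "l2le (\<lambda>k. cmod (b k)) M"
  shows "integral {c..c + 2 * pi} (\<lambda>t. \<Sum>k\<in>all_modes N. (cmod (quad N k t b))\<^sup>2) \<le> 6 * pi * M\<^sup>2"
proof -
  have M0: "0 \<le> M" using b by (rule l2le_nonneg)
  have b': "l2le (\<lambda>k. cmod (b (- k))) M" using b by (rule l2le_uminus)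
  have "integral {c..c + 2 * pi} (\<lambda>t. \<Sum>k\<in>all_modes N. (cmod (quad N k t b))\<^sup>2) =
    (\<Sum>k\<in>all_modes N. integral {c..c + 2 * pi} (\<lambda>t. (cmod (quad N k t b))\<^sup>2))"
    by (intro integral_sum integrable_continuous_real continuous_intros) auto
  also have "\<dots> = integral {c..c + 2 * pi} (\<lambda>t. (cmod (quad N 0 t b))\<^sup>2) + (\<Sum>k\<in>all_modes N - {0}. integral {c..c + 2 * pi} (\<lambda>t. (cmod (quad N k t b))\<^sup>2))"
    by (rule sum.remove) (auto simp: all_modes_def)
  also have "integral {c..c + 2 * pi} (\<lambda>t. (cmod (quad N 0 t b))\<^sup>2) \<le> integral {c..c + 2 * pi} (\<lambda>t. M\<^sup>2)"
  proof (intro integral_le power_mono)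
    fix t
    have "cmod (quad N 0 t b) \<le> (\<Sum>p\<in>pairs N 0. cmod (b p) * cmod (b (- p)))"
      unfolding quad_def by (intro order_trans[OF norm_sum] sum_mono) (simp add: norm_mult)
    also have "\<dots> \<le> M" by (intro sum_amgm l2leD[OF b] l2leD[OF b'] finite_pairs)
    finally show "cmod (quad N 0 t b) \<le> M" .
  qed (intro integrable_continuous_real continuous_intros | simp)+
  also have "(\<Sum>k\<in>all_modes N - {0}. integral {c..c + 2 * pi} (\<lambda>t. (cmod (quad N k t b))\<^sup>2)) \<le>
      (\<Sum>k\<in>all_modes N - {0}. 4 * pi * (\<Sum>p\<in>pairs N k. (cmod (b p) * cmod (b (k - p)))\<^sup>2))"
    by (intro sum_mono quad_square_integral_le) auto
  also have "\<dots> = 4 * pi * (\<Sum>z\<in>Sigma (all_modes N - {0}) (pairs N). (cmod (b (snd z)) * cmod (b (fst z - snd z)))\<^sup>2)"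
    by (simp add: sum_distrib_left[symmetric] sum.Sigma split_def)
  also have "\<dots> \<le> 4 * pi * (M * M)"
    by (intro mult_left_mono sum_prod2_le[OF b b]) (auto simp: inj_on_def prod_eq_iff)
  finally show ?thesis by (simp add: power2_eq_square algebra_simps)
qed

text \<open>The squares are |n|^(-5/4), and 5/4 > 1. The two signs are treated separately so that
  the absolute value is injective on each part.\<close>

lemma l2le_inverse_powr: "\<exists>Z. l2le (\<lambda>n. \<bar>of_int n\<bar> powr (-5/8)) Z"
proof -
  have sm: "summable (\<lambda>n. real n powr (-5/4))" by (simp add: summable_real_powr_iff)
  define Z where "Z = 2 * (\<Sum>n. real n powr (-5/4))"
  have "l2le (\<lambda>n. \<bar>of_int n\<bar> powr (-5/8)) Z"
    unfolding l2le_def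
  proof (intro allI impI)
    fix F :: "int set" assume F: "finite F"
    have sq: "(\<bar>real_of_int n\<bar> powr (-5/8))\<^sup>2 = real (nat \<bar>n\<bar>) powr (-5/4)" for n
      by (simp add: power2_eq_square flip: powr_add)
    have part: "(\<Sum>n\<in>G. real (nat \<bar>n\<bar>) powr (-5/4)) \<le> (\<Sum>n. real n powr (-5/4))" if "inj_on (\<lambda>n. nat \<bar>n\<bar>) G" "finite G" for G :: "int set"
    proof -
      have "(\<Sum>n\<in>G. real (nat \<bar>n\<bar>) powr (-5/4)) = (\<Sum>n\<in>(\<lambda>n. nat \<bar>n\<bar>) ` G. real n powr (-5/4))"
        by (subst sum.reindex[OF that(1)]) simp
      also have "\<dots> \<le> (\<Sum>n. real n powr (-5/4))"
        using that by (intro sum_le_suminf sm) auto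
      finally show ?thesis .
    qed
    have "(\<Sum>n\<in>F. (\<bar>real_of_int n\<bar> powr (-5/8))\<^sup>2) = (\<Sum>n\<in>F \<inter> {0..}. real (nat \<bar>n\<bar>) powr (-5/4)) + (\<Sum>n\<in>F - {0..}. real (nat \<bar>n\<bar>) powr (-5/4))"
      unfolding sq by (rule sum.Int_Diff[OF F])
    also have "\<dots> \<le> Z"
      unfolding Z_def mult_2 by (intro add_mono part) (use F in \<open>auto simp: inj_on_def\<close>)
    finally show "(\<Sum>n\<in>F. (\<bar>real_of_int n\<bar> powr (-5/8))\<^sup>2) \<le> Z" .
  qed
  then show ?thesis ..
qed

text \<open>Any admissible bound serves: an absolute constant may enter C freely.\<close>

definition zeta_const :: real where
  "zeta_const = (SOME Z. l2le (\<lambda>n. \<bar>of_int n\<bar> powr (-5/8)) Z)"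

lemma l2le_zeta: "l2le (\<lambda>n. \<bar>of_int n\<bar> powr (-5/8)) zeta_const"
  unfolding zeta_const_def by (rule someI_ex[OF l2le_inverse_powr])

text \<open>
  Splitting \<open>1/n = n\<^sup>-\<^sup>5\<^sup>/\<^sup>8 n\<^sup>-\<^sup>3\<^sup>/\<^sup>8\<close> in the Cauchy-Schwarz inequality leaves only sums of \<open>n\<^sup>-\<^sup>5\<^sup>/\<^sup>4\<close> and \<open>n\<^sup>-\<^sup>3\<^sup>/\<^sup>2\<close>.
\<close>

lemma quad_decay:
  assumes d: "\<And>p. p \<noteq> 0 \<Longrightarrow> \<bar>of_int p\<bar> * cmod (d p) \<le> C"
  shows "(\<Sum>k\<in>all_modes N. (cmod (quad N k t d))\<^sup>2) \<le> C ^ 4 * zeta_const ^ 3"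
proof -
  let ?g = "\<lambda>n::int. \<bar>real_of_int n\<bar> powr (-5/8)" and ?h = "\<lambda>n::int. \<bar>real_of_int n\<bar> powr (-3/8)"
  let ?Z = zeta_const
  have C0: "0 \<le> C" using order_trans[OF _ d[of 1]] by simp
  have Z0: "0 \<le> ?Z" using l2le_zeta by (rule l2le_nonneg)
  have gp: "\<bar>real_of_int p\<bar> powr (-3/4) \<le> ?g p" if "p \<noteq> 0" for p
    using abs_int_ge_1[OF that] by (intro powr_mono) auto
  have k: "(cmod (quad N k t d))\<^sup>2 \<le> C ^ 4 * ?Z * (\<Sum>p\<in>pairs N k. (?g p * ?g (k - p))\<^sup>2)" for k
  proof -
    have "(\<Sum>p\<in>pairs N k. (?h p * ?h (k - p))\<^sup>2) \<le> (\<Sum>p\<in>pairs N k. ?g p * ?g (k - p))"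
    proof (intro sum_mono)
      fix p assume "p \<in> pairs N k"
      then have nz: "p \<noteq> 0" "k - p \<noteq> 0" by (auto simp: pairs_def in_modes)
      have h: "(?h p)\<^sup>2 = \<bar>real_of_int p\<bar> powr (-3/4)" for p by (simp add: power2_eq_square flip: powr_add)
      show "(?h p * ?h (k - p))\<^sup>2 \<le> ?g p * ?g (k - p)"
        unfolding power_mult_distrib h by (intro mult_mono gp nz) auto
    qed
    also have "\<dots> \<le> ?Z"
    proof (rule sum_amgm)
      show "(\<Sum>p\<in>pairs N k. (?g p)\<^sup>2) \<le> ?Z" by (intro l2leD[OF l2le_zeta] finite_pairs)
      have "(\<Sum>p\<in>pairs N k. (?g (k - p))\<^sup>2) = (\<Sum>p\<in>pairs N k. (?g p)\<^sup>2)"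
        using sum_pairs_swap[of "\<lambda>p q. (?g q)\<^sup>2" k N] by simp
      then show "(\<Sum>p\<in>pairs N k. (?g (k - p))\<^sup>2) \<le> ?Z" using l2leD[OF l2le_zeta finite_pairs, of N k] by simp
    qed
    finally have H: "(\<Sum>p\<in>pairs N k. (?h p * ?h (k - p))\<^sup>2) \<le> ?Z" .
    have "cmod (quad N k t d) \<le> (\<Sum>p\<in>pairs N k. C\<^sup>2 * ((?g p * ?g (k - p)) * (?h p * ?h (k - p))))"
      unfolding quad_def
    proof (intro order_trans[OF norm_sum] sum_mono)
      fix p assume "p \<in> pairs N k"
      then have nz: "p \<noteq> 0" "k - p \<noteq> 0" by (auto simp: pairs_def in_modes)
      have dd: "cmod (d p) \<le> C * (?g p * ?h p)" if "p \<noteq> 0" for p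
      proof -
        have gh: "?g p * ?h p = 1 / \<bar>of_int p\<bar>"
          using that by (simp add: powr_minus_divide flip: powr_add)
        have "0 < \<bar>real_of_int p\<bar>" using that by simp
        then show ?thesis unfolding gh using d[OF that] by (simp add: pos_le_divide_eq mult.commute)
      qed
      have "cmod (osc (3 * k * p * (k - p)) t * (d p * d (k - p))) = cmod (d p) * cmod (d (k - p))" by (simp add: norm_mult)
      also have "\<dots> \<le> (C * (?g p * ?h p)) * (C * (?g (k - p) * ?h (k - p)))"
        using C0 by (intro mult_mono dd nz) auto
      finally show "cmod (osc (3 * k * p * (k - p)) t * (d p * d (k - p))) \<le> C\<^sup>2 * ((?g p * ?g (k - p)) * (?h p * ?h (k - p)))"
        by (simp add: power2_eq_square ac_simps)
    qed
    then have "(cmod (quad N k t d))\<^sup>2 \<le> (\<Sum>p\<in>pairs N k. C\<^sup>2 * ((?g p * ?g (k - p)) * (?h p * ?h (k - p))))\<^sup>2"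
      by (intro power_mono) auto
    also have "\<dots> = C ^ 4 * (\<Sum>p\<in>pairs N k. (?g p * ?g (k - p)) * (?h p * ?h (k - p)))\<^sup>2"
      unfolding sum_distrib_left[symmetric] power_mult_distrib by (simp flip: power_mult)
    also have "\<dots> \<le> C ^ 4 * ((\<Sum>p\<in>pairs N k. (?g p * ?g (k - p))\<^sup>2) * (\<Sum>p\<in>pairs N k. (?h p * ?h (k - p))\<^sup>2))"
      using C0 by (intro mult_left_mono Cauchy_Schwarz_ineq_sum) auto
    also have "\<dots> \<le> C ^ 4 * ((\<Sum>p\<in>pairs N k. (?g p * ?g (k - p))\<^sup>2) * ?Z)"
      using C0 by (intro mult_left_mono H sum_nonneg) auto
    finally show ?thesis by (simp only: ac_simps)
  qed
  have "(\<Sum>k\<in>all_modes N. (cmod (quad N k t d))\<^sup>2) \<le> (\<Sum>k\<in>all_modes N. C ^ 4 * ?Z * (\<Sum>p\<in>pairs N k. (?g p * ?g (k - p))\<^sup>2))"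
    by (intro sum_mono k)
  also have "\<dots> = C ^ 4 * ?Z * (\<Sum>z\<in>Sigma (all_modes N) (pairs N). (?g (snd z) * ?g (fst z - snd z))\<^sup>2)"
    unfolding sum_distrib_left[symmetric] by (subst sum.Sigma) (auto simp: split_def)
  also have "\<dots> \<le> C ^ 4 * ?Z * (?Z * ?Z)"
  proof (rule mult_left_mono)
    have "inj_on (\<lambda>z. (snd z, fst z - snd z)) (Sigma (all_modes N) (pairs N))"
      by (auto simp: inj_on_def prod_eq_iff)
    then show "(\<Sum>z\<in>Sigma (all_modes N) (pairs N). (?g (snd z) * ?g (fst z - snd z))\<^sup>2) \<le> ?Z * ?Z"
      by (intro sum_prod2_le[OF l2le_zeta l2le_zeta, of _ snd "\<lambda>z. fst z - snd z"]) simp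
    show "0 \<le> C ^ 4 * ?Z" using C0 Z0 by simp
  qed
  also have "\<dots> = C ^ 4 * ?Z ^ 3" by (simp only: power3_eq_cube mult.assoc)
  finally show ?thesis .
qed

text \<open>The factor 16 is 8 from splitting v into free part and deviation, times 2 from passing
  from \<open>quad\<close> to w. The two summands belong to the free wave and to the part decaying
  like 1/|k|.\<close>

definition strichartz_const :: "real \<Rightarrow> real \<Rightarrow> real \<Rightarrow> real" where
  "strichartz_const \<gamma> P M = 16 * ((3 / \<gamma> + 6 * pi) * M\<^sup>2 + (decay_const \<gamma> P M) ^ 4 * zeta_const ^ 3 / \<gamma>)"

text \<open>The interval is covered by at most (t-a)/(2 pi) + 1 whole periods; the linear growth in
  t - a is absorbed by the exponential, since x exp(-\<gamma> x) <= 1/\<gamma>.\<close>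

lemma linear_strichartz_weighted:
  assumes b: "l2le (\<lambda>k. cmod (b k)) M" and "0 < \<gamma>" "a \<le> t"
  shows "exp (- \<gamma> * (t - a)) * integral {a..t} (\<lambda>t. \<Sum>k\<in>all_modes N. (cmod (quad N k t b))\<^sup>2) \<le> (3 / \<gamma> + 6 * pi) * M\<^sup>2"
proof -
  let ?q = "\<lambda>t. \<Sum>k\<in>all_modes N. (cmod (quad N k t b))\<^sup>2"
  have M0: "0 \<le> M" using b by (rule l2le_nonneg)
  have cont: "?q integrable_on {c..d}" for c d by (intro integrable_continuous_real continuous_intros)
  have steps: "integral {a..a + 2 * pi * real n} ?q \<le> real n * (6 * pi * M\<^sup>2)" for n
  proof (induction n)
    case (Suc n)
    have "integral {a..a + 2 * pi * real (Suc n)} ?q = integral {a..a + 2 * pi * real n} ?q + integral {a + 2 * pi * real n..a + 2 * pi * real (Suc n)} ?q"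
      by (intro Henstock_Kurzweil_Integration.integral_combine[symmetric] cont) auto
    also have "integral {a + 2 * pi * real n..a + 2 * pi * real (Suc n)} ?q \<le> 6 * pi * M\<^sup>2"
      using linear_strichartz[OF b, of "a + 2 * pi * real n" N] by (simp add: algebra_simps)
    finally show ?case using Suc by (simp add: algebra_simps)
  qed simp
  define n where "n = nat \<lceil>(t - a) / (2 * pi)\<rceil>"
  have n0: "0 \<le> (t - a) / (2 * pi)" using assms by simp
  have n1: "(t - a) / (2 * pi) \<le> real n" unfolding n_def by (rule real_nat_ceiling_ge)
  have n2: "real n \<le> (t - a) / (2 * pi) + 1" unfolding n_def using n0 by linarith
  have "t \<le> a + 2 * pi * real n" using n1 by (simp add: field_simps)
  then have "integral {a..t} ?q \<le> integral {a..a + 2 * pi * real n} ?q"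
    by (intro integral_subset_le cont) (auto intro!: sum_nonneg)
  also have "\<dots> \<le> real n * (6 * pi * M\<^sup>2)" by (rule steps)
  also have "\<dots> \<le> ((t - a) / (2 * pi) + 1) * (6 * pi * M\<^sup>2)" using n2 by (intro mult_right_mono) auto
  also have "\<dots> = 3 * (t - a) * M\<^sup>2 + 6 * pi * M\<^sup>2" by (simp add: field_simps)
  finally have "exp (- \<gamma> * (t - a)) * integral {a..t} ?q \<le> exp (- \<gamma> * (t - a)) * (3 * (t - a) * M\<^sup>2 + 6 * pi * M\<^sup>2)"
    by (rule mult_left_mono) simp
  also have "\<dots> = 3 * M\<^sup>2 * (exp (- \<gamma> * (t - a)) * (t - a)) + 6 * pi * M\<^sup>2 * exp (- \<gamma> * (t - a))"
    by (simp add: algebra_simps)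
  also have "\<dots> \<le> 3 * M\<^sup>2 * (1 / \<gamma>) + 6 * pi * M\<^sup>2 * 1"
  proof (intro add_mono mult_left_mono)
    have "\<gamma> * (t - a) \<le> exp (\<gamma> * (t - a))" using exp_ge_add_one_self[of "\<gamma> * (t - a)"] by linarith
    then have "exp (- \<gamma> * (t - a)) * (\<gamma> * (t - a)) \<le> exp (- \<gamma> * (t - a)) * exp (\<gamma> * (t - a))"
      by (rule mult_left_mono) simp
    also have "\<dots> = 1" by (simp flip: exp_add)
    finally show "exp (- \<gamma> * (t - a)) * (t - a) \<le> 1 / \<gamma>"
      using assms by (simp add: pos_le_divide_eq ac_simps)
  qed (use assms in auto)
  finally show ?thesis by (simp add: field_simps)
qed

context kdv_modes begin

text \<open>v(r) is the damped free part exp(-\<gamma>(r-a)) v(a) plus \<open>dev\<close>; the first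
  is treated by the linear estimate, the second by \<open>quad_decay\<close> at each time. Neither
  bound depends on N.\<close>

lemma omega_truncated:
  assumes t: "a \<le> t" and M: "\<And>r. r \<in> {a..t} \<Longrightarrow> m r \<le> M"
  shows "exp (- \<gamma> * t) * integral {a..t} (\<lambda>r. exp (\<gamma> * r) * (\<Sum>k\<in>all_modes N. (cmod (quad N k r (\<lambda>p. v p r)))\<^sup>2))
    \<le> 8 * ((3 / \<gamma> + 6 * pi) * M\<^sup>2 + (decay_const \<gamma> P M) ^ 4 * zeta_const ^ 3 / \<gamma>)"
proof -
  let ?q = "\<lambda>r b. \<Sum>k\<in>all_modes N. (cmod (quad N k r b))\<^sup>2"
  let ?C = "(decay_const \<gamma> P M) ^ 4 * zeta_const ^ 3"
  have le: "exp (\<gamma> * r) * ?q r (\<lambda>p. v p r) \<le> 8 * exp (\<gamma> * a) * ?q r (\<lambda>p. v p a) + 8 * (exp (\<gamma> * r) * ?C)"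
    if r: "r \<in> {a..t}" for r
  proof -
    define e where "e = exp (- \<gamma> * (r - a))"
    have e: "0 \<le> e" "e \<le> 1" using r \<gamma>_pos by (auto simp: e_def)
    have "?q r (\<lambda>p. v p r) = ?q r (\<lambda>p. of_real e * v p a + dev a p r)"
      by (simp add: dev_def e_def)
    also have "\<dots> \<le> 8 * (?q r (\<lambda>p. of_real e * v p a) + ?q r (\<lambda>p. dev a p r))"
      by (rule quad_add_le)
    also have "?q r (\<lambda>p. dev a p r) \<le> ?C"
      using r M by (intro quad_decay dev_decay) auto
    also have "?q r (\<lambda>p. of_real e * v p a) = e ^ 4 * ?q r (\<lambda>p. v p a)"
    proof -
      have "quad N k r (\<lambda>p. of_real e * v p a) = of_real (e\<^sup>2) * quad N k r (\<lambda>p. v p a)" for k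
        unfolding quad_def sum_distrib_left by (intro sum.cong refl) (simp add: power2_eq_square ac_simps)
      moreover have "(cmod (of_real (e\<^sup>2) * z))\<^sup>2 = e ^ 4 * (cmod z)\<^sup>2" for z
        by (simp add: norm_mult norm_power power_mult_distrib flip: power_mult)
      ultimately show ?thesis by (simp only: sum_distrib_left)
    qed
    finally have "exp (\<gamma> * r) * ?q r (\<lambda>p. v p r) \<le> exp (\<gamma> * r) * (8 * (e ^ 4 * ?q r (\<lambda>p. v p a) + ?C))"
      by (intro mult_left_mono) auto
    also have "\<dots> = 8 * ((exp (\<gamma> * r) * e ^ 4) * ?q r (\<lambda>p. v p a)) + 8 * (exp (\<gamma> * r) * ?C)"
      by (simp add: algebra_simps)
    \<comment> \<open>One of the four decay factors turns the weight exp(\<gamma> r) into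
      exp(\<gamma> a), independent of r; the other three are dropped.\<close>
    also have "exp (\<gamma> * r) * e ^ 4 \<le> exp (\<gamma> * r) * e ^ 1"
      using e by (intro mult_left_mono power_decreasing) auto
    also have "exp (\<gamma> * r) * e ^ 1 = exp (\<gamma> * a)"
      by (simp add: e_def algebra_simps flip: exp_add)
    finally show ?thesis by (simp add: mult_right_mono mult_left_mono sum_nonneg mult.assoc)
  qed
  have "integral {a..t} (\<lambda>r. exp (\<gamma> * r) * ?q r (\<lambda>p. v p r)) \<le> integral {a..t} (\<lambda>r. 8 * exp (\<gamma> * a) * ?q r (\<lambda>p. v p a) + 8 * (exp (\<gamma> * r) * ?C))"
    by (intro integral_le le integrable_continuous_real continuous_intros)
  also have "\<dots> = 8 * exp (\<gamma> * a) * integral {a..t} (\<lambda>r. ?q r (\<lambda>p. v p a)) + 8 * integral {a..t} (\<lambda>r. exp (\<gamma> * r) * ?C)"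
    by (subst integral_add) (auto intro!: integrable_continuous_real continuous_intros)
  finally have "exp (- \<gamma> * t) * integral {a..t} (\<lambda>r. exp (\<gamma> * r) * ?q r (\<lambda>p. v p r))
    \<le> exp (- \<gamma> * t) * (8 * exp (\<gamma> * a) * integral {a..t} (\<lambda>r. ?q r (\<lambda>p. v p a)) + 8 * integral {a..t} (\<lambda>r. exp (\<gamma> * r) * ?C))"
    by (rule mult_left_mono) simp
  also have "\<dots> = 8 * ((exp (- \<gamma> * t) * exp (\<gamma> * a)) * integral {a..t} (\<lambda>r. ?q r (\<lambda>p. v p a)))
     + 8 * (exp (- \<gamma> * t) * integral {a..t} (\<lambda>r. exp (\<gamma> * r) * ?C))"
    by (simp only: distrib_left ac_simps)
  also have "exp (- \<gamma> * t) * exp (\<gamma> * a) = exp (- \<gamma> * (t - a))" by (simp add: algebra_simps flip: exp_add)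
  also have "8 * (exp (- \<gamma> * (t - a)) * integral {a..t} (\<lambda>r. ?q r (\<lambda>p. v p a))) + 8 * (exp (- \<gamma> * t) * integral {a..t} (\<lambda>r. exp (\<gamma> * r) * ?C))
     \<le> 8 * ((3 / \<gamma> + 6 * pi) * M\<^sup>2) + 8 * (?C / \<gamma>)"
  proof (intro add_mono mult_left_mono)
    show "exp (- \<gamma> * (t - a)) * integral {a..t} (\<lambda>r. ?q r (\<lambda>p. v p a)) \<le> (3 / \<gamma> + 6 * pi) * M\<^sup>2"
      by (intro linear_strichartz_weighted l2le_v M \<gamma>_pos t) (use t in auto)
    have "0 \<le> zeta_const" using l2le_zeta by (rule l2le_nonneg)
    then show "exp (- \<gamma> * t) * integral {a..t} (\<lambda>r. exp (\<gamma> * r) * ?C) \<le> ?C / \<gamma>"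
      by (intro weighted_integral_le[OF \<gamma>_pos t]) auto
  qed auto
  finally show ?thesis by (simp add: algebra_simps)
qed

text \<open>The modes counted by J are fixed while N tends to infinity: the error is their number
  times the squared tail and vanishes for each J, whereas the bound for \<open>quad\<close> is
  uniform in N. Hence the result is uniform in J.\<close>

lemma omega_integral:
  assumes t: "a \<le> t" and M: "\<And>r. r \<in> {a..t} \<Longrightarrow> m r \<le> M"
  shows "exp (- \<gamma> * t) * integral {a..t} (\<lambda>r. exp (\<gamma> * r) * (\<Sum>k\<in>modes J. (cmod (w k r))\<^sup>2)) \<le> strichartz_const \<gamma> P M"
proof -
  let ?L = "exp (- \<gamma> * t) * integral {a..t} (\<lambda>r. exp (\<gamma> * r) * (\<Sum>k\<in>modes J. (cmod (w k r))\<^sup>2))"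
  let ?T = "\<lambda>N. exp (- \<gamma> * t) * integral {a..t} (\<lambda>r. (exp (\<gamma> * r) * (card (modes J) * (8 * M))) * tail N r ^ Suc 1)"
  have M0: "0 \<le> M" using m_nonneg[of t] M[of t] t by simp
  have ev: "?L \<le> strichartz_const \<gamma> P M + ?T N" if N: "N \<ge> J" for N
  proof -
    let ?q = "\<lambda>r. \<Sum>k\<in>all_modes N. (cmod (quad N k r (\<lambda>p. v p r)))\<^sup>2"
    have "integral {a..t} (\<lambda>r. exp (\<gamma> * r) * (\<Sum>k\<in>modes J. (cmod (w k r))\<^sup>2))
      \<le> integral {a..t} (\<lambda>r. 2 * (exp (\<gamma> * r) * ?q r) + (exp (\<gamma> * r) * (card (modes J) * (8 * M))) * tail N r ^ Suc 1)"
    proof (rule integral_le)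
      fix r assume r: "r \<in> {a..t}"
      have "(cmod (w k r))\<^sup>2 \<le> 2 * (cmod (quad N k r (\<lambda>p. v p r)))\<^sup>2 + 8 * M * (tail N r)\<^sup>2" for k
      proof -
        let ?d = "w k r - quad N k r (\<lambda>p. v p r)"
        have "cmod ?d \<le> 2 * sqrt (m r) * tail N r" unfolding tail_def by (rule w_approx)
        also have "\<dots> \<le> 2 * sqrt M * tail N r" using M[OF r] tail_nonneg by (intro mult_right_mono) auto
        finally have "(cmod ?d)\<^sup>2 \<le> (2 * sqrt M * tail N r)\<^sup>2" by (intro power_mono) auto
        then have d: "(cmod ?d)\<^sup>2 \<le> 4 * M * (tail N r)\<^sup>2" using M0 by (simp add: power_mult_distrib)
        have "cmod (w k r) \<le> cmod (quad N k r (\<lambda>p. v p r)) + cmod ?d"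
          using norm_triangle_ineq[of "quad N k r (\<lambda>p. v p r)" ?d] by simp
        then have "(cmod (w k r))\<^sup>2 \<le> (cmod (quad N k r (\<lambda>p. v p r)) + cmod ?d)\<^sup>2" by (intro power_mono) auto
        also have "\<dots> \<le> 2 * (cmod (quad N k r (\<lambda>p. v p r)))\<^sup>2 + 2 * (cmod ?d)\<^sup>2"
          by (rule square_sum_le)
        finally show ?thesis using d by simp
      qed
      then have "(\<Sum>k\<in>modes J. (cmod (w k r))\<^sup>2) \<le> (\<Sum>k\<in>modes J. 2 * (cmod (quad N k r (\<lambda>p. v p r)))\<^sup>2 + 8 * M * (tail N r)\<^sup>2)"
        by (rule sum_mono)
      also have "\<dots> = 2 * (\<Sum>k\<in>modes J. (cmod (quad N k r (\<lambda>p. v p r)))\<^sup>2) + card (modes J) * (8 * M * (tail N r)\<^sup>2)"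
        by (simp add: sum.distrib sum_distrib_left)
      also have "\<dots> \<le> 2 * ?q r + card (modes J) * (8 * M * (tail N r)\<^sup>2)"
        using N M0 by (intro add_mono mult_left_mono sum_mono2) (auto simp: all_modes_def in_modes)
      finally have "exp (\<gamma> * r) * (\<Sum>k\<in>modes J. (cmod (w k r))\<^sup>2) \<le> exp (\<gamma> * r) * (2 * ?q r + card (modes J) * (8 * M * (tail N r)\<^sup>2))"
        by (rule mult_left_mono) simp
      also have "\<dots> = 2 * (exp (\<gamma> * r) * ?q r) + (exp (\<gamma> * r) * (card (modes J) * (8 * M))) * tail N r ^ Suc 1"
        by (simp add: power2_eq_square algebra_simps)
      finally show "exp (\<gamma> * r) * (\<Sum>k\<in>modes J. (cmod (w k r))\<^sup>2) \<le> 2 * (exp (\<gamma> * r) * ?q r) + (exp (\<gamma> * r) * (card (modes J) * (8 * M))) * tail N r ^ Suc 1" .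
    qed (intro integrable_continuous_real continuous_intros)+
    also have "\<dots> = 2 * integral {a..t} (\<lambda>r. exp (\<gamma> * r) * ?q r) + integral {a..t} (\<lambda>r. (exp (\<gamma> * r) * (card (modes J) * (8 * M))) * tail N r ^ Suc 1)"
      by (subst integral_add) (auto intro!: integrable_continuous_real continuous_intros)
    finally have "?L \<le> exp (- \<gamma> * t) * (2 * integral {a..t} (\<lambda>r. exp (\<gamma> * r) * ?q r) + integral {a..t} (\<lambda>r. (exp (\<gamma> * r) * (card (modes J) * (8 * M))) * tail N r ^ Suc 1))"
      by (rule mult_left_mono) simp
    also have "\<dots> = 2 * (exp (- \<gamma> * t) * integral {a..t} (\<lambda>r. exp (\<gamma> * r) * ?q r)) + ?T N"
      by (simp only: distrib_left ac_simps)
    finally show ?thesis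
      using omega_truncated[OF t M, of N] unfolding strichartz_const_def by linarith
  qed
  have "?T \<longlonglongrightarrow> exp (- \<gamma> * t) * 0"
    by (intro tendsto_mult tendsto_const tail_integral_tendsto[OF M] continuous_intros)
  then have "(\<lambda>N. strichartz_const \<gamma> P M + ?T N) \<longlonglongrightarrow> strichartz_const \<gamma> P M + 0"
    by (intro tendsto_add tendsto_const) simp
  then show ?thesis
    by (intro LIMSEQ_le_const[of "\<lambda>N. strichartz_const \<gamma> P M + ?T N"]) (use ev in auto)
qed

end

section \<open>Sobolev estimate\<close>

definition bdry_l2_const :: "real \<Rightarrow> real \<Rightarrow> real" where
  "bdry_l2_const P M = 4 * (P + 16 * (M * M) + 1024 * (M * M * M))"

text \<open>The part of the bound that does not involve w; 4096 = 2 * 2 * 1024, for two cubic terms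
  with twice \<open>forcing_mass\<close> in each.\<close>

definition rem_l2_const :: "real \<Rightarrow> real \<Rightarrow> real \<Rightarrow> real" where
  "rem_l2_const \<gamma> P M = 4 * (16 * (M * forcing_mass \<gamma> P M) + M\<^sup>2 * M + 4096 * (M * M * forcing_mass \<gamma> P M))"

text \<open>The outer 4 comes from squaring a sum of four terms: two boundary values, the time
  integral and the truncation error. The last 1/\<open>\<gamma>\<close> is due to
  \<open>weighted_Cauchy_Schwarz\<close>, the inner one to integrating a constant; 32768 is twice
  the 16384 of \<open>rem_l2\<close>.\<close>

definition sobolev_const :: "real \<Rightarrow> real \<Rightarrow> real \<Rightarrow> real" where
  "sobolev_const \<gamma> P M = 4 * (2 * bdry_l2_const P M +
     ((2 * rem_l2_const \<gamma> P M + 2 * (\<gamma>\<^sup>2 * bdry_l2_const P M)) / \<gamma> + 32768 * M\<^sup>2 * strichartz_const \<gamma> P M) / \<gamma>)"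

context kdv_modes begin

text \<open>w is cut off to \<open>modes N\<close> because only finite sums of |w_j|^2 enter, and
  their bound comes after integration in time.\<close>

lemma l2le_theta:
  assumes "m t \<le> M"
  shows "l2le (\<lambda>j. cmod (forcing j t) + (if j \<in> modes N then cmod (w j t) else 0))
    (2 * forcing_mass \<gamma> P M + 2 * (\<Sum>j\<in>modes N. (cmod (w j t))\<^sup>2))"
proof (rule l2le_add)
  show "l2le (\<lambda>j. cmod (forcing j t)) (forcing_mass \<gamma> P M)"
    unfolding forcing_mass_def by (rule l2le_forcing[OF assms])
  show "l2le (\<lambda>j. if j \<in> modes N then cmod (w j t) else 0) (\<Sum>j\<in>modes N. (cmod (w j t))\<^sup>2)"
    unfolding l2le_def
  proof (intro allI impI)
    fix F :: "int set" assume F: "finite F"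
    have "(\<Sum>j\<in>F. (if j \<in> modes N then cmod (w j t) else 0)\<^sup>2) = (\<Sum>j\<in>F \<inter> modes N. (cmod (w j t))\<^sup>2)"
      unfolding sum.inter_restrict[OF F] by (intro sum.cong) auto
    also have "\<dots> \<le> (\<Sum>j\<in>modes N. (cmod (w j t))\<^sup>2)" by (intro sum_mono2) auto
    finally show "(\<Sum>j\<in>F. (if j \<in> modes N then cmod (w j t) else 0)\<^sup>2) \<le> (\<Sum>j\<in>modes N. (cmod (w j t))\<^sup>2)" .
  qed
qed

lemma bdry_l2:
  assumes M: "m t \<le> M" and K: "finite K" "0 \<notin> K"
  shows "(\<Sum>k\<in>K. (\<bar>of_int k\<bar> * cmod (bdry N k t))\<^sup>2) \<le> bdry_l2_const P M"
proof -
  let ?\<alpha> = "\<lambda>k. cmod (v k t)"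
  note \<alpha> = l2le_v[OF M]
  have "(\<Sum>k\<in>K. (\<bar>of_int k\<bar> * cmod (bdry N k t))\<^sup>2) \<le>
    (\<Sum>k\<in>K. 4 * ((cmod (f k))\<^sup>2 + (maj2 N k ?\<alpha> ?\<alpha>)\<^sup>2 + (maj3 N k ?\<alpha> ?\<alpha> ?\<alpha>)\<^sup>2 + 0\<^sup>2))"
  proof (intro sum_mono)
    fix k assume "k \<in> K"
    then have "(\<bar>of_int k\<bar> * cmod (bdry N k t))\<^sup>2 \<le> (cmod (f k) + maj2 N k ?\<alpha> ?\<alpha> + maj3 N k ?\<alpha> ?\<alpha> ?\<alpha> + 0)\<^sup>2"
      using K cmod_bdry[of k N t] by (intro power_mono) auto
    also note sum4_square_le
    finally show "(\<bar>of_int k\<bar> * cmod (bdry N k t))\<^sup>2 \<le> 4 * ((cmod (f k))\<^sup>2 + (maj2 N k ?\<alpha> ?\<alpha>)\<^sup>2 + (maj3 N k ?\<alpha> ?\<alpha> ?\<alpha>)\<^sup>2 + 0\<^sup>2)" .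
  qed
  also have "\<dots> = 4 * ((\<Sum>k\<in>K. (cmod (f k))\<^sup>2) + (\<Sum>k\<in>K. (maj2 N k ?\<alpha> ?\<alpha>)\<^sup>2) + (\<Sum>k\<in>K. (maj3 N k ?\<alpha> ?\<alpha> ?\<alpha>)\<^sup>2))"
    unfolding sum_distrib_left[symmetric] sum.distrib by simp
  also have "\<dots> \<le> bdry_l2_const P M"
    unfolding bdry_l2_const_def
    by (intro mult_left_mono add_mono l2leD[OF f_bound] maj2_l2 maj3_l2 \<alpha> K) auto
  finally show ?thesis .
qed

text \<open>The bound is linear in the sum of |w_j|^2, so that its time integral is covered by
  \<open>omega_integral\<close>, uniformly in N.\<close>

lemma rem_l2:
  assumes M: "m t \<le> M" and K: "finite K" "0 \<notin> K" and N: "\<And>k. k \<in> K \<Longrightarrow> N \<ge> 2 * nat \<bar>k\<bar>"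
  shows "(\<Sum>k\<in>K. (\<bar>of_int k\<bar> * cmod (rem N k t))\<^sup>2) \<le>
    rem_l2_const \<gamma> P M + 16384 * M\<^sup>2 * (\<Sum>j\<in>modes N. (cmod (w j t))\<^sup>2)"
proof -
  let ?\<alpha> = "\<lambda>k. cmod (v k t)" and ?\<phi> = "\<lambda>k. cmod (forcing k t)"
  let ?\<theta> = "\<lambda>j. cmod (forcing j t) + (if j \<in> modes N then cmod (w j t) else 0)"
  let ?Q = "forcing_mass \<gamma> P M" and ?\<Omega> = "\<Sum>j\<in>modes N. (cmod (w j t))\<^sup>2"
  note \<alpha> = l2le_v[OF M] and \<theta> = l2le_theta[OF M, of N]
  have \<phi>: "l2le ?\<phi> ?Q" unfolding forcing_mass_def by (rule l2le_forcing[OF M])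
  have M0: "0 \<le> M" using m_nonneg[of t] M by simp
  have "(\<Sum>k\<in>K. (\<bar>of_int k\<bar> * cmod (rem N k t))\<^sup>2) \<le>
    (\<Sum>k\<in>K. 4 * ((maj2 N k ?\<alpha> ?\<phi>)\<^sup>2 + (M * ?\<alpha> k)\<^sup>2 + (maj3 N k ?\<theta> ?\<alpha> ?\<alpha>)\<^sup>2 + (maj3 N k ?\<alpha> ?\<theta> ?\<alpha>)\<^sup>2))"
  proof (intro sum_mono)
    fix k assume k: "k \<in> K"
    then have "\<bar>of_int k\<bar> * cmod (rem N k t) \<le> maj2 N k ?\<alpha> ?\<phi> + M * ?\<alpha> k + (maj3 N k ?\<theta> ?\<alpha> ?\<alpha> + maj3 N k ?\<alpha> ?\<theta> ?\<alpha>)"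
      using K N[OF k] M by (intro cmod_rem) auto
    then have "(\<bar>of_int k\<bar> * cmod (rem N k t))\<^sup>2 \<le> (maj2 N k ?\<alpha> ?\<phi> + M * ?\<alpha> k + maj3 N k ?\<theta> ?\<alpha> ?\<alpha> + maj3 N k ?\<alpha> ?\<theta> ?\<alpha>)\<^sup>2"
      by (intro power_mono) (auto simp: add.assoc)
    also note sum4_square_le
    finally show "(\<bar>of_int k\<bar> * cmod (rem N k t))\<^sup>2 \<le> 4 * ((maj2 N k ?\<alpha> ?\<phi>)\<^sup>2 + (M * ?\<alpha> k)\<^sup>2 + (maj3 N k ?\<theta> ?\<alpha> ?\<alpha>)\<^sup>2 + (maj3 N k ?\<alpha> ?\<theta> ?\<alpha>)\<^sup>2)" .
  qed
  also have "\<dots> = 4 * ((\<Sum>k\<in>K. (maj2 N k ?\<alpha> ?\<phi>)\<^sup>2) + M\<^sup>2 * (\<Sum>k\<in>K. (?\<alpha> k)\<^sup>2) + (\<Sum>k\<in>K. (maj3 N k ?\<theta> ?\<alpha> ?\<alpha>)\<^sup>2) + (\<Sum>k\<in>K. (maj3 N k ?\<alpha> ?\<theta> ?\<alpha>)\<^sup>2))"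
    unfolding sum_distrib_left[symmetric] sum.distrib power_mult_distrib ..
  also have "\<dots> \<le> 4 * (16 * (M * ?Q) + M\<^sup>2 * M + 1024 * ((2 * ?Q + 2 * ?\<Omega>) * M * M) + 1024 * (M * (2 * ?Q + 2 * ?\<Omega>) * M))"
    by (intro mult_left_mono add_mono maj2_l2 maj3_l2 l2leD[OF \<alpha>] \<alpha> \<phi> \<theta> K) auto
  also have "\<dots> = rem_l2_const \<gamma> P M + 16384 * M\<^sup>2 * ?\<Omega>"
    unfolding rem_l2_const_def power2_eq_square by algebra
  finally show ?thesis .
qed

text \<open>Cauchy-Schwarz in time is applied for each k before summing over k, because w is
  controlled in l^2 only on time average. K is fixed while N tends to infinity, so the truncation
  errors of its finitely many modes vanish.\<close>

lemma dev_sobolev: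
  assumes t: "a \<le> t" and M: "\<And>r. r \<in> {a..t} \<Longrightarrow> m r \<le> M" and K: "finite K" "0 \<notin> K"
  shows "(\<Sum>k\<in>K. (\<bar>of_int k\<bar> * cmod (dev a k t))\<^sup>2) \<le> sobolev_const \<gamma> P M"
proof -
  let ?B = "bdry_l2_const P M"
  let ?c0 = "2 * rem_l2_const \<gamma> P M + 2 * (\<gamma>\<^sup>2 * ?B)" and ?c1 = "32768 * M\<^sup>2"
  let ?I = "\<lambda>g. exp (- \<gamma> * t) * integral {a..t} (\<lambda>r. exp (\<gamma> * r) * g r)"
  let ?E = "\<lambda>N k. ?I (\<lambda>r. cmod (err N k r))"
  have scal: "?I (\<lambda>r. c * g r) = c * ?I g" for c :: real and g
  proof -
    have "(\<lambda>r. exp (\<gamma> * r) * (c * g r)) = (\<lambda>r. c * (exp (\<gamma> * r) * g r))" by (simp only: mult.left_commute)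
    then show ?thesis by (simp only: integral_mult_right mult.left_commute)
  qed
  \<comment> \<open>Large enough for \<open>cmod_rem\<close> at every k in K; the inserted 0 keeps
    \<open>Max\<close> meaningful for empty K.\<close>
  define N0 where "N0 = Max (insert 0 ((\<lambda>k. 2 * nat \<bar>k\<bar>) ` K))"
  have ev: "(\<Sum>k\<in>K. (\<bar>of_int k\<bar> * cmod (dev a k t))\<^sup>2) \<le> sobolev_const \<gamma> P M + 4 * (\<Sum>k\<in>K. (\<bar>of_int k\<bar> * ?E N k)\<^sup>2)"
    if N: "N \<ge> N0" for N
  proof -
    have NK: "N \<ge> 2 * nat \<bar>k\<bar>" if "k \<in> K" for k
    proof -
      have "2 * nat \<bar>k\<bar> \<le> N0" unfolding N0_def using that K by (intro Max_ge) auto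
      then show ?thesis using N by simp
    qed
    let ?g = "\<lambda>k r. \<bar>real_of_int k\<bar> * (cmod (rem N k r) + \<gamma> * cmod (bdry N k r))"
    let ?\<Omega> = "\<lambda>r. \<Sum>j\<in>modes N. (cmod (w j r))\<^sup>2"
    have pt: "(\<bar>of_int k\<bar> * cmod (dev a k t))\<^sup>2 \<le> 4 * ((\<bar>of_int k\<bar> * cmod (bdry N k t))\<^sup>2 + (\<bar>of_int k\<bar> * cmod (bdry N k a))\<^sup>2
        + 1 / \<gamma> * ?I (\<lambda>r. (?g k r)\<^sup>2) + (\<bar>of_int k\<bar> * ?E N k)\<^sup>2)" if k: "k \<in> K" for k
    proof -
      have "k \<noteq> 0" using k K by auto
      then have "\<bar>of_int k\<bar> * cmod (dev a k t) \<le> \<bar>of_int k\<bar> * (cmod (bdry N k t) + cmod (bdry N k a)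
        + ?I (\<lambda>r. cmod (rem N k r) + \<gamma> * cmod (bdry N k r)) + ?E N k)"
        by (intro mult_left_mono cmod_dev t) auto
      also have "\<dots> = \<bar>of_int k\<bar> * cmod (bdry N k t) + \<bar>of_int k\<bar> * cmod (bdry N k a) + ?I (?g k) + \<bar>of_int k\<bar> * ?E N k"
        by (simp only: scal) (simp only: distrib_left[of "\<bar>real_of_int k\<bar>"])
      finally have "(\<bar>of_int k\<bar> * cmod (dev a k t))\<^sup>2 \<le> (\<bar>of_int k\<bar> * cmod (bdry N k t) + \<bar>of_int k\<bar> * cmod (bdry N k a) + ?I (?g k) + \<bar>of_int k\<bar> * ?E N k)\<^sup>2"
        by (intro power_mono) auto
      also note sum4_square_le
      also have "(?I (?g k))\<^sup>2 \<le> 1 / \<gamma> * ?I (\<lambda>r. (?g k r)\<^sup>2)"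
        by (intro weighted_Cauchy_Schwarz \<gamma>_pos t continuous_intros)
      finally show ?thesis by simp
    qed
    have sum_g: "(\<Sum>k\<in>K. (?g k r)\<^sup>2) \<le> ?c0 + ?c1 * ?\<Omega> r" if r: "r \<in> {a..t}" for r
    proof -
      have "(\<Sum>k\<in>K. (?g k r)\<^sup>2) \<le> (\<Sum>k\<in>K. 2 * (\<bar>of_int k\<bar> * cmod (rem N k r))\<^sup>2 + 2 * (\<gamma>\<^sup>2 * (\<bar>of_int k\<bar> * cmod (bdry N k r))\<^sup>2))"
      proof (intro sum_mono)
        fix k
        from square_sum_le[of "\<bar>of_int k\<bar> * cmod (rem N k r)" "\<gamma> * (\<bar>of_int k\<bar> * cmod (bdry N k r))"]
        show "(?g k r)\<^sup>2 \<le> 2 * (\<bar>of_int k\<bar> * cmod (rem N k r))\<^sup>2 + 2 * (\<gamma>\<^sup>2 * (\<bar>of_int k\<bar> * cmod (bdry N k r))\<^sup>2)"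
          by (simp only: distrib_left power_mult_distrib mult.left_commute[of "\<gamma>\<^sup>2"] mult.left_commute[of \<gamma>])
      qed
      also have "\<dots> = 2 * (\<Sum>k\<in>K. (\<bar>of_int k\<bar> * cmod (rem N k r))\<^sup>2) + 2 * (\<gamma>\<^sup>2 * (\<Sum>k\<in>K. (\<bar>of_int k\<bar> * cmod (bdry N k r))\<^sup>2))"
        unfolding sum_distrib_left[symmetric] sum.distrib ..
      also have "\<dots> \<le> 2 * (rem_l2_const \<gamma> P M + 16384 * M\<^sup>2 * ?\<Omega> r) + 2 * (\<gamma>\<^sup>2 * ?B)"
        by (intro add_mono mult_left_mono rem_l2 bdry_l2 M r K NK) auto
      finally show ?thesis by simp
    qed
    have c0: "0 \<le> ?c0"
    proof -
      have tt: "m t \<le> M" using M[of t] t by simp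
      then have M0: "0 \<le> M" using m_nonneg[of t] by simp
      have Q0: "0 \<le> forcing_mass \<gamma> P M"
        unfolding forcing_mass_def by (rule l2le_nonneg[OF l2le_forcing[OF tt]])
      have "0 \<le> ?B" using bdry_l2[OF tt, of "{}" N] by simp
      then show ?thesis using M0 Q0 by (simp add: rem_l2_const_def)
    qed
    have I: "(\<Sum>k\<in>K. ?I (\<lambda>r. (?g k r)\<^sup>2)) \<le> ?c0 / \<gamma> + ?c1 * strichartz_const \<gamma> P M"
    proof -
      have "(\<Sum>k\<in>K. ?I (\<lambda>r. (?g k r)\<^sup>2)) = ?I (\<lambda>r. \<Sum>k\<in>K. (?g k r)\<^sup>2)"
      proof -
        have "(\<Sum>k\<in>K. integral {a..t} (\<lambda>r. exp (\<gamma> * r) * (?g k r)\<^sup>2)) = integral {a..t} (\<lambda>r. \<Sum>k\<in>K. exp (\<gamma> * r) * (?g k r)\<^sup>2)"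
          by (rule integral_sum[symmetric]) (auto intro!: K integrable_continuous_real continuous_intros)
        then show ?thesis by (simp only: sum_distrib_left[symmetric])
      qed
      also have "\<dots> \<le> exp (- \<gamma> * t) * integral {a..t} (\<lambda>r. exp (\<gamma> * r) * ?c0 + ?c1 * (exp (\<gamma> * r) * ?\<Omega> r))"
      proof (intro mult_left_mono integral_le)
        fix r assume "r \<in> {a..t}"
        then have "exp (\<gamma> * r) * (\<Sum>k\<in>K. (?g k r)\<^sup>2) \<le> exp (\<gamma> * r) * (?c0 + ?c1 * ?\<Omega> r)"
          by (intro mult_left_mono sum_g) auto
        then show "exp (\<gamma> * r) * (\<Sum>k\<in>K. (?g k r)\<^sup>2) \<le> exp (\<gamma> * r) * ?c0 + ?c1 * (exp (\<gamma> * r) * ?\<Omega> r)"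
          by (simp only: distrib_left mult.left_commute[of ?c1])
      qed (intro integrable_continuous_real continuous_intros | simp)+
      also have "\<dots> = ?I (\<lambda>r. ?c0) + ?c1 * ?I ?\<Omega>"
        by (subst integral_add) (auto intro!: integrable_continuous_real continuous_intros simp: distrib_left)
      also have "\<dots> \<le> ?c0 / \<gamma> + ?c1 * strichartz_const \<gamma> P M"
        by (intro add_mono mult_left_mono omega_integral weighted_integral_le \<gamma>_pos t M c0 continuous_intros) auto
      finally show ?thesis .
    qed
    have "(\<Sum>k\<in>K. (\<bar>of_int k\<bar> * cmod (dev a k t))\<^sup>2) \<le> (\<Sum>k\<in>K. 4 * ((\<bar>of_int k\<bar> * cmod (bdry N k t))\<^sup>2 + (\<bar>of_int k\<bar> * cmod (bdry N k a))\<^sup>2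
        + 1 / \<gamma> * ?I (\<lambda>r. (?g k r)\<^sup>2) + (\<bar>of_int k\<bar> * ?E N k)\<^sup>2))"
      by (intro sum_mono pt)
    also have "\<dots> = 4 * ((\<Sum>k\<in>K. (\<bar>of_int k\<bar> * cmod (bdry N k t))\<^sup>2) + (\<Sum>k\<in>K. (\<bar>of_int k\<bar> * cmod (bdry N k a))\<^sup>2)
        + 1 / \<gamma> * (\<Sum>k\<in>K. ?I (\<lambda>r. (?g k r)\<^sup>2)) + (\<Sum>k\<in>K. (\<bar>of_int k\<bar> * ?E N k)\<^sup>2))"
      unfolding sum_distrib_left[symmetric, of 4] sum_distrib_left[symmetric, of "1 / \<gamma>"] sum.distrib ..
    also have "\<dots> \<le> 4 * (?B + ?B + 1 / \<gamma> * (?c0 / \<gamma> + ?c1 * strichartz_const \<gamma> P M) + (\<Sum>k\<in>K. (\<bar>of_int k\<bar> * ?E N k)\<^sup>2))"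
      using t \<gamma>_pos by (intro mult_left_mono add_mono bdry_l2 I K M) auto
    finally show ?thesis unfolding sobolev_const_def by simp
  qed
  have "(\<lambda>N. sobolev_const \<gamma> P M + 4 * (\<Sum>k\<in>K. (\<bar>of_int k\<bar> * ?E N k)\<^sup>2)) \<longlonglongrightarrow> sobolev_const \<gamma> P M + 4 * (\<Sum>k\<in>K. (\<bar>of_int k\<bar> * 0)\<^sup>2)"
    by (intro tendsto_intros err_integral_tendsto[OF M])
  then show ?thesis
    by (intro LIMSEQ_le_const[of "\<lambda>N. sobolev_const \<gamma> P M + 4 * (\<Sum>k\<in>K. (\<bar>of_int k\<bar> * ?E N k)\<^sup>2)"]) (use ev in auto)
qed

end

section \<open>Energy estimate\<close>

definition good :: "nat \<Rightarrow> (int \<times> int) set" where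
  "good N = Sigma (modes N) (pairs N)"

text \<open>Interactions that feed a mode in \<open>modes N\<close> with at least one input outside
  it, inputs being cut at L: these alone transport energy through frequency N.\<close>

definition bad :: "nat \<Rightarrow> nat \<Rightarrow> (int \<times> int) set" where
  "bad N L = Sigma (modes N) (pairs L) - good N"

lemma finite_bad [simp]: "finite (bad N L)"
  by (simp add: bad_def)

lemma sum_bad_swap:
  "(\<Sum>z\<in>bad N L. g (fst z) (snd z) (fst z - snd z)) = (\<Sum>z\<in>bad N L. g (fst z) (fst z - snd z) (snd z))"
  by (rule sum.reindex_bij_witness[of _ "\<lambda>z. (fst z, fst z - snd z)" "\<lambda>z. (fst z, fst z - snd z)"])
     (auto simp: bad_def good_def pairs_def)

text \<open>On three modes summing to zero the weights add up to zero, so low frequencies exchange no energy.\<close>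

lemma sum_good_eq_0:
  fixes h :: "int \<Rightarrow> int \<Rightarrow> int \<Rightarrow> complex"
  assumes sym: "\<And>x y z. h x y z = h y x z" "\<And>x y z. h x y z = h x z y"
  shows "(\<Sum>z\<in>good N. of_int (fst z) * h (- fst z) (snd z) (fst z - snd z)) = 0"
proof -
  define T where "T = {(x, y, z). x \<in> modes N \<and> y \<in> modes N \<and> z \<in> modes N \<and> x + y + z = 0}"
  have "(\<Sum>z\<in>good N. of_int (fst z) * h (- fst z) (snd z) (fst z - snd z)) = (\<Sum>(x, y, z)\<in>T. - of_int x * h x y z)"
    by (rule sum.reindex_bij_witness[of _ "\<lambda>(x, y, z). (- x, y)" "\<lambda>z. (- fst z, snd z, fst z - snd z)"])
       (auto simp: T_def good_def pairs_def in_modes)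
  also have "\<dots> = - (\<Sum>(x, y, z)\<in>T. of_int x * h x y z)"
    by (simp add: split_def sum_negf)
  also have "(\<Sum>(x, y, z)\<in>T. of_int x * h x y z) = 0"
  proof -
    have 1: "(\<Sum>(x, y, z)\<in>T. of_int x * h x y z) = (\<Sum>(x, y, z)\<in>T. of_int y * h x y z)"
      by (rule sum.reindex_bij_witness[of _ "\<lambda>(x, y, z). (y, x, z)" "\<lambda>(x, y, z). (y, x, z)"])
         (auto simp: T_def sym(1))
    have 2: "(\<Sum>(x, y, z)\<in>T. of_int y * h x y z) = (\<Sum>(x, y, z)\<in>T. of_int z * h x y z)"
      by (rule sum.reindex_bij_witness[of _ "\<lambda>(x, y, z). (x, z, y)" "\<lambda>(x, y, z). (x, z, y)"])
         (auto simp: T_def sym(2))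
    have "(\<Sum>(x, y, z)\<in>T. of_int x * h x y z) + (\<Sum>(x, y, z)\<in>T. of_int y * h x y z) + (\<Sum>(x, y, z)\<in>T. of_int z * h x y z)
      = (\<Sum>(x, y, z)\<in>T. of_int (x + y + z) * h x y z)"
      unfolding sum.distrib[symmetric] by (intro sum.cong) (auto simp: algebra_simps)
    also have "\<dots> = 0" by (intro sum.neutral) (auto simp: T_def simp flip: of_int_add)
    finally show ?thesis using 1 2 by simp
  qed
  finally show ?thesis by simp
qed

text \<open>One reciprocal suffices for three l^2 factors over two free frequencies: the four
  factors are grouped into two pairs, each with independent arguments.\<close>

lemma trilinear_bound:
  assumes X: "l2le X A" and Y: "l2le Y B" and Z: "l2le Z C" and T: "finite T"
  shows "(\<Sum>z\<in>T. X (fst z) * Y (snd z) * Z (fst z - snd z) * (1 / \<bar>of_int (snd z)\<bar>)) \<le> 2 * sqrt (A * B * C)"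
    and "(\<Sum>z\<in>T. X (fst z) * Y (snd z) * Z (fst z - snd z) * (1 / \<bar>of_int (fst z - snd z)\<bar>)) \<le> 2 * sqrt (A * B * C)"
proof -
  let ?i = "\<lambda>n::int. 1 / \<bar>real_of_int n\<bar>"
  have A0: "0 \<le> A * B" "0 \<le> A * C" using X Y Z by (auto dest!: l2le_nonneg)
  have "(\<Sum>z\<in>T. (X (fst z) * Y (snd z)) * (Z (fst z - snd z) * ?i (snd z)))\<^sup>2 \<le> (A * B) * (C * 4)"
    by (rule order_trans[OF Cauchy_Schwarz_ineq_sum])
       (intro mult_mono sum_prod2_le[OF X Y T] sum_prod2_le[OF Z l2le_inverse_abs T] A0 sum_nonneg;
         auto simp: inj_on_def prod_eq_iff)
  then have "(\<Sum>z\<in>T. (X (fst z) * Y (snd z)) * (Z (fst z - snd z) * ?i (snd z))) \<le> sqrt ((A * B) * (C * 4))"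
    by (rule real_le_rsqrt)
  then show "(\<Sum>z\<in>T. X (fst z) * Y (snd z) * Z (fst z - snd z) * (1 / \<bar>of_int (snd z)\<bar>)) \<le> 2 * sqrt (A * B * C)"
    by (simp add: real_sqrt_mult ac_simps)
  have "(\<Sum>z\<in>T. (X (fst z) * Z (fst z - snd z)) * (Y (snd z) * ?i (fst z - snd z)))\<^sup>2 \<le> (A * C) * (B * 4)"
    by (rule order_trans[OF Cauchy_Schwarz_ineq_sum])
       (intro mult_mono sum_prod2_le[OF X Z T] sum_prod2_le[OF Y l2le_inverse_abs T] A0 sum_nonneg;
         auto simp: inj_on_def prod_eq_iff)
  then have "(\<Sum>z\<in>T. (X (fst z) * Z (fst z - snd z)) * (Y (snd z) * ?i (fst z - snd z))) \<le> sqrt ((A * C) * (B * 4))"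
    by (rule real_le_rsqrt)
  then show "(\<Sum>z\<in>T. X (fst z) * Y (snd z) * Z (fst z - snd z) * (1 / \<bar>of_int (fst z - snd z)\<bar>)) \<le> 2 * sqrt (A * B * C)"
    by (simp add: real_sqrt_mult ac_simps)
qed

context kdv_modes begin

definition high :: "nat \<Rightarrow> real \<Rightarrow> int \<Rightarrow> real" where
  "high N t k = (if k \<in> modes N then 0 else cmod (v k t))"

lemma l2le_high: "l2le (high N t) ((tail N t)\<^sup>2)"
  unfolding l2le_def
proof (intro allI impI)
  fix F :: "int set" assume F: "finite F"
  have "(\<Sum>k\<in>F. (high N t k)\<^sup>2) = (\<Sum>k\<in>F - modes N. (cmod (v k t))\<^sup>2)"
    using F by (intro sum.mono_neutral_cong_right) (auto simp: high_def)
  also have "\<dots> = (\<Sum>k\<in>F \<union> modes N. (cmod (v k t))\<^sup>2) - (\<Sum>k\<in>modes N. (cmod (v k t))\<^sup>2)"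
    using F by (simp add: sum_diff[symmetric] Un_Diff)
  also have "\<dots> \<le> (tail N t)\<^sup>2"
    using sum_le_m[of "F \<union> modes N" t] sum_le_m[of "modes N" t] F by (simp add: tail_def)
  finally show "(\<Sum>k\<in>F. (high N t k)\<^sup>2) \<le> (tail N t)\<^sup>2" .
qed

lemma high_nonneg [simp]: "0 \<le> high N t k" by (simp add: high_def)

text \<open>k = p + q with p or q outside \<open>modes N\<close>. Among p, q one is high at once;
  among k, q one is beyond N div 2, since otherwise p = k - q and q would both lie in
  \<open>modes N\<close>. The second form serves when the derivative has fallen on p, and it is the
  reason for halving N.\<close>

lemma bad_high:
  assumes z: "z \<in> bad N L"
  defines "k \<equiv> fst z" and "p \<equiv> snd z" and "q \<equiv> fst z - snd z"
  shows "cmod (v p t) * cmod (v q t) \<le> high (N div 2) t p * cmod (v q t) + cmod (v p t) * high (N div 2) t q"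
    and "cmod (v k t) * cmod (v q t) \<le> high (N div 2) t k * cmod (v q t) + cmod (v k t) * high (N div 2) t q"
proof -
  have bd: "k \<in> modes N" "p \<in> modes L" "q \<in> modes L" "p \<notin> modes N \<or> q \<notin> modes N"
    using z by (auto simp: bad_def good_def pairs_def k_def p_def q_def)
  have k: "k = p + q" by (simp add: k_def p_def q_def)
  have "p \<notin> modes (N div 2) \<or> q \<notin> modes (N div 2)"
    using bd modes_mono[of "N div 2" N] by auto
  then show "cmod (v p t) * cmod (v q t) \<le> high (N div 2) t p * cmod (v q t) + cmod (v p t) * high (N div 2) t q"
    by (auto simp: high_def)
  have "k \<notin> modes (N div 2) \<or> q \<notin> modes (N div 2)"
    using bd k by (auto simp: in_modes)
  then show "cmod (v k t) * cmod (v q t) \<le> high (N div 2) t k * cmod (v q t) + cmod (v k t) * high (N div 2) t q"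
    by (auto simp: high_def)
qed

text \<open>The rate at which the nonlinearity supplies mass to \<open>modes N\<close>; the 2 from
  differentiating |v_k|^2 cancels the 1/2 of (u^2/2)_x.\<close>

definition flux :: "nat \<Rightarrow> real \<Rightarrow> real" where
  "flux N t = (\<Sum>k\<in>modes N. Re (cnj (v k t) * (- \<i> * of_int k * w k t)))"

text \<open>With q = k - p, the weight 1/(3pq) is -ik divided by the factor -3ikpq of the
  differentiated oscillation; the frequency k cancels.\<close>

definition flux_bdry :: "nat \<Rightarrow> nat \<Rightarrow> real \<Rightarrow> complex" where
  "flux_bdry N L t = (\<Sum>z\<in>bad N L. osc (3 * fst z * snd z * (fst z - snd z)) t *
     (v (- fst z) t * v (snd z) t * v (fst z - snd z) t) / (3 * of_int (snd z) * of_int (fst z - snd z)))"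

definition flux_rem :: "nat \<Rightarrow> nat \<Rightarrow> real \<Rightarrow> complex" where
  "flux_rem N L t = (\<Sum>z\<in>bad N L. osc (3 * fst z * snd z * (fst z - snd z)) t *
     (vdot (- fst z) t * v (snd z) t * v (fst z - snd z) t + 2 * (v (- fst z) t * vdot (snd z) t * v (fst z - snd z) t))
     / (3 * of_int (snd z) * of_int (fst z - snd z)))"

text \<open>Since conj(v_k) = v_{-k}, the summand is k times a symmetric function of the frequencies
  -k, p, q, whose sum is 0; on \<open>good N\<close> the three frequencies range symmetrically and
  \<open>sum_good_eq_0\<close> removes that part.\<close>

lemma flux_split:
  assumes "N \<le> L"
  shows "(\<Sum>k\<in>modes N. cnj (v k t) * (- \<i> * of_int k * quad L k t (\<lambda>p. v p t))) =
    (\<Sum>z\<in>bad N L. - \<i> * of_int (fst z) * (osc (3 * fst z * snd z * (fst z - snd z)) t *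
     (v (- fst z) t * v (snd z) t * v (fst z - snd z) t)))"
proof -
  let ?g = "\<lambda>z. - \<i> * of_int (fst z) * (osc (3 * fst z * snd z * (fst z - snd z)) t *
     (v (- fst z) t * v (snd z) t * v (fst z - snd z) t))"
  define h where "h x y z = - \<i> * (osc (- (3 * x * y * z)) t * (v x t * v y t * v z t))" for x y z
  have "(\<Sum>k\<in>modes N. cnj (v k t) * (- \<i> * of_int k * quad L k t (\<lambda>p. v p t))) = (\<Sum>z\<in>Sigma (modes N) (pairs L). ?g z)"
    unfolding quad_def sum_distrib_left
    by (subst sum.Sigma) (auto simp: split_def hermitian ac_simps intro!: sum.cong)
  also have "\<dots> = sum ?g (bad N L) + sum ?g (good N)"
    unfolding bad_def
    by (rule sum.subset_diff) (use modes_mono[OF assms] in \<open>auto simp: good_def pairs_def\<close>)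
  also have "sum ?g (good N) = (\<Sum>z\<in>good N. of_int (fst z) * h (- fst z) (snd z) (fst z - snd z))"
    by (intro sum.cong refl) (simp add: h_def)
  also have "\<dots> = 0"
    by (rule sum_good_eq_0) (simp_all add: h_def ac_simps)
  finally show ?thesis by simp
qed

text \<open>As for \<open>bd3\<close>, symmetry merges two of the three derivatives, here those of
  the factors p and k - p.\<close>

lemma flux_bdry_deriv:
  "(flux_bdry N L has_vector_derivative ((\<Sum>z\<in>bad N L. - \<i> * of_int (fst z) * (osc (3 * fst z * snd z * (fst z - snd z)) t *
     (v (- fst z) t * v (snd z) t * v (fst z - snd z) t))) + flux_rem N L t)) (at t)"
proof -
  let ?n = "\<lambda>z. 3 * fst z * snd z * (fst z - snd z)"
  let ?o = "\<lambda>z. osc (?n z) t" and ?d = "\<lambda>z. 3 * of_int (snd z) * of_int (fst z - snd z) :: complex"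
  let ?x = "\<lambda>z. v (- fst z) t" and ?y = "\<lambda>z. v (snd z) t" and ?u = "\<lambda>z. v (fst z - snd z) t"
  let ?x' = "\<lambda>z. vdot (- fst z) t" and ?y' = "\<lambda>z. vdot (snd z) t" and ?u' = "\<lambda>z. vdot (fst z - snd z) t"
  have "(flux_bdry N L has_vector_derivative (\<Sum>z\<in>bad N L.
      (?o z * ((?x z * ?y z) * ?u' z + (?x z * ?y' z + ?x' z * ?y z) * ?u z) + (- \<i> * of_int (?n z) * ?o z) * (?x z * ?y z * ?u z)) / ?d z)) (at t)"
    unfolding flux_bdry_def
    by (intro has_vector_derivative_sum has_vector_derivative_divide has_vector_derivative_mult osc_has_vector_derivative v_vdot)
  also have "(\<Sum>z\<in>bad N L.
      (?o z * ((?x z * ?y z) * ?u' z + (?x z * ?y' z + ?x' z * ?y z) * ?u z) + (- \<i> * of_int (?n z) * ?o z) * (?x z * ?y z * ?u z)) / ?d z)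
    = (\<Sum>z\<in>bad N L. ?o z * (?x z * ?y z * ?u' z) / ?d z)
     + (\<Sum>z\<in>bad N L. ?o z * (?x' z * ?y z * ?u z + ?x z * ?y' z * ?u z) / ?d z)
     + (\<Sum>z\<in>bad N L. - \<i> * of_int (fst z) * (?o z * (?x z * ?y z * ?u z)))"
    unfolding sum.distrib[symmetric]
  proof (intro sum.cong refl)
    fix z assume "z \<in> bad N L"
    then have nz: "of_int (snd z) \<noteq> (0::complex)" "of_int (fst z - snd z) \<noteq> (0::complex)"
      by (auto simp: bad_def pairs_def in_modes simp flip: of_int_diff)
    have "(c * ((x * y) * u' + (x * y' + x' * y) * u) + (- \<i> * (3 * K * P * R) * c) * (x * y * u)) / (3 * P * R)
      = c * (x * y * u') / (3 * P * R) + c * (x' * y * u + x * y' * u) / (3 * P * R) + - \<i> * K * (c * (x * y * u))"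
      if "P \<noteq> 0" "R \<noteq> 0" for c x y u x' y' u' K P R :: complex
      using that by (simp add: field_simps)
    from this[OF nz, of "?o z" "?x z" "?y z" "?u' z" "?y' z" "?x' z" "?u z" "of_int (fst z)"]
    show "(?o z * ((?x z * ?y z) * ?u' z + (?x z * ?y' z + ?x' z * ?y z) * ?u z) + (- \<i> * of_int (?n z) * ?o z) * (?x z * ?y z * ?u z)) / ?d z
      = ?o z * (?x z * ?y z * ?u' z) / ?d z + ?o z * (?x' z * ?y z * ?u z + ?x z * ?y' z * ?u z) / ?d z
       + - \<i> * of_int (fst z) * (?o z * (?x z * ?y z * ?u z))"
      by (simp only: of_int_mult of_int_numeral)
  qed
  also have "(\<Sum>z\<in>bad N L. ?o z * (?x z * ?y z * ?u' z) / ?d z) = (\<Sum>z\<in>bad N L. ?o z * (?x z * ?y' z * ?u z) / ?d z)"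
    using sum_bad_swap[of "\<lambda>k p q. osc (3 * k * p * q) t * (v (- k) t * v p t * vdot q t) / (3 * of_int p * of_int q)" N L]
    by (simp only: ac_simps)
  also have "(\<Sum>z\<in>bad N L. ?o z * (?x z * ?y' z * ?u z) / ?d z) + (\<Sum>z\<in>bad N L. ?o z * (?x' z * ?y z * ?u z + ?x z * ?y' z * ?u z) / ?d z) = flux_rem N L t"
    unfolding flux_rem_def sum.distrib[symmetric]
    by (intro sum.cong refl) (simp add: algebra_simps add_divide_distrib)
  finally show ?thesis by (simp only: add.commute)
qed

lemma cmod_flux_bdry:
  assumes M: "m t \<le> M"
  shows "cmod (flux_bdry N L t) \<le> 4 * M * tail (N div 2) t"
proof -
  let ?\<alpha> = "\<lambda>k. cmod (v k t)" and ?h = "high (N div 2) t" and ?\<tau> = "tail (N div 2) t"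
  note \<alpha> = l2le_v[OF M] and h = l2le_high[of "N div 2" t]
  have M0: "0 \<le> M" using m_nonneg[of t] M by simp
  have "cmod (flux_bdry N L t) \<le> (\<Sum>z\<in>bad N L. ?\<alpha> (fst z) * ?h (snd z) * ?\<alpha> (fst z - snd z) * (1 / \<bar>of_int (snd z)\<bar>)
      + ?\<alpha> (fst z) * ?\<alpha> (snd z) * ?h (fst z - snd z) * (1 / \<bar>of_int (snd z)\<bar>))"
    unfolding flux_bdry_def
  proof (intro order_trans[OF norm_sum] sum_mono)
    fix z assume z: "z \<in> bad N L"
    define p q where "p = snd z" and "q = fst z - snd z"
    have p1: "1 \<le> \<bar>real_of_int p\<bar>" "1 \<le> \<bar>real_of_int q\<bar>"
      using z by (auto simp: bad_def pairs_def in_modes p_def q_def intro!: abs_int_ge_1 simp del: of_int_diff)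
    have bh: "?\<alpha> p * ?\<alpha> q \<le> ?h p * ?\<alpha> q + ?\<alpha> p * ?h q"
      using bad_high(1)[OF z, of t] by (simp only: p_def q_def)
    have "cmod (osc (3 * fst z * p * q) t * (v (- fst z) t * v p t * v q t) / (3 * of_int p * of_int q))
      = (?\<alpha> (fst z) * (?\<alpha> p * ?\<alpha> q)) * (1 / (3 * \<bar>of_int p\<bar> * \<bar>of_int q\<bar>))"
      by (simp add: norm_mult norm_divide hermitian_cmod)
    also have "\<dots> \<le> (?\<alpha> (fst z) * (?h p * ?\<alpha> q + ?\<alpha> p * ?h q)) * (1 / (1 * \<bar>of_int p\<bar> * 1))"
      using p1 bh
      by (intro mult_mono mult_left_mono divide_left_mono mult_pos_pos) auto
    also have "\<dots> = ?\<alpha> (fst z) * ?h p * ?\<alpha> q * (1 / \<bar>of_int p\<bar>) + ?\<alpha> (fst z) * ?\<alpha> p * ?h q * (1 / \<bar>of_int p\<bar>)"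
      by (simp add: algebra_simps)
    finally show "cmod (osc (3 * fst z * snd z * (fst z - snd z)) t * (v (- fst z) t * v (snd z) t * v (fst z - snd z) t) / (3 * of_int (snd z) * of_int (fst z - snd z)))
      \<le> ?\<alpha> (fst z) * ?h (snd z) * ?\<alpha> (fst z - snd z) * (1 / \<bar>of_int (snd z)\<bar>) + ?\<alpha> (fst z) * ?\<alpha> (snd z) * ?h (fst z - snd z) * (1 / \<bar>of_int (snd z)\<bar>)"
      unfolding p_def q_def .
  qed
  also have "\<dots> \<le> 2 * sqrt (M * ?\<tau>\<^sup>2 * M) + 2 * sqrt (M * M * ?\<tau>\<^sup>2)"
    unfolding sum.distrib by (intro add_mono trilinear_bound \<alpha> h finite_bad)
  also have "\<dots> = 4 * M * ?\<tau>" using M0 tail_nonneg by (simp add: real_sqrt_mult)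
  finally show ?thesis .
qed

text \<open>A derivative costs one frequency: |k|/(|p||q|) <= 1/|p| + 1/|q|, or |p|/(|p||q|) =
  1/|q|. Either way one reciprocal remains for \<open>trilinear_bound\<close>, and one
  undifferentiated factor is high. The constant is 16 = 4 * 2 + 2 * 2 * 2.\<close>

lemma cmod_flux_rem:
  assumes M: "m t \<le> M" and NL: "N \<le> L"
  shows "cmod (flux_rem N L t) \<le> 16 * sqrt M * sqrt (2 * forcing_mass \<gamma> P M + 2 * (\<Sum>j\<in>modes L. (cmod (w j t))\<^sup>2)) * tail (N div 2) t"
proof -
  let ?\<alpha> = "\<lambda>k. cmod (v k t)" and ?h = "high (N div 2) t" and ?\<tau> = "tail (N div 2) t"
  let ?\<theta> = "\<lambda>j. cmod (forcing j t) + (if j \<in> modes L then cmod (w j t) else 0)"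
  let ?\<Theta> = "2 * forcing_mass \<gamma> P M + 2 * (\<Sum>j\<in>modes L. (cmod (w j t))\<^sup>2)"
  note \<alpha> = l2le_v[OF M] and h = l2le_high[of "N div 2" t] and \<theta> = l2le_theta[OF M, of L]
  have \<theta>': "l2le (\<lambda>j. ?\<theta> (- j)) ?\<Theta>" using \<theta> by (rule l2le_uminus)
  have M0: "0 \<le> M" using m_nonneg[of t] M by simp
  have \<theta>0: "0 \<le> ?\<theta> j" for j by simp
  have vd: "cmod (vdot j t) \<le> \<bar>of_int j\<bar> * ?\<theta> j" if "j \<in> modes L" for j
    using cmod_vdot[of j t] that by (auto simp: in_modes)
  let ?i = "\<lambda>n::int. 1 / \<bar>real_of_int n\<bar>"
  let ?T = "\<lambda>X Y Z i z. X (fst z) * Y (snd z) * Z (fst z - snd z) * ?i (i z)"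
  let ?p = "\<lambda>z::int\<times>int. snd z" and ?q = "\<lambda>z::int\<times>int. fst z - snd z" and ?\<theta>' = "\<lambda>j. ?\<theta> (- j)"
  have "cmod (flux_rem N L t) \<le> (\<Sum>z\<in>bad N L.
     (?T ?\<theta>' ?h ?\<alpha> ?p z + ?T ?\<theta>' ?\<alpha> ?h ?p z + ?T ?\<theta>' ?h ?\<alpha> ?q z + ?T ?\<theta>' ?\<alpha> ?h ?q z)
      + 2 * (?T ?h ?\<theta> ?\<alpha> ?q z + ?T ?\<alpha> ?\<theta> ?h ?q z))"
    unfolding flux_rem_def
  proof (intro order_trans[OF norm_sum] sum_mono)
    fix z assume z: "z \<in> bad N L"
    define k p q where "k = fst z" and "p = snd z" and "q = fst z - snd z"
    have md: "- k \<in> modes L" "p \<in> modes L" "q \<in> modes L"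
      using z modes_mono[OF NL] by (auto simp: bad_def pairs_def p_def q_def k_def)
    have pq: "0 < \<bar>real_of_int p\<bar>" "0 < \<bar>real_of_int q\<bar>" using md by (auto simp: in_modes)
    have k: "\<bar>real_of_int k\<bar> \<le> \<bar>real_of_int p\<bar> + \<bar>real_of_int q\<bar>" by (simp add: k_def p_def q_def)
    have "cmod (osc (3 * k * p * q) t * (vdot (- k) t * v p t * v q t + 2 * (v (- k) t * vdot p t * v q t)) / (3 * of_int p * of_int q))
      = cmod (vdot (- k) t * v p t * v q t + 2 * (v (- k) t * vdot p t * v q t)) * (1 / (3 * \<bar>of_int p\<bar> * \<bar>of_int q\<bar>))"
      by (simp add: norm_mult norm_divide)
    also have "\<dots> \<le> (\<bar>of_int k\<bar> * ?\<theta>' k * (?\<alpha> p * ?\<alpha> q) + 2 * (\<bar>of_int p\<bar> * ?\<theta> p * (?\<alpha> k * ?\<alpha> q))) * (1 / (1 * \<bar>of_int p\<bar> * \<bar>of_int q\<bar>))"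
    proof (intro mult_mono divide_left_mono order_trans[OF norm_triangle_ineq] add_mono)
      have "cmod (vdot (- k) t) * (?\<alpha> p * ?\<alpha> q) \<le> \<bar>of_int (- k)\<bar> * ?\<theta> (- k) * (?\<alpha> p * ?\<alpha> q)"
        by (intro mult_right_mono vd md) auto
      then show "cmod (vdot (- k) t * v p t * v q t) \<le> \<bar>of_int k\<bar> * ?\<theta>' k * (?\<alpha> p * ?\<alpha> q)"
        by (simp add: norm_mult mult.assoc)
      have "2 * (cmod (vdot p t) * (?\<alpha> k * ?\<alpha> q)) \<le> 2 * (\<bar>of_int p\<bar> * ?\<theta> p * (?\<alpha> k * ?\<alpha> q))"
        by (intro mult_left_mono mult_right_mono vd md) auto
      then show "cmod (2 * (v (- k) t * vdot p t * v q t)) \<le> 2 * (\<bar>of_int p\<bar> * ?\<theta> p * (?\<alpha> k * ?\<alpha> q))"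
        by (simp add: norm_mult hermitian_cmod ac_simps)
    qed (use pq \<theta>0 in \<open>auto intro!: add_nonneg_nonneg mult_nonneg_nonneg\<close>)
    also have "\<dots> = \<bar>of_int k\<bar> / (\<bar>of_int p\<bar> * \<bar>of_int q\<bar>) * (?\<theta>' k * (?\<alpha> p * ?\<alpha> q)) + 2 * (?i q * (?\<theta> p * (?\<alpha> k * ?\<alpha> q)))"
    proof -
      have "(K * A * B + 2 * (X * C * D)) * (1 / (1 * X * Y)) = K / (X * Y) * (A * B) + 2 * (1 / Y * (C * D))"
        if "0 < X" "0 < Y" for K A B C D X Y :: real
        using that by (simp add: field_simps)
      from this[OF pq] show ?thesis .
    qed
    also have "\<dots> \<le> (?i p + ?i q) * (?\<theta>' k * (?h p * ?\<alpha> q + ?\<alpha> p * ?h q)) + 2 * (?i q * (?\<theta> p * (?h k * ?\<alpha> q + ?\<alpha> k * ?h q)))"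
    proof (intro add_mono mult_mono mult_left_mono)
      have "?i p + ?i q = (\<bar>of_int p\<bar> + \<bar>of_int q\<bar>) / (\<bar>of_int p\<bar> * \<bar>of_int q\<bar>)" using pq by (simp add: field_simps)
      also have "\<dots> \<ge> \<bar>of_int k\<bar> / (\<bar>of_int p\<bar> * \<bar>of_int q\<bar>)" using k pq by (intro divide_right_mono) auto
      finally show "\<bar>of_int k\<bar> / (\<bar>of_int p\<bar> * \<bar>of_int q\<bar>) \<le> ?i p + ?i q" .
      show "?\<alpha> p * ?\<alpha> q \<le> ?h p * ?\<alpha> q + ?\<alpha> p * ?h q" "?\<alpha> k * ?\<alpha> q \<le> ?h k * ?\<alpha> q + ?\<alpha> k * ?h q"
        using bad_high[OF z, of t] unfolding k_def p_def q_def by blast+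
    qed (use \<theta>0 in \<open>auto intro!: add_nonneg_nonneg mult_nonneg_nonneg\<close>)
    also have "\<dots> = (?\<theta>' k * ?h p * ?\<alpha> q * ?i p + ?\<theta>' k * ?\<alpha> p * ?h q * ?i p + ?\<theta>' k * ?h p * ?\<alpha> q * ?i q + ?\<theta>' k * ?\<alpha> p * ?h q * ?i q)
      + 2 * (?h k * ?\<theta> p * ?\<alpha> q * ?i q + ?\<alpha> k * ?\<theta> p * ?h q * ?i q)"
    proof -
      have "(ip + iq) * (T * (hp * aq + ap * hq)) + 2 * (iq * (S * (hk * aq + ak * hq))) =
        (T * hp * aq * ip + T * ap * hq * ip + T * hp * aq * iq + T * ap * hq * iq) + 2 * (hk * S * aq * iq + ak * S * hq * iq)"
        for ip iq T hp aq ap hq S hk ak :: real by algebra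
      then show ?thesis .
    qed
    finally show "cmod (osc (3 * fst z * snd z * (fst z - snd z)) t *
     (vdot (- fst z) t * v (snd z) t * v (fst z - snd z) t + 2 * (v (- fst z) t * vdot (snd z) t * v (fst z - snd z) t))
     / (3 * of_int (snd z) * of_int (fst z - snd z))) \<le> (?T ?\<theta>' ?h ?\<alpha> ?p z + ?T ?\<theta>' ?\<alpha> ?h ?p z + ?T ?\<theta>' ?h ?\<alpha> ?q z + ?T ?\<theta>' ?\<alpha> ?h ?q z)
      + 2 * (?T ?h ?\<theta> ?\<alpha> ?q z + ?T ?\<alpha> ?\<theta> ?h ?q z)"
      unfolding k_def p_def q_def .
  qed
  also have "\<dots> \<le> (2 * sqrt (?\<Theta> * ?\<tau>\<^sup>2 * M) + 2 * sqrt (?\<Theta> * M * ?\<tau>\<^sup>2) + 2 * sqrt (?\<Theta> * ?\<tau>\<^sup>2 * M) + 2 * sqrt (?\<Theta> * M * ?\<tau>\<^sup>2))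
      + 2 * (2 * sqrt (?\<tau>\<^sup>2 * ?\<Theta> * M) + 2 * sqrt (M * ?\<Theta> * ?\<tau>\<^sup>2))"
    unfolding sum.distrib sum_distrib_left[symmetric, of 2]
    by (intro add_mono mult_left_mono trilinear_bound \<alpha> h \<theta> \<theta>' finite_bad) simp
  also have "\<dots> = 16 * sqrt M * sqrt ?\<Theta> * ?\<tau>"
    using tail_nonneg[of "N div 2" t] by (simp add: real_sqrt_mult)
  finally show ?thesis .
qed

lemma continuous_on_flux_bdry [continuous_intros]: "continuous_on A (flux_bdry N L)"
  unfolding flux_bdry_def
  by (intro continuous_intros) (auto simp: bad_def pairs_def in_modes simp flip: of_int_diff)

lemma continuous_on_flux_rem [continuous_intros]: "continuous_on A (flux_rem N L)"
  unfolding flux_rem_def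
  by (intro continuous_intros) (auto simp: bad_def pairs_def in_modes simp flip: of_int_diff)

lemma continuous_on_flux [continuous_intros]: "continuous_on A (flux N)"
  unfolding flux_def by (intro continuous_intros)

text \<open>N is fixed, so the sum of |k| over \<open>modes N\<close> is a mere constant when L
  tends to infinity.\<close>

lemma flux_le:
  assumes M: "m t \<le> M" and "N \<le> L"
  shows "flux N t \<le> Re (\<Sum>z\<in>bad N L. - \<i> * of_int (fst z) * (osc (3 * fst z * snd z * (fst z - snd z)) t *
     (v (- fst z) t * v (snd z) t * v (fst z - snd z) t))) + (\<Sum>k\<in>modes N. \<bar>of_int k\<bar>) * (2 * M) * tail L t"
proof -
  have M0: "0 \<le> M" using m_nonneg[of t] M by simp
  have "flux N t - Re (\<Sum>k\<in>modes N. cnj (v k t) * (- \<i> * of_int k * quad L k t (\<lambda>p. v p t)))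
     = (\<Sum>k\<in>modes N. Re (cnj (v k t) * (- \<i> * of_int k * (w k t - quad L k t (\<lambda>p. v p t)))))"
    unfolding flux_def Re_sum sum_subtractf[symmetric] by (intro sum.cong refl) (simp add: algebra_simps)
  also have "\<dots> \<le> (\<Sum>k\<in>modes N. \<bar>of_int k\<bar> * (2 * M) * tail L t)"
  proof (intro sum_mono order_trans[OF complex_Re_le_cmod])
    fix k
    have "cmod (w k t - quad L k t (\<lambda>p. v p t)) \<le> 2 * sqrt (m t) * tail L t" unfolding tail_def by (rule w_approx)
    also have "\<dots> \<le> 2 * sqrt M * tail L t" using M tail_nonneg by (intro mult_right_mono) auto
    finally have w: "cmod (w k t - quad L k t (\<lambda>p. v p t)) \<le> 2 * sqrt M * tail L t" .
    have "cmod (v k t) * (\<bar>of_int k\<bar> * cmod (w k t - quad L k t (\<lambda>p. v p t))) \<le> sqrt M * (\<bar>of_int k\<bar> * (2 * sqrt M * tail L t))"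
      using M0 by (intro mult_mono cmod_v_le M w) auto
    also have "\<dots> = \<bar>of_int k\<bar> * (2 * M) * tail L t" using M0 by simp
    finally show "cmod (cnj (v k t) * (- \<i> * of_int k * (w k t - quad L k t (\<lambda>p. v p t)))) \<le> \<bar>of_int k\<bar> * (2 * M) * tail L t"
      by (simp add: norm_mult)
  qed
  finally show ?thesis unfolding flux_split[OF assms(2)] by (simp add: sum_distrib_right)
qed

lemma exp_has_vector_derivative:
  "((\<lambda>r. complex_of_real (exp (\<gamma> * r))) has_vector_derivative of_real (\<gamma> * exp (\<gamma> * r))) (at r)"
  by (auto intro!: derivative_eq_intros has_vector_derivative_of_real simp flip: has_real_derivative_iff_has_vector_derivative)

text \<open>\<open>\<Theta>\<close> is bounded uniformly in L only after integration,
  \<open>\<tau>\<close> tends to 0 only pointwise in time. Their product is therefore separated with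
  a parameter e, which is sent to 0 after N has tended to infinity.\<close>

lemma bad_integral_le:
  assumes t: "a \<le> t" and M: "\<And>r. r \<in> {a..t} \<Longrightarrow> m r \<le> M" and NL: "N \<le> L" and e: "0 < e"
  defines "\<Theta> \<equiv> \<lambda>r. 2 * forcing_mass \<gamma> P M + 2 * (\<Sum>j\<in>modes L. (cmod (w j r))\<^sup>2)" and "\<tau> \<equiv> tail (N div 2)"
  shows "integral {a..t} (\<lambda>r. exp (\<gamma> * r) * Re (\<Sum>z\<in>bad N L. - \<i> * of_int (fst z) * (osc (3 * fst z * snd z * (fst z - snd z)) r *
     (v (- fst z) r * v (snd z) r * v (fst z - snd z) r))))
    \<le> exp (\<gamma> * t) * (4 * M * \<tau> t) + exp (\<gamma> * a) * (4 * M * \<tau> a) + integral {a..t} (\<lambda>r. exp (\<gamma> * r) * (\<gamma> * (4 * M)) * \<tau> r ^ Suc 0)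
      + e * integral {a..t} (\<lambda>r. exp (\<gamma> * r) * \<Theta> r) + integral {a..t} (\<lambda>r. (exp (\<gamma> * r) * (64 * M / e)) * \<tau> r ^ Suc 1)"
proof -
  let ?S = "\<lambda>r. \<Sum>z\<in>bad N L. - \<i> * of_int (fst z) * (osc (3 * fst z * snd z * (fst z - snd z)) r *
     (v (- fst z) r * v (snd z) r * v (fst z - snd z) r))"
  have M0: "0 \<le> M" using m_nonneg[of t] M[of t] t by simp
  have cS: "continuous_on {a..t} ?S" by (intro continuous_intros)
  have c\<Theta>: "continuous_on {a..t} \<Theta>" unfolding \<Theta>_def by (intro continuous_intros)
  have c\<tau>: "continuous_on {a..t} \<tau>" unfolding \<tau>_def by (intro continuous_intros)
  have "((\<lambda>r. complex_of_real (exp (\<gamma> * r)) * (?S r + flux_rem N L r) + of_real (\<gamma> * exp (\<gamma> * r)) * flux_bdry N L r) has_integral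
     (of_real (exp (\<gamma> * t)) * flux_bdry N L t - of_real (exp (\<gamma> * a)) * flux_bdry N L a)) {a..t}"
    by (rule fundamental_theorem_of_calculus[OF t], rule has_vector_derivative_at_within)
       (rule has_vector_derivative_mult[OF exp_has_vector_derivative flux_bdry_deriv])
  then have "((\<lambda>r. Re (complex_of_real (exp (\<gamma> * r)) * (?S r + flux_rem N L r) + of_real (\<gamma> * exp (\<gamma> * r)) * flux_bdry N L r)) has_integral
     Re (of_real (exp (\<gamma> * t)) * flux_bdry N L t - of_real (exp (\<gamma> * a)) * flux_bdry N L a)) {a..t}"
    by (rule has_integral_linear[OF _ bounded_linear_Re, unfolded o_def])
  then have "((\<lambda>r. exp (\<gamma> * r) * Re (?S r) + exp (\<gamma> * r) * (Re (flux_rem N L r) + \<gamma> * Re (flux_bdry N L r))) has_integral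
     (exp (\<gamma> * t) * Re (flux_bdry N L t) - exp (\<gamma> * a) * Re (flux_bdry N L a))) {a..t}"
    by (simp add: algebra_simps)
  then have I: "integral {a..t} (\<lambda>r. exp (\<gamma> * r) * Re (?S r)) + integral {a..t} (\<lambda>r. exp (\<gamma> * r) * (Re (flux_rem N L r) + \<gamma> * Re (flux_bdry N L r)))
     = exp (\<gamma> * t) * Re (flux_bdry N L t) - exp (\<gamma> * a) * Re (flux_bdry N L a)"
    by (subst integral_add[symmetric]) (auto intro!: integral_unique integrable_continuous_real continuous_intros)
  have bd: "\<bar>Re (flux_bdry N L r)\<bar> \<le> 4 * M * \<tau> r" if "r \<in> {a..t}" for r
    unfolding \<tau>_def using abs_Re_le_cmod cmod_flux_bdry[OF M[OF that]] order_trans by blast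
  have "exp (\<gamma> * t) * Re (flux_bdry N L t) \<le> exp (\<gamma> * t) * (4 * M * \<tau> t)"
    using bd[of t] t by (intro mult_left_mono) auto
  moreover have "exp (\<gamma> * a) * - Re (flux_bdry N L a) \<le> exp (\<gamma> * a) * (4 * M * \<tau> a)"
    using bd[of a] t by (intro mult_left_mono) auto
  moreover have "- integral {a..t} (\<lambda>r. exp (\<gamma> * r) * (Re (flux_rem N L r) + \<gamma> * Re (flux_bdry N L r))) \<le>
      integral {a..t} (\<lambda>r. exp (\<gamma> * r) * (\<gamma> * (4 * M)) * \<tau> r ^ Suc 0)
      + e * integral {a..t} (\<lambda>r. exp (\<gamma> * r) * \<Theta> r) + integral {a..t} (\<lambda>r. (exp (\<gamma> * r) * (64 * M / e)) * \<tau> r ^ Suc 1)"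
  proof -
    have "- integral {a..t} (\<lambda>r. exp (\<gamma> * r) * (Re (flux_rem N L r) + \<gamma> * Re (flux_bdry N L r)))
      = integral {a..t} (\<lambda>r. - (exp (\<gamma> * r) * (Re (flux_rem N L r) + \<gamma> * Re (flux_bdry N L r))))"
      by (rule integral_neg[symmetric])
    also have "\<dots> \<le> integral {a..t} (\<lambda>r. exp (\<gamma> * r) * (\<gamma> * (4 * M)) * \<tau> r ^ Suc 0 + e * (exp (\<gamma> * r) * \<Theta> r) + (exp (\<gamma> * r) * (64 * M / e)) * \<tau> r ^ Suc 1)"
    proof (rule integral_le)
      fix r assume r: "r \<in> {a..t}"
      have \<Theta>0: "0 \<le> \<Theta> r"
        unfolding \<Theta>_def using l2le_theta[OF M[OF r], of L] by (rule l2le_nonneg)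
      have "- Re (flux_rem N L r) \<le> 16 * sqrt M * sqrt (\<Theta> r) * \<tau> r"
        using abs_Re_le_cmod[of "flux_rem N L r"] cmod_flux_rem[OF M[OF r] NL] unfolding \<Theta>_def \<tau>_def by linarith
      also have "\<dots> \<le> e * \<Theta> r + 64 * M / e * \<tau> r ^ 2"
      proof -
        \<comment> \<open>Chosen so that 2xy is the product to be split and x^2 carries the small
          factor e.\<close>
        define x where "x = sqrt (e * \<Theta> r)"
        define y where "y = 8 * sqrt M * \<tau> r / sqrt e"
        have "16 * sqrt M * sqrt (\<Theta> r) * \<tau> r = 2 * x * y"
          unfolding x_def y_def using e by (simp add: real_sqrt_mult)
        also have "\<dots> \<le> x\<^sup>2 + y\<^sup>2" by (rule sum_squares_bound)
        also have "x\<^sup>2 = e * \<Theta> r" unfolding x_def using e \<Theta>0 by simp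
        also have "y\<^sup>2 = 64 * M / e * \<tau> r ^ 2" unfolding y_def using e M0 by (simp add: power_mult_distrib power_divide)
        finally show ?thesis .
      qed
      finally have 1: "- Re (flux_rem N L r) \<le> e * \<Theta> r + 64 * M / e * \<tau> r ^ 2" .
      have "\<gamma> * - Re (flux_bdry N L r) \<le> \<gamma> * (4 * M * \<tau> r)"
        using bd[OF r] \<gamma>_pos by (intro mult_left_mono) auto
      with 1 have "- (Re (flux_rem N L r) + \<gamma> * Re (flux_bdry N L r)) \<le> \<gamma> * (4 * M * \<tau> r) + (e * \<Theta> r + 64 * M / e * \<tau> r ^ 2)" by simp
      then have "exp (\<gamma> * r) * - (Re (flux_rem N L r) + \<gamma> * Re (flux_bdry N L r)) \<le> exp (\<gamma> * r) * (\<gamma> * (4 * M * \<tau> r) + (e * \<Theta> r + 64 * M / e * \<tau> r ^ 2))"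
        by (rule mult_left_mono) simp
      also have "\<dots> = exp (\<gamma> * r) * (\<gamma> * (4 * M)) * \<tau> r ^ Suc 0 + e * (exp (\<gamma> * r) * \<Theta> r) + (exp (\<gamma> * r) * (64 * M / e)) * \<tau> r ^ Suc 1"
        by (simp add: power2_eq_square algebra_simps)
      finally show "- (exp (\<gamma> * r) * (Re (flux_rem N L r) + \<gamma> * Re (flux_bdry N L r))) \<le> exp (\<gamma> * r) * (\<gamma> * (4 * M)) * \<tau> r ^ Suc 0 + e * (exp (\<gamma> * r) * \<Theta> r) + (exp (\<gamma> * r) * (64 * M / e)) * \<tau> r ^ Suc 1"
        by (simp only: mult_minus_right)
    qed (intro integrable_continuous_real continuous_intros c\<Theta> c\<tau>)+
    also have "\<dots> = integral {a..t} (\<lambda>r. exp (\<gamma> * r) * (\<gamma> * (4 * M)) * \<tau> r ^ Suc 0)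
      + e * integral {a..t} (\<lambda>r. exp (\<gamma> * r) * \<Theta> r) + integral {a..t} (\<lambda>r. (exp (\<gamma> * r) * (64 * M / e)) * \<tau> r ^ Suc 1)"
      unfolding integral_mult_right[symmetric]
      by (subst integral_add, (intro integrable_continuous_real continuous_intros c\<Theta> c\<tau>)+)+ (rule refl)
    finally show ?thesis .
  qed
  ultimately show ?thesis using I by linarith
qed

text \<open>The limit L to infinity: the right-hand side contains no L because
  \<open>omega_integral\<close> is uniform in the number of modes.\<close>

lemma flux_integral_le:
  assumes t: "a \<le> t" and M: "\<And>r. r \<in> {a..t} \<Longrightarrow> m r \<le> M" and e: "0 < e"
  defines "\<tau> \<equiv> \<lambda>N. tail (N div 2)"
  shows "integral {a..t} (\<lambda>r. exp (\<gamma> * r) * flux N r) \<le>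
     exp (\<gamma> * t) * (4 * M * \<tau> N t) + exp (\<gamma> * a) * (4 * M * \<tau> N a) + integral {a..t} (\<lambda>r. exp (\<gamma> * r) * (\<gamma> * (4 * M)) * \<tau> N r ^ Suc 0)
      + e * (2 * exp (\<gamma> * t) * (forcing_mass \<gamma> P M / \<gamma> + strichartz_const \<gamma> P M)) + integral {a..t} (\<lambda>r. (exp (\<gamma> * r) * (64 * M / e)) * \<tau> N r ^ Suc 1)"
    (is "_ \<le> ?R")
proof -
  let ?c = "(\<Sum>k\<in>modes N. \<bar>real_of_int k\<bar>) * (2 * M)"
  let ?T = "\<lambda>L. integral {a..t} (\<lambda>r. (exp (\<gamma> * r) * ?c) * tail L r ^ Suc 0)"
  have ev: "integral {a..t} (\<lambda>r. exp (\<gamma> * r) * flux N r) \<le> ?R + ?T L" if L: "N \<le> L" for L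
  proof -
    let ?S = "\<lambda>r. \<Sum>z\<in>bad N L. - \<i> * of_int (fst z) * (osc (3 * fst z * snd z * (fst z - snd z)) r *
     (v (- fst z) r * v (snd z) r * v (fst z - snd z) r))"
    let ?\<Omega> = "\<lambda>r. \<Sum>j\<in>modes L. (cmod (w j r))\<^sup>2"
    have "integral {a..t} (\<lambda>r. exp (\<gamma> * r) * flux N r) \<le> integral {a..t} (\<lambda>r. exp (\<gamma> * r) * Re (?S r) + (exp (\<gamma> * r) * ?c) * tail L r ^ Suc 0)"
    proof (rule integral_le)
      fix r assume "r \<in> {a..t}"
      then have "exp (\<gamma> * r) * flux N r \<le> exp (\<gamma> * r) * (Re (?S r) + ?c * tail L r)"
        by (intro mult_left_mono flux_le M L) auto
      then show "exp (\<gamma> * r) * flux N r \<le> exp (\<gamma> * r) * Re (?S r) + (exp (\<gamma> * r) * ?c) * tail L r ^ Suc 0"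
        by (simp only: distrib_left mult.assoc power_Suc0_right)
    qed (intro integrable_continuous_real continuous_intros)+
    also have "\<dots> = integral {a..t} (\<lambda>r. exp (\<gamma> * r) * Re (?S r)) + ?T L"
      by (rule integral_add) (intro integrable_continuous_real continuous_intros)+
    also have "integral {a..t} (\<lambda>r. exp (\<gamma> * r) * Re (?S r)) \<le> ?R"
    proof -
      have Q0: "0 \<le> forcing_mass \<gamma> P M"
        unfolding forcing_mass_def using M[of t] t by (intro l2le_nonneg[OF l2le_forcing[of t]]) auto
      have "exp (- \<gamma> * t) * integral {a..t} (\<lambda>r. exp (\<gamma> * r) * (2 * forcing_mass \<gamma> P M + 2 * ?\<Omega> r)) =
        2 * (exp (- \<gamma> * t) * integral {a..t} (\<lambda>r. exp (\<gamma> * r) * forcing_mass \<gamma> P M) + exp (- \<gamma> * t) * integral {a..t} (\<lambda>r. exp (\<gamma> * r) * ?\<Omega> r))"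
      proof -
        have "integral {a..t} (\<lambda>r. exp (\<gamma> * r) * (2 * forcing_mass \<gamma> P M + 2 * ?\<Omega> r)) =
          integral {a..t} (\<lambda>r. 2 * (exp (\<gamma> * r) * forcing_mass \<gamma> P M + exp (\<gamma> * r) * ?\<Omega> r))"
          by (simp only: distrib_left mult.left_commute)
        also have "\<dots> = 2 * (integral {a..t} (\<lambda>r. exp (\<gamma> * r) * forcing_mass \<gamma> P M) + integral {a..t} (\<lambda>r. exp (\<gamma> * r) * ?\<Omega> r))"
          unfolding integral_mult_right
          by (subst integral_add) (intro integrable_continuous_real continuous_intros | rule refl)+
        finally show ?thesis by (simp only: distrib_left mult.left_commute)
      qed
      also have "\<dots> \<le> 2 * (forcing_mass \<gamma> P M / \<gamma> + strichartz_const \<gamma> P M)"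
        by (intro mult_left_mono add_mono weighted_integral_le \<gamma>_pos t Q0 omega_integral M continuous_intros order_refl) auto
      finally have "exp (\<gamma> * t) * (exp (- \<gamma> * t) * integral {a..t} (\<lambda>r. exp (\<gamma> * r) * (2 * forcing_mass \<gamma> P M + 2 * ?\<Omega> r)))
         \<le> exp (\<gamma> * t) * (2 * (forcing_mass \<gamma> P M / \<gamma> + strichartz_const \<gamma> P M))"
        by (rule mult_left_mono) simp
      moreover have "exp (\<gamma> * t) * (exp (- \<gamma> * t) * x) = x" for x
        by (simp add: exp_minus)
      moreover have "exp (\<gamma> * t) * (2 * x) = 2 * exp (\<gamma> * t) * x" for x by simp
      ultimately have "integral {a..t} (\<lambda>r. exp (\<gamma> * r) * (2 * forcing_mass \<gamma> P M + 2 * ?\<Omega> r))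
         \<le> 2 * exp (\<gamma> * t) * (forcing_mass \<gamma> P M / \<gamma> + strichartz_const \<gamma> P M)" by (simp only:)
      then have "e * integral {a..t} (\<lambda>r. exp (\<gamma> * r) * (2 * forcing_mass \<gamma> P M + 2 * ?\<Omega> r))
         \<le> e * (2 * exp (\<gamma> * t) * (forcing_mass \<gamma> P M / \<gamma> + strichartz_const \<gamma> P M))"
        using e by (intro mult_left_mono) auto
      then show ?thesis
        using bad_integral_le[OF t M L e] unfolding \<tau>_def by linarith
    qed
    finally show ?thesis by simp
  qed
  have "(\<lambda>L. ?R + ?T L) \<longlonglongrightarrow> ?R + 0"
    by (intro tendsto_intros tail_integral_tendsto[OF M] continuous_intros)
  then show ?thesis
    by (intro LIMSEQ_le_const[of "\<lambda>L. ?R + ?T L"]) (use ev in auto)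
qed

lemma mass_modes: "(\<Sum>k\<in>modes N. (cmod (v k t))\<^sup>2) = m t - (tail N t)\<^sup>2"
  unfolding tail_def using sum_le_m[of "modes N" t] by simp

lemma cmod_v_square_deriv:
  "((\<lambda>t. (cmod (v k t))\<^sup>2) has_vector_derivative 2 * Re (cnj (v k t) * vdot k t)) (at t)"
proof -
  have "((\<lambda>t. v k t * cnj (v k t)) has_vector_derivative (v k t * cnj (vdot k t) + vdot k t * cnj (v k t))) (at t)"
    by (intro has_vector_derivative_mult v_vdot bounded_linear.has_vector_derivative[OF bounded_linear_cnj])
  then have "((\<lambda>t. Re (v k t * cnj (v k t))) has_vector_derivative Re (v k t * cnj (vdot k t) + vdot k t * cnj (v k t))) (at t)"
    by (rule bounded_linear.has_vector_derivative[OF bounded_linear_Re])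
  also have "(\<lambda>t. Re (v k t * cnj (v k t))) = (\<lambda>t. (cmod (v k t))\<^sup>2)"
    by (simp only: cmod_power2) (simp add: power2_eq_square)
  also have "Re (v k t * cnj (vdot k t) + vdot k t * cnj (v k t)) = 2 * Re (cnj (v k t) * vdot k t)"
    by simp
  finally show ?thesis .
qed

text \<open>The flux is bounded above by terms that vanish as N tends to infinity, apart from a
  multiple of e; then e tends to 0. M makes these limits legitimate and does not survive in the
  conclusion. The forcing is absorbed by half of the damping: 2 Re(conj(v) f) <= \<gamma> |v|^2 +
  |f|^2/\<gamma>.\<close>

theorem energy:
  assumes t: "a \<le> t" and M: "\<And>r. r \<in> {a..t} \<Longrightarrow> m r \<le> M"
  shows "m t \<le> exp (- \<gamma> * (t - a)) * m a + P / \<gamma>\<^sup>2"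
proof -
  let ?K = "2 * exp (\<gamma> * t) * (forcing_mass \<gamma> P M / \<gamma> + strichartz_const \<gamma> P M)"
  let ?R = "\<lambda>e n. exp (\<gamma> * t) * (4 * M * tail n t) + exp (\<gamma> * a) * (4 * M * tail n a) + integral {a..t} (\<lambda>r. exp (\<gamma> * r) * (\<gamma> * (4 * M)) * tail n r ^ Suc 0)
      + e * ?K + integral {a..t} (\<lambda>r. (exp (\<gamma> * r) * (64 * M / e)) * tail n r ^ Suc 1)"
  have P0: "0 \<le> P" using f_bound by (rule l2le_nonneg)
  have step: "exp (\<gamma> * t) * (m t - (tail N t)\<^sup>2) \<le> exp (\<gamma> * a) * (m a - (tail N a)\<^sup>2) + exp (\<gamma> * t) * (P / \<gamma> / \<gamma>) + integral {a..t} (\<lambda>r. exp (\<gamma> * r) * flux N r)" for N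
  proof -
    let ?G = "\<lambda>r. exp (\<gamma> * r) * (\<Sum>k\<in>modes N. 2 * Re (cnj (v k r) * vdot k r)) + (\<gamma> * exp (\<gamma> * r)) * (\<Sum>k\<in>modes N. (cmod (v k r))\<^sup>2)"
    have "(?G has_integral (exp (\<gamma> * t) * (\<Sum>k\<in>modes N. (cmod (v k t))\<^sup>2) - exp (\<gamma> * a) * (\<Sum>k\<in>modes N. (cmod (v k a))\<^sup>2))) {a..t}"
    proof (rule fundamental_theorem_of_calculus[OF t], rule has_vector_derivative_at_within)
      fix r
      have "((\<lambda>r. exp (\<gamma> * r)) has_vector_derivative (\<gamma> * exp (\<gamma> * r))) (at r)"
        by (auto intro!: derivative_eq_intros simp flip: has_real_derivative_iff_has_vector_derivative)
      then show "((\<lambda>r. exp (\<gamma> * r) * (\<Sum>k\<in>modes N. (cmod (v k r))\<^sup>2)) has_vector_derivative ?G r) (at r)"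
        by (intro has_vector_derivative_mult has_vector_derivative_sum cmod_v_square_deriv)
    qed
    then have "exp (\<gamma> * t) * (m t - (tail N t)\<^sup>2) - exp (\<gamma> * a) * (m a - (tail N a)\<^sup>2) = integral {a..t} ?G"
      unfolding mass_modes[symmetric] by (rule integral_unique[symmetric])
    also have "\<dots> \<le> integral {a..t} (\<lambda>r. exp (\<gamma> * r) * (P / \<gamma>) + exp (\<gamma> * r) * flux N r)"
    proof (rule integral_le)
      fix r
      have "(\<Sum>k\<in>modes N. 2 * Re (cnj (v k r) * vdot k r)) + \<gamma> * (\<Sum>k\<in>modes N. (cmod (v k r))\<^sup>2) - flux N r
        = (\<Sum>k\<in>modes N. 2 * Re (cnj (v k r) * (osc (k ^ 3) r * f k)) - \<gamma> * (cmod (v k r))\<^sup>2)"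
        unfolding flux_def sum_distrib_left sum.distrib[symmetric] sum_subtractf[symmetric]
      proof (intro sum.cong refl)
        fix k
        have "Re (cnj z * (F - of_real \<gamma> * z - \<i> * K / 2 * W)) * 2 + \<gamma> * (cmod z)\<^sup>2 - Re (cnj z * (- \<i> * K * W)) = 2 * Re (cnj z * F) - \<gamma> * (cmod z)\<^sup>2"
          for z F K W
          unfolding cmod_power2 by (simp add: power2_eq_square field_simps)
        from this[of "v k r" "osc (k ^ 3) r * f k" "of_int k" "w k r"]
        show "2 * Re (cnj (v k r) * vdot k r) + \<gamma> * (cmod (v k r))\<^sup>2 - Re (cnj (v k r) * (- \<i> * of_int k * w k r))
          = 2 * Re (cnj (v k r) * (osc (k ^ 3) r * f k)) - \<gamma> * (cmod (v k r))\<^sup>2"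
          unfolding vdot_def forcing_def by (simp only: mult.commute[of 2])
      qed
      also have "\<dots> \<le> (\<Sum>k\<in>modes N. (cmod (f k))\<^sup>2 / \<gamma>)"
      proof (intro sum_mono)
        fix k
        have "Re (cnj (v k r) * (osc (k ^ 3) r * f k)) \<le> cmod (v k r) * cmod (f k)"
          using complex_Re_le_cmod[of "cnj (v k r) * (osc (k ^ 3) r * f k)"] by (simp add: norm_mult)
        moreover have "2 * (cmod (v k r) * cmod (f k)) \<le> \<gamma> * (cmod (v k r))\<^sup>2 + (cmod (f k))\<^sup>2 / \<gamma>"
        proof -
          define x where "x = sqrt \<gamma> * cmod (v k r)"
          define y where "y = cmod (f k) / sqrt \<gamma>"
          have "2 * (cmod (v k r) * cmod (f k)) = 2 * x * y" unfolding x_def y_def using \<gamma>_pos by simp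
          also have "\<dots> \<le> x\<^sup>2 + y\<^sup>2" by (rule sum_squares_bound)
          finally show ?thesis unfolding x_def y_def using \<gamma>_pos by (simp add: power_mult_distrib power_divide)
        qed
        ultimately show "2 * Re (cnj (v k r) * (osc (k ^ 3) r * f k)) - \<gamma> * (cmod (v k r))\<^sup>2 \<le> (cmod (f k))\<^sup>2 / \<gamma>" by simp
      qed
      also have "\<dots> \<le> P / \<gamma>"
        unfolding sum_divide_distrib[symmetric] using \<gamma>_pos by (intro divide_right_mono l2leD[OF f_bound]) auto
      finally have "exp (\<gamma> * r) * ((\<Sum>k\<in>modes N. 2 * Re (cnj (v k r) * vdot k r)) + \<gamma> * (\<Sum>k\<in>modes N. (cmod (v k r))\<^sup>2)) \<le> exp (\<gamma> * r) * (P / \<gamma> + flux N r)"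
        by (intro mult_left_mono) auto
      then show "?G r \<le> exp (\<gamma> * r) * (P / \<gamma>) + exp (\<gamma> * r) * flux N r"
        by (simp only: distrib_left mult.assoc mult.left_commute[of \<gamma>])
    qed (intro integrable_continuous_real continuous_intros)+
    also have "\<dots> = integral {a..t} (\<lambda>r. exp (\<gamma> * r) * (P / \<gamma>)) + integral {a..t} (\<lambda>r. exp (\<gamma> * r) * flux N r)"
      by (rule integral_add) (intro integrable_continuous_real continuous_intros)+
    also have "integral {a..t} (\<lambda>r. exp (\<gamma> * r) * (P / \<gamma>)) \<le> exp (\<gamma> * t) * (P / \<gamma> / \<gamma>)"
    proof -
      have "exp (\<gamma> * t) * (exp (- \<gamma> * t) * integral {a..t} (\<lambda>r. exp (\<gamma> * r) * (P / \<gamma>))) \<le> exp (\<gamma> * t) * (P / \<gamma> / \<gamma>)"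
        using P0 \<gamma>_pos by (intro mult_left_mono weighted_integral_le t) auto
      moreover have "exp (\<gamma> * t) * (exp (- \<gamma> * t) * x) = x" for x by (simp add: exp_minus)
      ultimately show ?thesis by (simp only:)
    qed
    finally show ?thesis by simp
  qed
  have lim_e: "exp (\<gamma> * t) * m t \<le> exp (\<gamma> * a) * m a + exp (\<gamma> * t) * (P / \<gamma> / \<gamma>) + e * ?K" if e: "0 < e" for e
  proof -
    \<comment> \<open>Even indices are used because the bounds for the flux through 2n involve the
      tail at 2n div 2 = n.\<close>
    have sub: "(\<lambda>n. tail (2 * n) r) \<longlonglongrightarrow> 0" for r
      using LIMSEQ_subseq_LIMSEQ[OF tail_tendsto[of r], of "\<lambda>n. 2 * n"] by (simp add: o_def strict_mono_def)
    have ev: "exp (\<gamma> * t) * (m t - (tail (2 * n) t)\<^sup>2) \<le> exp (\<gamma> * a) * (m a - (tail (2 * n) a)\<^sup>2) + exp (\<gamma> * t) * (P / \<gamma> / \<gamma>) + ?R e n" for n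
      using order_trans[OF step[of "2 * n"] add_left_mono[OF flux_integral_le[OF t M e, of "2 * n"]]] by simp
    have L: "(\<lambda>n. exp (\<gamma> * t) * (m t - (tail (2 * n) t)\<^sup>2)) \<longlonglongrightarrow> exp (\<gamma> * t) * (m t - 0\<^sup>2)"
      by (intro tendsto_intros sub)
    have R: "(\<lambda>n. exp (\<gamma> * a) * (m a - (tail (2 * n) a)\<^sup>2) + exp (\<gamma> * t) * (P / \<gamma> / \<gamma>) + ?R e n) \<longlonglongrightarrow>
      exp (\<gamma> * a) * (m a - 0\<^sup>2) + exp (\<gamma> * t) * (P / \<gamma> / \<gamma>) + (exp (\<gamma> * t) * (4 * M * 0) + exp (\<gamma> * a) * (4 * M * 0) + 0 + e * ?K + 0)"
      by (intro tendsto_add tendsto_mult tendsto_const tendsto_diff tendsto_power sub tail_tendsto tail_integral_tendsto[OF M] continuous_intros)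
    from LIMSEQ_le[OF L R] ev show ?thesis by auto
  qed
  have "exp (\<gamma> * t) * m t \<le> exp (\<gamma> * a) * m a + exp (\<gamma> * t) * (P / \<gamma> / \<gamma>)"
  proof (rule field_le_epsilon)
    fix d :: real assume d: "0 < d"
    \<comment> \<open>Division by |K| + 1 makes eK at most d whatever the sign of K.\<close>
    have "(d / (\<bar>?K\<bar> + 1)) * ?K \<le> (d / (\<bar>?K\<bar> + 1)) * (\<bar>?K\<bar> + 1)" using d by (intro mult_left_mono) auto
    also have "\<dots> = d" by (simp add: add_nonneg_eq_0_iff)
    finally show "exp (\<gamma> * t) * m t \<le> exp (\<gamma> * a) * m a + exp (\<gamma> * t) * (P / \<gamma> / \<gamma>) + d"
      using lim_e[of "d / (\<bar>?K\<bar> + 1)"] d by (smt (verit) divide_pos_pos)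
  qed
  then have "exp (- \<gamma> * t) * (exp (\<gamma> * t) * m t) \<le> exp (- \<gamma> * t) * (exp (\<gamma> * a) * m a + exp (\<gamma> * t) * (P / \<gamma> / \<gamma>))"
    by (rule mult_left_mono) simp
  also have "exp (- \<gamma> * t) * (exp (\<gamma> * t) * m t) = m t" by (simp add: exp_minus)
  also have "exp (- \<gamma> * t) * (exp (\<gamma> * a) * m a + exp (\<gamma> * t) * (P / \<gamma> / \<gamma>)) = exp (- \<gamma> * (t - a)) * m a + P / \<gamma>\<^sup>2"
    by (simp add: exp_minus exp_diff right_diff_distrib power2_eq_square field_simps)
  finally show ?thesis .
qed

end

section \<open>Fourier series on the torus\<close>

text \<open>A finite measure of mass 2 pi, on which square integrable functions are integrable; both
  endpoints are kept, as they form a null set.\<close>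

definition torus :: "real measure" where
  "torus = restrict_space lborel {0..2 * pi}"

lemma integral_torus:
  fixes g :: "real \<Rightarrow> 'a :: {banach, second_countable_topology}"
  shows "integral\<^sup>L torus g = (LINT x:{0..2 * pi}|lborel. g x)"
  unfolding torus_def set_lebesgue_integral_def by (subst integral_restrict_space) auto

lemma integrable_torus:
  fixes g :: "real \<Rightarrow> 'a :: {banach, second_countable_topology}"
  shows "integrable torus g \<longleftrightarrow> set_integrable lborel {0..2 * pi} g"
  unfolding torus_def set_integrable_def by (subst integrable_restrict_space) auto

lemma space_torus: "space torus = {0..2 * pi}"
  by (simp add: torus_def)

lemma borel_measurable_torus [measurable (raw)]: "g \<in> borel_measurable borel \<Longrightarrow> g \<in> borel_measurable torus"
  unfolding torus_def by (rule measurable_restrict_space1) simp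

lemma emeasure_torus: "emeasure torus (space torus) = ennreal (2 * pi)"
  unfolding torus_def by (simp add: emeasure_restrict_space space_restrict_space)

lemma measure_torus: "measure torus (space torus) = 2 * pi"
  by (simp add: measure_def emeasure_torus)

interpretation torus: finite_measure torus
  by standard (simp add: emeasure_torus)

lemma AE_torusI: "(AE x in lborel. Q x) \<Longrightarrow> (AE x in torus. Q x)"
  unfolding torus_def by (subst AE_restrict_space_iff) auto

lemma integrable_mult_bounded:
  fixes g b :: "'a \<Rightarrow> complex"
  assumes "integrable M g" "b \<in> borel_measurable M" "\<And>x. cmod (b x) \<le> B"
  shows "integrable M (\<lambda>x. g x * b x)"
proof (rule Bochner_Integration.integrable_bound[of M "\<lambda>x. B * cmod (g x)"])
  show "integrable M (\<lambda>x. B * cmod (g x))" using assms by auto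
  show "(\<lambda>x. g x * b x) \<in> borel_measurable M" using assms by (auto intro: borel_measurable_times)
  show "AE x in M. norm (g x * b x) \<le> norm (B * cmod (g x))"
    using assms(3) by (auto simp: norm_mult abs_mult mult.commute intro!: mult_right_mono order_trans[OF _ abs_ge_self])
qed

lemma cis_borel_measurable [measurable]: "(\<lambda>x. cis (c * x)) \<in> borel_measurable borel"
  by (intro borel_measurable_continuous_onI continuous_intros)

section \<open>Uniqueness of Fourier coefficients for integrable functions\<close>

definition spectrum_free :: "(real \<Rightarrow> complex) \<Rightarrow> bool" where
  "spectrum_free g \<longleftrightarrow> integrable torus g \<and> (\<forall>k::int. (LINT x|torus. g x * cis (of_int k * x)) = 0)"

lemma integrable_times_cis:
  "integrable torus g \<Longrightarrow> integrable torus (\<lambda>x. g x * cis (c * x))"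
  by (rule integrable_mult_bounded[where B = 1]) auto

text \<open>A real linear function of cis x is a combination of exp(ix) and exp(-ix), so
  multiplication by it only shifts the coefficients. The induction is over all g at once, which lets
  products be multiplied in one factor at a time.\<close>

lemma spectrum_free_poly:
  assumes "real_polynomial_function p" "spectrum_free g"
  shows "spectrum_free (\<lambda>x. g x * of_real (p (cis x)))"
  using assms
proof (induction arbitrary: g rule: real_polynomial_function.induct)
  case (linear f)
  interpret f: bounded_linear f by fact
  define A B where "A = (of_real (f 1) - \<i> * of_real (f \<i>)) / 2" and "B = (of_real (f 1) + \<i> * of_real (f \<i>)) / 2"
  have eq: "of_real (f (cis x)) = A * cis (1 * x) + B * cis (-1 * x)" for x
  proof -
    have "cis x = cos x *\<^sub>R 1 + sin x *\<^sub>R \<i>" by (simp add: complex_eq_iff)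
    then have "f (cis x) = cos x * f 1 + sin x * f \<i>" by (simp only: f.add f.scaleR real_scaleR_def)
    then show ?thesis by (simp add: A_def B_def complex_eq_iff field_simps)
  qed
  have gi: "integrable torus g" and g0: "(LINT x|torus. g x * cis (of_int k * x)) = 0" for k :: int
    using linear by (auto simp: spectrum_free_def)
  have eq2: "g x * of_real (f (cis x)) = A * (g x * cis (1 * x)) + B * (g x * cis (-1 * x))" for x
    unfolding eq by (simp add: algebra_simps)
  have int: "integrable torus (\<lambda>x. g x * of_real (f (cis x)))"
    unfolding eq2 by (intro Bochner_Integration.integrable_add Bochner_Integration.integrable_mult_right integrable_times_cis gi)
  have eq3: "g x * of_real (f (cis x)) * cis (of_int k * x) = A * (g x * cis (of_int (k + 1) * x)) + B * (g x * cis (of_int (k - 1) * x))" for k x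
    unfolding eq by (simp add: algebra_simps cis_mult)
  have "(LINT x|torus. g x * of_real (f (cis x)) * cis (of_int k * x)) = 0" for k :: int
    unfolding eq3
    by (subst Bochner_Integration.integral_add) (auto intro!: integrable_times_cis gi simp: g0 simp del: of_int_add of_int_diff)
  with int show ?case by (simp add: spectrum_free_def)
next
  case (const c)
  have eq: "g x * of_real c * cis (of_int k * x) = of_real c * (g x * cis (of_int k * x))" for x and k :: int by simp
  show ?case using const unfolding spectrum_free_def eq by simp
next
  case (add p q)
  from add.IH(1)[OF add.prems] add.IH(2)[OF add.prems] show ?case
    by (simp add: spectrum_free_def distrib_left distrib_right integrable_times_cis)
next
  case (mult p q)
  from mult.IH(2)[OF mult.IH(1)[OF mult.prems]] show ?case by (simp add: mult.assoc)
qed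

text \<open>Stone-Weierstrass on the unit circle: a uniform error e in the approximation costs at
  most e times the L^1 norm of g.\<close>

lemma spectrum_free_continuous:
  assumes g: "spectrum_free g" and \<phi>: "continuous_on UNIV \<phi>" and b: "\<And>z. \<bar>\<phi> z\<bar> \<le> 1"
  shows "(LINT x|torus. g x * of_real (\<phi> (cis x))) = 0"
proof -
  have gi: "integrable torus g" using g by (simp add: spectrum_free_def)
  have \<phi>m: "(\<lambda>x. complex_of_real (\<phi> (cis x))) \<in> borel_measurable torus"
    by (intro borel_measurable_torus borel_measurable_continuous_onI continuous_intros continuous_on_compose2[OF \<phi>]) auto
  have i\<phi>: "integrable torus (\<lambda>x. g x * of_real (\<phi> (cis x)))"
    by (rule integrable_mult_bounded[OF gi \<phi>m, where B = 1]) (use b in auto)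
  have small: "cmod (LINT x|torus. g x * of_real (\<phi> (cis x))) \<le> e * (LINT x|torus. cmod (g x))" if e: "0 < e" for e
  proof -
    obtain p where p: "real_polynomial_function p" "\<And>x. x \<in> sphere 0 1 \<Longrightarrow> \<bar>\<phi> x - p x\<bar> < e"
      using Stone_Weierstrass_real_polynomial_function[of "sphere (0::complex) 1" \<phi> e] e \<phi> continuous_on_subset by (metis compact_sphere subset_UNIV)
    have sp: "spectrum_free (\<lambda>x. g x * of_real (p (cis x)))" by (rule spectrum_free_poly[OF p(1) g])
    then have ip: "integrable torus (\<lambda>x. g x * of_real (p (cis x)))" by (simp add: spectrum_free_def)
    have "(LINT x|torus. g x * of_real (p (cis x)) * cis (of_int 0 * x)) = 0"
      using sp unfolding spectrum_free_def by blast
    then have p0: "(LINT x|torus. g x * of_real (p (cis x))) = 0" by simp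
    have "cmod (LINT x|torus. g x * of_real (\<phi> (cis x))) = cmod (LINT x|torus. g x * of_real (\<phi> (cis x)) - g x * of_real (p (cis x)))"
      using p0 by (subst Bochner_Integration.integral_diff[OF i\<phi> ip]) simp
    also have "\<dots> \<le> (LINT x|torus. e * cmod (g x))"
    proof (rule order_trans[OF integral_norm_bound integral_mono])
      fix x
      have "\<bar>\<phi> (cis x) - p (cis x)\<bar> \<le> e" using p(2)[of "cis x"] by simp
      then have "cmod (g x) * \<bar>\<phi> (cis x) - p (cis x)\<bar> \<le> cmod (g x) * e" by (intro mult_left_mono) auto
      then show "cmod (g x * of_real (\<phi> (cis x)) - g x * of_real (p (cis x))) \<le> e * cmod (g x)"
        by (simp add: norm_mult mult.commute flip: right_diff_distrib of_real_diff)
    qed (use gi i\<phi> ip in \<open>auto intro!: integrable_norm Bochner_Integration.integrable_diff\<close>)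
    finally show ?thesis by simp
  qed
  have "cmod (LINT x|torus. g x * of_real (\<phi> (cis x))) \<le> 0"
  proof (rule field_le_epsilon)
    fix d :: real assume d: "0 < d"
    let ?I = "LINT x|torus. cmod (g x)"
    have "0 \<le> ?I" by simp
    then have "d / (?I + 1) * ?I \<le> d / (?I + 1) * (?I + 1)" using d by (intro mult_left_mono) auto
    also have "\<dots> = d" using \<open>0 \<le> ?I\<close> by (simp add: add_nonneg_eq_0_iff)
    finally show "cmod (LINT x|torus. g x * of_real (\<phi> (cis x))) \<le> 0 + d"
      using small[of "d / (?I + 1)"] d \<open>0 \<le> ?I\<close> by (smt (verit) divide_pos_pos)
  qed
  then show ?thesis by simp
qed

text \<open>Both points stay strictly below 2 pi, where cis is injective; at 2 pi the circle closes
  up.\<close>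

lemma cis_in_arc:
  assumes "0 \<le> x" "x < 2 * pi" "0 \<le> b" "b < 2 * pi"
  shows "cis x \<in> cis ` {0..b} \<longleftrightarrow> x \<le> b"
proof
  assume "cis x \<in> cis ` {0..b}"
  then obtain y where y: "y \<in> {0..b}" "cis x = cis y" by auto
  then have "sin x = sin y" "cos x = cos y" by (auto simp: complex_eq_iff)
  then obtain n :: int where n: "x = y + 2 * pi * n" using sin_cos_eq_iff by metis
  have "real_of_int n < 1" "real_of_int n > -1"
  proof -
    have pi2: "0 < 2 * pi" by simp
    have "2 * pi * n < 2 * pi * 1" "2 * pi * (-1) < 2 * pi * n" using n assms y unfolding atLeastAtMost_iff by linarith+
    then show "real_of_int n < 1" "real_of_int n > -1" by (simp_all only: mult_less_cancel_left_pos[OF pi2])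
  qed
  then have "n = 0" by linarith
  then show "x \<le> b" using n y by auto
qed (use assms in auto)

lemma AE_torus_neq: "AE x in torus. x \<noteq> c"
  by (rule AE_torusI, rule AE_lborel_singleton)

lemma AE_torus_space: "AE x in torus. 0 \<le> x \<and> x < 2 * pi"
  using AE_torus_neq[of "2 * pi"] AE_space by eventually_elim (auto simp: space_torus)

text \<open>The functions max(0, 1 - n dist) of the distance to a closed arc converge pointwise to
  the indicator of the arc. The point x = 2 pi, which cis identifies with 0, is discarded as a null
  set.\<close>

lemma spectrum_free_interval:
  assumes g: "spectrum_free g" and b: "0 \<le> b" "b < 2 * pi"
  shows "(LINT x|torus. g x * indicator {..b} x) = 0"
proof -
  let ?C = "cis ` {0..b}"
  define \<phi> where "\<phi> n z = max 0 (1 - real n * infdist z ?C)" for n z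
  have C: "closed ?C" "?C \<noteq> {}"
    using b by (auto intro!: compact_imp_closed compact_continuous_image continuous_intros)
  have gi: "integrable torus g" using g by (simp add: spectrum_free_def)
  have \<phi>c: "continuous_on UNIV (\<phi> n)" for n unfolding \<phi>_def by (intro continuous_intros)
  have \<phi>b: "\<bar>\<phi> n z\<bar> \<le> 1" for n z unfolding \<phi>_def using infdist_nonneg[of z ?C] by auto
  have z: "(LINT x|torus. g x * of_real (\<phi> n (cis x))) = 0" for n
    by (rule spectrum_free_continuous[OF g \<phi>c \<phi>b])
  have "(\<lambda>n. LINT x|torus. g x * of_real (\<phi> n (cis x))) \<longlonglongrightarrow> (LINT x|torus. g x * indicator {..b} x)"
  proof (rule integral_dominated_convergence[where w = "\<lambda>x. cmod (g x)"])
    have m: "g \<in> borel_measurable torus" using gi by auto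
    have "(indicator {..b} :: real \<Rightarrow> complex) \<in> borel_measurable borel" by measurable
    then show "(\<lambda>x. g x * indicator {..b} x) \<in> borel_measurable torus"
      using m by (intro borel_measurable_times[OF m] borel_measurable_torus)
    have "(\<lambda>x. complex_of_real (\<phi> n (cis x))) \<in> borel_measurable torus" for n
      by (intro borel_measurable_torus borel_measurable_continuous_onI continuous_intros continuous_on_compose2[OF \<phi>c]) auto
    then show "(\<lambda>x. g x * of_real (\<phi> n (cis x))) \<in> borel_measurable torus" for n
      using m by (intro borel_measurable_times) auto
    show "integrable torus (\<lambda>x. cmod (g x))" using gi by simp
    show "AE x in torus. norm (g x * of_real (\<phi> n (cis x))) \<le> cmod (g x)" for n
      using \<phi>b by (auto simp: norm_mult intro!: mult_left_le)
    show "AE x in torus. (\<lambda>n. g x * of_real (\<phi> n (cis x))) \<longlonglongrightarrow> g x * indicator {..b} x"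
      using AE_torus_space
    proof eventually_elim
      case (elim x)
      have "(\<lambda>n. \<phi> n (cis x)) \<longlonglongrightarrow> indicator {..b} x"
      proof (cases "x \<le> b")
        case True
        then have "infdist (cis x) ?C = 0" using cis_in_arc[of x b] elim b by (intro infdist_zero) auto
        then show ?thesis using True by (simp add: \<phi>_def)
      next
        case False
        then have "cis x \<notin> ?C" using cis_in_arc[of x b] elim b by auto
        then have d: "infdist (cis x) ?C > 0" by (rule infdist_pos_not_in_closed[OF C])
        have "\<forall>\<^sub>F n in sequentially. \<phi> n (cis x) = 0"
        proof -
          obtain N :: nat where "1 / infdist (cis x) ?C < real N" using reals_Archimedean2 by blast
          then have N: "1 < real N * infdist (cis x) ?C" using d by (simp add: field_simps)
          have "\<phi> n (cis x) = 0" if "n \<ge> N" for n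
          proof -
            have "real N * infdist (cis x) ?C \<le> real n * infdist (cis x) ?C" using that d by (intro mult_right_mono) auto
            then show ?thesis using N by (simp add: \<phi>_def)
          qed
          then show ?thesis by (auto simp: eventually_sequentially)
        qed
        then show ?thesis using False by (simp add: tendsto_eventually)
      qed
      then have "(\<lambda>n. g x * of_real (\<phi> n (cis x))) \<longlonglongrightarrow> g x * of_real (indicator {..b} x)"
        by (intro tendsto_intros)
      then show ?case by (simp add: indicator_def of_bool_def split: if_splits)
    qed
  qed
  then show ?thesis unfolding z by (simp add: LIMSEQ_const_iff)
qed

text \<open>The positive and negative parts of g are densities of two finite measures. They agree on
  half lines, hence on Borel sets, so g integrates to 0 over each of these.\<close>

lemma spectrum_free_AE_zero:
  fixes g :: "real \<Rightarrow> real"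
  assumes g: "spectrum_free (\<lambda>x. of_real (g x))"
  shows "AE x in torus. g x = 0"
proof -
  have gi: "integrable torus g"
    using integrable_Re[of torus "\<lambda>x. of_real (g x)"] g by (simp add: spectrum_free_def)
  have gm: "g \<in> borel_measurable torus" using gi by auto
  \<comment> \<open>\<open>h 1\<close> is the positive part of g and \<open>h (-1)\<close> the
    negative part; the sign as parameter treats both at once.\<close>
  define h where "h s x = max 0 (s * g x)" for s x :: real
  have hm: "h s \<in> borel_measurable torus" for s unfolding h_def using gm by measurable
  have hi: "integrable torus (h s)" for s
    unfolding h_def using gi by (intro integrable_max) auto
  have h0: "0 \<le> h s x" for s x by (simp add: h_def)
  define \<mu> where "\<mu> s = distr (density torus (\<lambda>x. ennreal (h s x))) borel (\<lambda>x. x)" for s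
  have id: "(\<lambda>x. x) \<in> measurable torus borel" by (intro borel_measurable_torus) simp
  have idD: "(\<lambda>x. x) \<in> measurable (density torus (\<lambda>x. ennreal (h s x))) borel" for s
    using id by simp
  have em: "emeasure (\<mu> s) A = ennreal (LINT x|torus. h s x * indicator A x)" if A: "A \<in> sets borel" for s A
  proof -
    have A': "A \<inter> space torus \<in> sets torus" using measurable_sets[OF id A] by (simp add: vimage_def Int_def)
    have "emeasure (\<mu> s) A = emeasure (density torus (\<lambda>x. ennreal (h s x))) (A \<inter> space torus)"
      unfolding \<mu>_def using A by (subst emeasure_distr[OF idD]) (auto simp: vimage_def Int_def)
    also have "\<dots> = (\<integral>\<^sup>+x. ennreal (h s x) * indicator (A \<inter> space torus) x \<partial>torus)"
      using A' hm by (intro emeasure_density) auto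
    also have "\<dots> = (\<integral>\<^sup>+x. ennreal (h s x * indicator A x) \<partial>torus)"
      by (intro nn_integral_cong) (auto simp: indicator_def)
    also have "\<dots> = ennreal (LINT x|torus. h s x * indicator A x)"
    proof (rule nn_integral_eq_integral)
      have "integrable torus (\<lambda>x. indicator (A \<inter> space torus) x *\<^sub>R h s x)"
        using A' hi by (intro integrable_mult_indicator) auto
      then show "integrable torus (\<lambda>x. h s x * indicator A x)"
        by (rule Bochner_Integration.integrable_cong[THEN iffD1, rotated 2]) (auto simp: indicator_def)
    qed (use h0 in auto)
    finally show ?thesis .
  qed
  have diff: "h 1 x - h (-1) x = g x" for x by (auto simp: h_def)
  have iA: "integrable torus (\<lambda>x. h s x * indicator A x)" if A: "A \<in> sets borel" for s and A
  proof (rule Bochner_Integration.integrable_bound[OF hi[of s]])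
    have "(indicator A :: real \<Rightarrow> real) \<in> borel_measurable borel" using A by measurable
    then show "(\<lambda>x. h s x * indicator A x) \<in> borel_measurable torus" using hm
      by (intro borel_measurable_times[OF hm] borel_measurable_torus)
  qed (auto simp: indicator_def)
  have cI: "(LINT x|torus. g x * indicator {..b} x) = 0" if "0 \<le> b" "b < 2 * pi" for b
  proof -
    have "(LINT x|torus. complex_of_real (g x * indicator {..b} x)) = (LINT x|torus. of_real (g x) * indicator {..b} x)"
      by (intro Bochner_Integration.integral_cong refl) (auto simp: indicator_def)
    then show ?thesis using spectrum_free_interval[OF g that] by (simp only: integral_complex_of_real of_real_eq_0_iff)
  qed
  have tot: "(LINT x|torus. g x) = 0"
  proof -
    have "(LINT x|torus. of_real (g x) * cis (of_int 0 * x)) = 0" using g unfolding spectrum_free_def by blast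
    then show ?thesis by (simp add: integral_complex_of_real)
  qed
  \<comment> \<open>Below the torus the whole integral appears, above it nothing, and in between the
    complement of an initial interval.\<close>
  have ray: "(LINT x|torus. g x * indicator {b<..} x) = 0" for b
  proof -
    consider "b < 0" | "0 \<le> b" "b < 2 * pi" | "2 * pi \<le> b" by linarith
    then show ?thesis
    proof cases
      case 1
      have "(LINT x|torus. g x * indicator {b<..} x) = (LINT x|torus. g x)"
        using 1 by (intro Bochner_Integration.integral_cong refl) (auto simp: space_torus indicator_def)
      then show ?thesis using tot by simp
    next
      case 2
      have "(LINT x|torus. g x * indicator {b<..} x) = (LINT x|torus. g x - g x * indicator {..b} x)"
        by (intro Bochner_Integration.integral_cong refl) (auto simp: indicator_def)
      also have "\<dots> = 0"
      proof (subst Bochner_Integration.integral_diff)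
        have "integrable torus (\<lambda>x. h 1 x * indicator {..b} x - h (-1) x * indicator {..b} x)"
          by (intro Bochner_Integration.integrable_diff iA) auto
        then show "integrable torus (\<lambda>x. g x * indicator {..b} x)" by (simp add: diff flip: left_diff_distrib)
      qed (use gi tot cI[OF 2] in auto)
      finally show ?thesis .
    next
      case 3
      have "(LINT x|torus. g x * indicator {b<..} x) = (LINT x|torus. 0)"
        using 3 by (intro Bochner_Integration.integral_cong refl) (auto simp: space_torus indicator_def)
      then show ?thesis by simp
    qed
  qed
  have split: "(LINT x|torus. h 1 x * indicator A x) - (LINT x|torus. h (-1) x * indicator A x) = (LINT x|torus. g x * indicator A x)"
    if "A \<in> sets borel" for A
    by (subst Bochner_Integration.integral_diff[symmetric]) (auto intro!: iA that simp: diff simp flip: left_diff_distrib)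
  have "\<mu> 1 = \<mu> (-1)"
  proof (rule measure_eqI_lessThan)
    show "emeasure (\<mu> 1) {x<..} = emeasure (\<mu> (- 1)) {x<..}" for x
      using split[of "{x<..}"] ray[of x] by (simp add: em)
    show "emeasure (\<mu> 1) {x<..} < \<infinity>" for x by (simp add: em)
  qed (auto simp: \<mu>_def)
  then have nn: "(LINT x|torus. g x * indicator A x) = 0" if A: "A \<in> sets borel" for A
    using em[OF A, of 1] em[OF A, of "-1"] split[OF A] h0
    by (simp add: ennreal_inj integral_nonneg_AE)
  show ?thesis
  proof (rule torus.density_zero[OF gi])
    fix A assume "A \<in> sets torus"
    then have A: "A \<in> sets borel" unfolding torus_def by (auto simp: sets_restrict_space)
    show "set_lebesgue_integral torus A g = 0"
      unfolding set_lebesgue_integral_def using nn[OF A] by (simp add: mult.commute)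
  qed
qed

lemma continuous_integrable_torus:
  fixes g :: "real \<Rightarrow> 'a :: {banach, second_countable_topology}"
  assumes "continuous_on UNIV g"
  shows "integrable torus g"
  unfolding integrable_torus set_integrable_def
  by (intro borel_integrable_compact continuous_on_subset[OF assms]) auto

lemma integral_torus_HK:
  fixes g :: "real \<Rightarrow> 'a :: euclidean_space"
  assumes "continuous_on UNIV g" "(g has_integral I) {0..0 + 2 * pi}"
  shows "integral\<^sup>L torus g = I"
proof -
  have "set_integrable lborel {0..2 * pi} g"
    using continuous_integrable_torus[OF assms(1)] by (simp add: integrable_torus)
  from set_borel_integral_eq_integral(2)[OF this] show ?thesis
    using integral_unique[OF assms(2)] by (simp add: integral_torus)
qed

section \<open>Square integrable functions and the Cauchy-Schwarz inequality\<close>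

definition square_integrable :: "(real \<Rightarrow> real) \<Rightarrow> bool" where
  "square_integrable g \<longleftrightarrow> g \<in> borel_measurable torus \<and> integrable torus (\<lambda>x. (g x)\<^sup>2)"

lemma square_integrableD:
  assumes "square_integrable g"
  shows "g \<in> borel_measurable torus" "integrable torus (\<lambda>x. (g x)\<^sup>2)" "integrable torus g"
proof -
  show 1: "g \<in> borel_measurable torus" "integrable torus (\<lambda>x. (g x)\<^sup>2)"
    using assms unfolding square_integrable_def by blast+
  show "integrable torus g" using 1 by (rule torus.square_integrable_imp_integrable)
qed

lemma square_integrable_mult:
  assumes "square_integrable f" "square_integrable g"
  shows "integrable torus (\<lambda>x. f x * g x)"
proof (rule Bochner_Integration.integrable_bound[of torus "\<lambda>x. (f x)\<^sup>2 + (g x)\<^sup>2"])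
  show "(\<lambda>x. f x * g x) \<in> borel_measurable torus" using assms by (intro borel_measurable_times square_integrableD(1))
  show "AE x in torus. norm (f x * g x) \<le> norm ((f x)\<^sup>2 + (g x)\<^sup>2)"
  proof (rule AE_I2)
    fix x
    have "2 * \<bar>f x\<bar> * \<bar>g x\<bar> \<le> \<bar>f x\<bar>\<^sup>2 + \<bar>g x\<bar>\<^sup>2" by (rule sum_squares_bound)
    moreover have "0 \<le> \<bar>f x\<bar> * \<bar>g x\<bar>" by simp
    ultimately have "\<bar>f x\<bar> * \<bar>g x\<bar> \<le> (f x)\<^sup>2 + (g x)\<^sup>2" unfolding power2_abs by linarith
    then show "norm (f x * g x) \<le> norm ((f x)\<^sup>2 + (g x)\<^sup>2)" by (simp add: abs_mult)
  qed
qed (use assms in \<open>auto dest: square_integrableD\<close>)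

lemma square_integrable_lincomb:
  assumes f: "square_integrable f" and g: "square_integrable g"
  shows "square_integrable (\<lambda>x. a * f x + b * g x)"
proof -
  have "integrable torus (\<lambda>x. a\<^sup>2 * (f x)\<^sup>2 + 2 * a * b * (f x * g x) + b\<^sup>2 * (g x)\<^sup>2)"
    by (intro Bochner_Integration.integrable_add Bochner_Integration.integrable_mult_right
        square_integrable_mult square_integrableD(2) f g)
  moreover have "(\<lambda>x. a\<^sup>2 * (f x)\<^sup>2 + 2 * a * b * (f x * g x) + b\<^sup>2 * (g x)\<^sup>2) = (\<lambda>x. (a * f x + b * g x)\<^sup>2)"
    by (rule ext) algebra
  ultimately show ?thesis
    using f g by (simp add: square_integrable_def borel_measurable_add borel_measurable_times)
qed

lemma square_integrable_diff:
  "square_integrable f \<Longrightarrow> square_integrable g \<Longrightarrow> square_integrable (\<lambda>x. f x - g x)"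
  using square_integrable_lincomb[of f g 1 "-1"] by simp

lemma square_integrable_add:
  "square_integrable f \<Longrightarrow> square_integrable g \<Longrightarrow> square_integrable (\<lambda>x. f x + g x)"
  using square_integrable_lincomb[of f g 1 1] by simp

lemma square_integral_lincomb:
  assumes f: "square_integrable f" and g: "square_integrable g"
  shows "(LINT x|torus. (a * f x + b * g x)\<^sup>2) =
    a\<^sup>2 * (LINT x|torus. (f x)\<^sup>2) + 2 * a * b * (LINT x|torus. f x * g x) + b\<^sup>2 * (LINT x|torus. (g x)\<^sup>2)"
proof -
  have eq: "(a * f x + b * g x)\<^sup>2 = a\<^sup>2 * (f x)\<^sup>2 + 2 * a * b * (f x * g x) + b\<^sup>2 * (g x)\<^sup>2" for x
    unfolding power2_sum power_mult_distrib by (simp only: ac_simps)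
  note i = square_integrable_mult[OF f g] square_integrableD(2)[OF f] square_integrableD(2)[OF g]
  show ?thesis
    unfolding eq
  proof -
    have "(LINT x|torus. a\<^sup>2 * (f x)\<^sup>2 + 2 * a * b * (f x * g x) + b\<^sup>2 * (g x)\<^sup>2) =
      (LINT x|torus. a\<^sup>2 * (f x)\<^sup>2 + 2 * a * b * (f x * g x)) + (LINT x|torus. b\<^sup>2 * (g x)\<^sup>2)"
      by (rule Bochner_Integration.integral_add) (intro Bochner_Integration.integrable_add Bochner_Integration.integrable_mult_right i)+
    also have "(LINT x|torus. a\<^sup>2 * (f x)\<^sup>2 + 2 * a * b * (f x * g x)) =
      (LINT x|torus. a\<^sup>2 * (f x)\<^sup>2) + (LINT x|torus. 2 * a * b * (f x * g x))"
      by (rule Bochner_Integration.integral_add) (intro Bochner_Integration.integrable_mult_right i)+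
    finally show "(LINT x|torus. a\<^sup>2 * (f x)\<^sup>2 + 2 * a * b * (f x * g x) + b\<^sup>2 * (g x)\<^sup>2) =
      a\<^sup>2 * (LINT x|torus. (f x)\<^sup>2) + 2 * a * b * (LINT x|torus. f x * g x) + b\<^sup>2 * (LINT x|torus. (g x)\<^sup>2)"
      by (simp only: integral_mult_right_zero)
  qed
qed

text \<open>Evaluation at (a, b) = (-Y, X) yields X (XZ - Y^2) >= 0. For X = 0 the form is affine in
  a at b = 1, and boundedness below forces Y = 0.\<close>

lemma quadratic_form_discriminant:
  fixes X Y Z :: real
  assumes q: "\<And>a b. 0 \<le> a\<^sup>2 * X + 2 * a * b * Y + b\<^sup>2 * Z"
  shows "Y\<^sup>2 \<le> X * Z"
proof (cases "X = 0")
  case True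
  have "Y = 0"
  proof (rule ccontr)
    assume Y: "Y \<noteq> 0"
    \<comment> \<open>With this a the form takes the value -1 at (a, 1).\<close>
    define a where "a = - (Z + 1) / (2 * Y)"
    have e: "2 * a * 1 * Y = - (Z + 1)" unfolding a_def using Y by (simp add: field_simps)
    have "0 \<le> a\<^sup>2 * 0 + - (Z + 1) + 1\<^sup>2 * Z" using q[of a 1] by (simp only: e True)
    then show False by simp
  qed
  then show ?thesis using True by simp
next
  case False
  moreover have "0 \<le> 1\<^sup>2 * X + 2 * 1 * 0 * Y + 0\<^sup>2 * Z" by (rule q)
  ultimately have X: "0 < X" by simp
  have "0 \<le> (- Y)\<^sup>2 * X + 2 * (- Y) * X * Y + X\<^sup>2 * Z" by (rule q)
  also have "\<dots> = X * (X * Z - Y\<^sup>2)" by (simp add: power2_eq_square algebra_simps)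
  finally show ?thesis using X by (simp add: zero_le_mult_iff)
qed

lemma Cauchy_Schwarz_torus:
  assumes f: "square_integrable f" and g: "square_integrable g"
  shows "\<bar>LINT x|torus. f x * g x\<bar> \<le> sqrt (LINT x|torus. (f x)\<^sup>2) * sqrt (LINT x|torus. (g x)\<^sup>2)"
proof -
  define X Y Z where "X = (LINT x|torus. (f x)\<^sup>2)" and "Y = (LINT x|torus. f x * g x)" and "Z = (LINT x|torus. (g x)\<^sup>2)"
  have q: "0 \<le> a\<^sup>2 * X + 2 * a * b * Y + b\<^sup>2 * Z" for a b
    unfolding X_def Y_def Z_def square_integral_lincomb[OF f g, of a b, symmetric]
    by (rule Bochner_Integration.integral_nonneg) (rule zero_le_power2)
  have "Y\<^sup>2 \<le> X * Z" using q by (rule quadratic_form_discriminant)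
  then have "\<bar>Y\<bar> \<le> sqrt (X * Z)" by (intro real_le_rsqrt) simp
  then show ?thesis by (simp only: X_def Y_def Z_def real_sqrt_mult)
qed

lemma L1_le_L2:
  assumes f: "square_integrable f"
  shows "(LINT x|torus. \<bar>f x\<bar>) \<le> sqrt (2 * pi) * sqrt (LINT x|torus. (f x)\<^sup>2)"
proof -
  have a: "square_integrable (\<lambda>x. \<bar>f x\<bar>)" using f by (simp add: square_integrable_def borel_measurable_abs)
  have "square_integrable (\<lambda>x. 1)" by (simp add: square_integrable_def)
  from Cauchy_Schwarz_torus[OF a this] show ?thesis
    by (simp add: measure_torus mult.commute)
qed

lemma sqrt_2pi: "sqrt (2 * pi) * sqrt (2 * pi) = 2 * pi"
  by (rule real_sqrt_mult_self[THEN trans]) simp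

section \<open>Fourier coefficients, partial sums and the Parseval identity\<close>

lemma fourier_coeff_torus:
  "fourier_coeff g k = (1 / (2 * pi)) *\<^sub>R (LINT x|torus. of_real (g x) * cis (- (of_int k * x)))"
  by (simp add: fourier_coeff_def integral_torus)

lemma integrable_fourier:
  "square_integrable g \<Longrightarrow> integrable torus (\<lambda>x. complex_of_real (g x) * cis (- (c * x)))"
  using integrable_times_cis[of "\<lambda>x. complex_of_real (g x)" "-c"] square_integrableD(3)[of g] by simp

lemma cmod_fourier_coeff_le:
  assumes g: "square_integrable g"
  shows "cmod (fourier_coeff g k) \<le> sqrt ((LINT x|torus. (g x)\<^sup>2) / (2 * pi))"
proof -
  have "cmod (LINT x|torus. of_real (g x) * cis (- (of_int k * x))) \<le> (LINT x|torus. \<bar>g x\<bar>)"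
    by (rule order_trans[OF integral_norm_bound]) (simp add: norm_mult)
  also note L1_le_L2[OF g]
  finally have "cmod (fourier_coeff g k) \<le> 1 / (2 * pi) * (sqrt (2 * pi) * sqrt (LINT x|torus. (g x)\<^sup>2))"
    unfolding fourier_coeff_torus norm_scaleR by (intro mult_mono) auto
  also have "\<dots> = sqrt (LINT x|torus. (g x)\<^sup>2) / sqrt (2 * pi)"
  proof -
    have "1 / (2 * pi) * (s * X) = X / s" if "s * s = 2 * pi" "0 < s" for s X :: real
      using that by (simp add: field_simps)
    from this[OF sqrt_2pi, of "sqrt (LINT x|torus. (g x)\<^sup>2)"] show ?thesis by simp
  qed
  finally show ?thesis by (simp only: real_sqrt_divide)
qed

lemma fourier_coeff_lincomb:
  assumes f: "square_integrable f" and g: "square_integrable g"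
  shows "fourier_coeff (\<lambda>x. f x - a * g x) k = fourier_coeff f k - of_real a * fourier_coeff g k"
proof -
  have "complex_of_real (f x - a * g x) * cis y = of_real (f x) * cis y - of_real a * (of_real (g x) * cis y)" for x y
    by (simp add: algebra_simps)
  then have "fourier_coeff (\<lambda>x. f x - a * g x) k = (1 / (2 * pi)) *\<^sub>R
     (LINT x|torus. of_real (f x) * cis (- (of_int k * x)) - of_real a * (of_real (g x) * cis (- (of_int k * x))))"
    by (simp only: fourier_coeff_torus)
  also have "\<dots> = fourier_coeff f k - of_real a * fourier_coeff g k"
    using integrable_fourier[OF f] integrable_fourier[OF g]
    by (simp add: fourier_coeff_torus scaleR_diff_right)
  finally show ?thesis .
qed

lemma fourier_coeff_diff:
  "square_integrable f \<Longrightarrow> square_integrable g \<Longrightarrow> fourier_coeff (\<lambda>x. f x - g x) k = fourier_coeff f k - fourier_coeff g k"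
  using fourier_coeff_lincomb[of f g 1] by simp

lemma fourier_coeff_uminus: "fourier_coeff g (- k) = cnj (fourier_coeff g k)"
proof -
  have "cnj (LINT x|torus. of_real (g x) * cis (- (of_int k * x))) = (LINT x|torus. cnj (of_real (g x) * cis (- (of_int k * x))))"
    by (rule integral_bounded_linear'[OF bounded_linear_cnj bounded_linear_cnj, symmetric]) simp
  then show ?thesis by (simp add: fourier_coeff_torus cis_cnj)
qed

definition tsum :: "(int \<Rightarrow> complex) \<Rightarrow> int set \<Rightarrow> real \<Rightarrow> complex" where
  "tsum c K x = (\<Sum>k\<in>K. c k * cis (of_int k * x))"

text \<open>The real part makes this a real function for every c; for hermitian c nothing is lost,
  by \<open>of_real_psum\<close>.\<close>

definition psum :: "(int \<Rightarrow> complex) \<Rightarrow> nat \<Rightarrow> real \<Rightarrow> real" where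
  "psum c N x = Re (tsum c (freqs N) x)"

lemma continuous_on_tsum [continuous_intros]: "continuous_on A (tsum c K)"
  unfolding tsum_def by (intro continuous_intros)

lemma continuous_on_psum [continuous_intros]: "continuous_on A (psum c N)"
  unfolding psum_def by (intro continuous_intros)

lemma psum_measurable [measurable]: "psum c N \<in> borel_measurable borel"
  by (intro borel_measurable_continuous_onI continuous_intros)

lemma square_integrable_psum: "square_integrable (psum c N)"
  unfolding square_integrable_def
  by (intro conjI borel_measurable_torus psum_measurable continuous_integrable_torus continuous_intros)

lemma psum_periodic: "psum c N (x + 2 * pi) = psum c N x"
  by (simp add: psum_def tsum_def cis_int_periodic)

lemma integral_tsum_square:
  assumes "finite K"
  shows "(LINT x|torus. (cmod (tsum c K x))\<^sup>2) = 2 * pi * (\<Sum>k\<in>K. (cmod (c k))\<^sup>2)"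
  by (rule integral_torus_HK) (use trig_parseval[OF assms, of c 0] in \<open>auto simp: tsum_def intro!: continuous_intros\<close>)

definition hermitian :: "(int \<Rightarrow> complex) \<Rightarrow> bool" where
  "hermitian c \<longleftrightarrow> (\<forall>k. c (- k) = cnj (c k))"

lemma hermitian_fourier_coeff: "hermitian (fourier_coeff g)"
  by (simp add: hermitian_def fourier_coeff_uminus)

lemma of_real_psum:
  assumes "hermitian c"
  shows "of_real (psum c N x) = tsum c (freqs N) x"
proof -
  have "cnj (tsum c (freqs N) x) = (\<Sum>k\<in>freqs N. c (- k) * cis (of_int (- k) * x))"
    using assms by (simp add: tsum_def hermitian_def cis_cnj)
  also have "\<dots> = tsum c (freqs N) x"
    unfolding tsum_def by (rule sum.reindex_bij_witness[of _ uminus uminus]) (auto simp: freqs_def)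
  finally show ?thesis by (simp add: psum_def complex_eq_iff)
qed

lemma integral_psum_square:
  assumes "hermitian c"
  shows "(LINT x|torus. (psum c N x)\<^sup>2) = 2 * pi * (\<Sum>k\<in>freqs N. (cmod (c k))\<^sup>2)"
proof -
  have "(psum c N x)\<^sup>2 = (cmod (tsum c (freqs N) x))\<^sup>2" for x
    unfolding of_real_psum[OF assms, symmetric] by simp
  then show ?thesis by (simp add: integral_tsum_square)
qed

lemma integral_psum_diff_square:
  assumes "hermitian c" "N \<le> L"
  shows "(LINT x|torus. (psum c L x - psum c N x)\<^sup>2) =
    2 * pi * ((\<Sum>k\<in>freqs L. (cmod (c k))\<^sup>2) - (\<Sum>k\<in>freqs N. (cmod (c k))\<^sup>2))"
proof -
  have sub: "freqs N \<subseteq> freqs L" using assms by (intro freqs_mono)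
  have "tsum c (freqs L) x - tsum c (freqs N) x = tsum c (freqs L - freqs N) x" for x
    unfolding tsum_def using sub by (simp add: sum_diff)
  then have "(psum c L x - psum c N x)\<^sup>2 = (cmod (tsum c (freqs L - freqs N) x))\<^sup>2" for x
    by (simp flip: of_real_psum[OF assms(1)] of_real_diff) (metis norm_of_real of_real_diff of_real_psum[OF assms(1)] power2_abs)
  then show ?thesis using sub by (simp add: integral_tsum_square sum_diff)
qed

lemma integral_torus_cis: "(LINT x|torus. cis (of_int n * x)) = (if n = 0 then 2 * pi else 0)"
  by (rule integral_torus_HK[OF _ cis_has_integral]) (intro continuous_intros)

lemma fourier_coeff_psum:
  assumes "hermitian c" "k \<in> freqs N"
  shows "fourier_coeff (psum c N) k = c k"
proof -
  have "(LINT x|torus. of_real (psum c N x) * cis (- (of_int k * x))) = (LINT x|torus. (\<Sum>j\<in>freqs N. c j * cis (of_int (j - k) * x)))"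
    unfolding of_real_psum[OF assms(1)] tsum_def sum_distrib_right
    by (intro Bochner_Integration.integral_cong sum.cong refl) (simp add: cis_mult left_diff_distrib mult.assoc)
  also have "\<dots> = (\<Sum>j\<in>freqs N. c j * (LINT x|torus. cis (of_int (j - k) * x)))"
    by (subst Bochner_Integration.integral_sum) (auto intro!: continuous_integrable_torus continuous_intros simp del: of_int_diff)
  also have "\<dots> = (\<Sum>j\<in>freqs N. if j = k then c k * (2 * pi) else 0)"
    unfolding integral_torus_cis by (intro sum.cong refl) auto
  also have "\<dots> = c k * (2 * pi)" using assms(2) by simp
  finally show ?thesis by (simp add: fourier_coeff_torus scaleR_conv_of_real)
qed

lemma integral_mult_psum:
  assumes g: "square_integrable g" and c: "hermitian c"
  shows "(LINT x|torus. g x * psum c N x) = 2 * pi * Re (\<Sum>k\<in>freqs N. c k * cnj (fourier_coeff g k))"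
proof -
  have "complex_of_real (LINT x|torus. g x * psum c N x) = (LINT x|torus. of_real (g x * psum c N x))"
    by (rule integral_complex_of_real[symmetric])
  also have "\<dots> = (LINT x|torus. (\<Sum>k\<in>freqs N. c k * (of_real (g x) * cis (- (of_int (- k) * x)))))"
    by (intro Bochner_Integration.integral_cong refl)
       (simp add: of_real_psum[OF c] tsum_def sum_distrib_left ac_simps)
  also have "\<dots> = (\<Sum>k\<in>freqs N. c k * (LINT x|torus. of_real (g x) * cis (- (of_int (- k) * x))))"
    by (subst Bochner_Integration.integral_sum) (auto intro!: integrable_fourier g simp del: of_int_minus)
  also have "\<dots> = (\<Sum>k\<in>freqs N. of_real (2 * pi) * (c k * cnj (fourier_coeff g k)))"
  proof (intro sum.cong refl)
    fix k
    have "(LINT x|torus. of_real (g x) * cis (- (of_int (- k) * x))) = of_real (2 * pi) * fourier_coeff g (- k)"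
      by (simp add: fourier_coeff_torus scaleR_conv_of_real)
    then show "c k * (LINT x|torus. of_real (g x) * cis (- (of_int (- k) * x))) = of_real (2 * pi) * (c k * cnj (fourier_coeff g k))"
      by (simp only: fourier_coeff_uminus mult.left_commute)
  qed
  also have "\<dots> = of_real (2 * pi) * (\<Sum>k\<in>freqs N. c k * cnj (fourier_coeff g k))"
    by (simp only: sum_distrib_left)
  finally have "Re (complex_of_real (LINT x|torus. g x * psum c N x)) = Re (of_real (2 * pi) * (\<Sum>k\<in>freqs N. c k * cnj (fourier_coeff g k)))"
    by (rule arg_cong)
  then show ?thesis by simp
qed

text \<open>The partial sum is an orthogonal projection: its inner product with g equals its own
  squared norm, so the cross term counts twice against once.\<close>

lemma bessel_identity:
  assumes g: "square_integrable g"
  shows "(LINT x|torus. (g x - psum (fourier_coeff g) N x)\<^sup>2) =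
    (LINT x|torus. (g x)\<^sup>2) - 2 * pi * (\<Sum>k\<in>freqs N. (cmod (fourier_coeff g k))\<^sup>2)"
proof -
  have "Re (\<Sum>k\<in>freqs N. fourier_coeff g k * cnj (fourier_coeff g k)) = (\<Sum>k\<in>freqs N. (cmod (fourier_coeff g k))\<^sup>2)"
    unfolding Re_sum by (intro sum.cong refl) (simp flip: complex_norm_square)
  then have gp: "(LINT x|torus. g x * psum (fourier_coeff g) N x) = 2 * pi * (\<Sum>k\<in>freqs N. (cmod (fourier_coeff g k))\<^sup>2)"
    using integral_mult_psum[OF g hermitian_fourier_coeff[of g], of N] by simp
  show ?thesis
    using square_integral_lincomb[OF g square_integrable_psum[of "fourier_coeff g" N], of 1 "-1"]
    by (simp add: gp integral_psum_square[OF hermitian_fourier_coeff])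
qed

lemma bessel:
  assumes g: "square_integrable g" and F: "finite F"
  shows "(\<Sum>k\<in>F. (cmod (fourier_coeff g k))\<^sup>2) \<le> (LINT x|torus. (g x)\<^sup>2) / (2 * pi)"
proof -
  obtain N where "F \<subseteq> freqs N" using finite_int_bounded[OF F] unfolding freqs_def .
  then have "(\<Sum>k\<in>F. (cmod (fourier_coeff g k))\<^sup>2) \<le> (\<Sum>k\<in>freqs N. (cmod (fourier_coeff g k))\<^sup>2)"
    by (intro sum_mono2) auto
  also have "0 \<le> (LINT x|torus. (g x - psum (fourier_coeff g) N x)\<^sup>2)" by simp
  then have "(\<Sum>k\<in>freqs N. (cmod (fourier_coeff g k))\<^sup>2) \<le> (LINT x|torus. (g x)\<^sup>2) / (2 * pi)"
    unfolding bessel_identity[OF g] by (simp add: field_simps)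
  finally show ?thesis .
qed

text \<open>The partial sums are Cauchy in L^1, a subsequence converges almost everywhere, and the
  Fatou lemma transfers the L^2 distance to the limit. The rate in terms of the tail of c is part of
  the result because \<open>parseval\<close> relies on it.\<close>

theorem Riesz_Fischer:
  assumes c: "hermitian c" and S: "((\<lambda>k. (cmod (c k))\<^sup>2) has_sum S) UNIV"
  obtains h where "periodic_2pi h" "h \<in> borel_measurable borel" "square_integrable h"
    "\<And>k. fourier_coeff h k = c k"
    "\<And>N. (LINT x|torus. (psum c N x - h x)\<^sup>2) \<le> 2 * pi * (S - (\<Sum>k\<in>freqs N. (cmod (c k))\<^sup>2))"
proof -
  define s where "s N = (\<Sum>k\<in>freqs N. (cmod (c k))\<^sup>2)" for N
  have s_le: "s N \<le> S" for N
    unfolding s_def using finite_sum_le_has_sum[OF S, of "freqs N"] by auto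
  have s_mono: "s N \<le> s L" if "N \<le> L" for N L
    unfolding s_def by (rule sum_mono2) (use freqs_mono[OF that] in auto)
  have s_lim: "s \<longlonglongrightarrow> S" unfolding s_def by (rule freqs_tendsto[OF S])
  have dL: "(LINT x|torus. (psum c L x - psum c N x)\<^sup>2) = 2 * pi * (s L - s N)" if "N \<le> L" for N L
    unfolding s_def by (rule integral_psum_diff_square[OF c that])
  have L1: "(LINT x|torus. norm (psum c i x - psum c j x)) \<le> 2 * pi * sqrt (S - s N)" if "N \<le> i" "N \<le> j" for i j N
  proof -
    have *: "(LINT x|torus. norm (psum c i x - psum c j x)) \<le> 2 * pi * sqrt (S - s N)" if ij: "N \<le> j" "j \<le> i" for i j
    proof -
      have "(LINT x|torus. \<bar>psum c i x - psum c j x\<bar>) \<le> sqrt (2 * pi) * sqrt (2 * pi * (s i - s j))"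
        using L1_le_L2[OF square_integrable_diff[OF square_integrable_psum[of c i] square_integrable_psum[of c j]]] dL[OF ij(2)] by simp
      also have "\<dots> \<le> sqrt (2 * pi) * sqrt (2 * pi * (S - s N))"
        using s_le[of i] s_mono[OF ij(1)] by (intro mult_left_mono real_sqrt_le_mono) auto
      also have "\<dots> = 2 * pi * sqrt (S - s N)"
        by (simp only: real_sqrt_mult[of "2 * pi"] sqrt_2pi mult.assoc[symmetric])
      finally show ?thesis by simp
    qed
    show ?thesis
    proof (cases "j \<le> i")
      case True then show ?thesis using * that by blast
    next
      case False
      have "(LINT x|torus. norm (psum c j x - psum c i x)) \<le> 2 * pi * sqrt (S - s N)" using *[of i j] that False by simp
      then show ?thesis by (simp add: abs_minus_commute)
    qed
  qed
  have "\<exists>N. \<forall>i\<ge>N. \<forall>j\<ge>N. (LINT x|torus. norm (psum c i x - psum c j x)) < e" if e: "e > 0" for e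
  proof -
    have "(\<lambda>N. 2 * pi * sqrt (S - s N)) \<longlonglongrightarrow> 2 * pi * sqrt (S - S)" by (intro tendsto_intros s_lim)
    then have "\<forall>\<^sub>F N in sequentially. 2 * pi * sqrt (S - s N) < e" using e by (intro order_tendstoD) auto
    then obtain N where "2 * pi * sqrt (S - s N) < e" by (auto simp: eventually_sequentially)
    then show ?thesis using L1 by (meson le_less_trans)
  qed
  then obtain r where r: "strict_mono r" "AE x in torus. Cauchy (\<lambda>i. psum c (r i) x)"
    using cauchy_L1_AE_cauchy_subseq[of torus "psum c"] square_integrableD(3)[OF square_integrable_psum] by metis
  \<comment> \<open>\<open>lim\<close> is total, so h is periodic and Borel on the whole line,
    including the points where the subsequence diverges.\<close>
  define h where "h x = lim (\<lambda>i. psum c (r i) x)" for x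
  have per: "periodic_2pi h" by (simp add: periodic_2pi_def h_def psum_periodic)
  have meas: "h \<in> borel_measurable borel" unfolding h_def by measurable
  have lim: "AE x in torus. (\<lambda>i. psum c (r i) x) \<longlonglongrightarrow> h x"
    using r(2) unfolding h_def by eventually_elim (simp add: Cauchy_convergent_iff convergent_LIMSEQ_iff)
  have fatou: "(\<integral>\<^sup>+x. ennreal ((psum c N x - h x)\<^sup>2) \<partial>torus) \<le> ennreal (2 * pi * (S - s N))" for N
  proof -
    have "(\<integral>\<^sup>+x. ennreal ((psum c N x - h x)\<^sup>2) \<partial>torus) = (\<integral>\<^sup>+x. liminf (\<lambda>i. ennreal ((psum c N x - psum c (r i) x)\<^sup>2)) \<partial>torus)"
    proof (rule nn_integral_cong_AE)
      show "AE x in torus. ennreal ((psum c N x - h x)\<^sup>2) = liminf (\<lambda>i. ennreal ((psum c N x - psum c (r i) x)\<^sup>2))"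
        using lim
      proof eventually_elim
        case (elim x)
        then have "(\<lambda>i. ennreal ((psum c N x - psum c (r i) x)\<^sup>2)) \<longlonglongrightarrow> ennreal ((psum c N x - h x)\<^sup>2)"
          by (intro tendsto_ennrealI tendsto_intros)
        then show ?case by (rule lim_imp_Liminf[OF trivial_limit_sequentially, symmetric])
      qed
    qed
    also have "\<dots> \<le> liminf (\<lambda>i. \<integral>\<^sup>+x. ennreal ((psum c N x - psum c (r i) x)\<^sup>2) \<partial>torus)"
      by (intro nn_integral_liminf measurable_compose[OF _ measurable_ennreal] borel_measurable_torus) measurable
    also have "\<dots> \<le> ennreal (2 * pi * (S - s N))"
    proof (rule Liminf_le)
      show "\<forall>\<^sub>F i in sequentially. (\<integral>\<^sup>+x. ennreal ((psum c N x - psum c (r i) x)\<^sup>2) \<partial>torus) \<le> ennreal (2 * pi * (S - s N))"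
        using eventually_ge_at_top[of N]
      proof eventually_elim
        case (elim i)
        then have Ni: "N \<le> r i" using seq_suble[OF r(1), of i] by simp
        have "(\<integral>\<^sup>+x. ennreal ((psum c N x - psum c (r i) x)\<^sup>2) \<partial>torus) = ennreal (LINT x|torus. (psum c N x - psum c (r i) x)\<^sup>2)"
          by (intro nn_integral_eq_integral square_integrableD(2) square_integrable_diff square_integrable_psum) auto
        also have "(LINT x|torus. (psum c N x - psum c (r i) x)\<^sup>2) = 2 * pi * (s (r i) - s N)"
          using dL[OF Ni] by (simp add: power2_commute)
        also have "ennreal (2 * pi * (s (r i) - s N)) \<le> ennreal (2 * pi * (S - s N))"
          using s_le[of "r i"] by (intro ennreal_leI mult_left_mono) auto
        finally show ?case .
      qed
    qed simp
    finally show ?thesis .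
  qed
  have dm: "(\<lambda>x. psum c N x - h x) \<in> borel_measurable torus" for N
    using meas by (intro borel_measurable_torus) measurable
  have sd: "square_integrable (\<lambda>x. psum c N x - h x)" for N
    unfolding square_integrable_def
  proof
    show "integrable torus (\<lambda>x. (psum c N x - h x)\<^sup>2)"
    proof (rule integrableI_bounded)
      show "(\<lambda>x. (psum c N x - h x)\<^sup>2) \<in> borel_measurable torus" using dm by measurable
      show "(\<integral>\<^sup>+x. ennreal (norm ((psum c N x - h x)\<^sup>2)) \<partial>torus) < \<infinity>"
        using fatou[of N] by (simp add: le_less_trans)
    qed
  qed (rule dm)
  have est: "(LINT x|torus. (psum c N x - h x)\<^sup>2) \<le> 2 * pi * (S - s N)" for N
  proof -
    have "ennreal (LINT x|torus. (psum c N x - h x)\<^sup>2) \<le> ennreal (2 * pi * (S - s N))"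
      using fatou[of N] nn_integral_eq_integral[OF square_integrableD(2)[OF sd[of N]]] by simp
    then show ?thesis using s_le[of N] by (subst (asm) ennreal_le_iff) auto
  qed
  have sh: "square_integrable h"
    using square_integrable_diff[OF square_integrable_psum[of c 0] sd[of 0]] by simp
  have coeff: "fourier_coeff h k = c k" for k
  proof -
    have "(\<lambda>N. c k - fourier_coeff h k) \<longlonglongrightarrow> 0"
    proof (rule Lim_null_comparison)
      show "(\<lambda>N. sqrt (S - s N)) \<longlonglongrightarrow> 0"
      proof -
        have "(\<lambda>N. sqrt (S - s N)) \<longlonglongrightarrow> sqrt (S - S)" by (intro tendsto_intros s_lim)
        then show ?thesis by simp
      qed
      show "\<forall>\<^sub>F N in sequentially. norm (c k - fourier_coeff h k) \<le> sqrt (S - s N)"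
        using eventually_ge_at_top[of "nat \<bar>k\<bar>"]
      proof eventually_elim
        case (elim N)
        then have "k \<in> freqs N" by (auto simp: freqs_def)
        then have "c k - fourier_coeff h k = fourier_coeff (\<lambda>x. psum c N x - h x) k"
          by (simp add: fourier_coeff_diff[OF square_integrable_psum sh] fourier_coeff_psum[OF c])
        also have "cmod \<dots> \<le> sqrt ((LINT x|torus. (psum c N x - h x)\<^sup>2) / (2 * pi))"
          by (rule cmod_fourier_coeff_le[OF sd])
        also have "\<dots> \<le> sqrt (S - s N)"
          using est[of N] by (intro real_sqrt_le_mono) (simp add: field_simps)
        finally show ?case .
      qed
    qed
    then show ?thesis by (simp add: LIMSEQ_const_iff)
  qed
  show thesis
    by (rule that[OF per meas sh coeff]) (use est in \<open>simp add: s_def\<close>)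
qed

lemma fourier_coeff_eq_AE:
  assumes f: "square_integrable f" and g: "square_integrable g" and eq: "\<And>k. fourier_coeff f k = fourier_coeff g k"
  shows "AE x in torus. f x = g x"
proof -
  let ?d = "\<lambda>x. f x - g x"
  have d: "square_integrable ?d" by (rule square_integrable_diff[OF f g])
  have "spectrum_free (\<lambda>x. of_real (?d x))"
    unfolding spectrum_free_def
  proof (intro conjI allI)
    show "integrable torus (\<lambda>x. complex_of_real (?d x))"
      by (rule integrable_of_real[OF square_integrableD(3)[OF d]])
    fix k :: int
    have "fourier_coeff ?d (- k) = 0" unfolding fourier_coeff_diff[OF f g] eq by simp
    then show "(LINT x|torus. of_real (?d x) * cis (of_int k * x)) = 0"
      by (simp add: fourier_coeff_torus)
  qed
  from spectrum_free_AE_zero[OF this] show ?thesis by simp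
qed

text \<open>The limit h of the partial sums has the coefficients of g, so h = g almost everywhere by
  uniqueness. The estimate of \<open>Riesz_Fischer\<close> at N = 0 then gives one inequality,
  Bessel the other.\<close>

theorem parseval:
  assumes g: "square_integrable g"
  shows "((\<lambda>k. (cmod (fourier_coeff g k))\<^sup>2) has_sum ((LINT x|torus. (g x)\<^sup>2) / (2 * pi))) UNIV"
proof -
  let ?c = "fourier_coeff g" and ?I = "LINT x|torus. (g x)\<^sup>2"
  have "(\<lambda>k. (cmod (?c k))\<^sup>2) summable_on UNIV"
    by (rule nonneg_bdd_above_summable_on) (auto intro!: bdd_aboveI[where M = "?I / (2 * pi)"] bessel[OF g])
  then obtain S where S: "((\<lambda>k. (cmod (?c k))\<^sup>2) has_sum S) UNIV" by (auto simp: summable_on_def)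
  obtain h where "periodic_2pi h" "h \<in> borel_measurable borel" and h: "square_integrable h" "\<And>k. fourier_coeff h k = ?c k"
    "\<And>N. (LINT x|torus. (psum ?c N x - h x)\<^sup>2) \<le> 2 * pi * (S - (\<Sum>k\<in>freqs N. (cmod (?c k))\<^sup>2))"
    by (rule Riesz_Fischer[OF hermitian_fourier_coeff[of g] S]) (rule that)
  have ae: "AE x in torus. h x = g x" by (rule fourier_coeff_eq_AE[OF h(1) g h(2)])
  have le: "?I - 2 * pi * (\<Sum>k\<in>freqs N. (cmod (?c k))\<^sup>2) \<le> 2 * pi * (S - (\<Sum>k\<in>freqs N. (cmod (?c k))\<^sup>2))" for N
  proof -
    have "(LINT x|torus. (g x - psum ?c N x)\<^sup>2) = (LINT x|torus. (psum ?c N x - h x)\<^sup>2)"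
    proof (rule integral_cong_AE)
      show "AE x in torus. (g x - psum ?c N x)\<^sup>2 = (psum ?c N x - h x)\<^sup>2"
        using ae by eventually_elim (simp add: power2_commute)
    qed (use square_integrableD(1)[OF g] square_integrableD(1)[OF h(1)] square_integrableD(1)[OF square_integrable_psum] in measurable)
    then show ?thesis using h(3)[of N] bessel_identity[OF g, of N] by simp
  qed
  have "?I \<le> 2 * pi * S" using le[of 0] by (simp add: right_diff_distrib)
  moreover have "S \<le> ?I / (2 * pi)"
    by (rule has_sum_le_finite_sums[OF S]) (use bessel[OF g] in auto)
  ultimately have "S = ?I / (2 * pi)" by (simp add: field_simps)
  then show ?thesis using S by simp
qed

section \<open>Fourier coefficients of solutions\<close>

lemma L2_torus_iff: "L2_torus g \<longleftrightarrow> periodic_2pi g \<and> g \<in> borel_measurable borel \<and> integrable torus (\<lambda>x. (g x)\<^sup>2)"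
  by (simp add: L2_torus_def integrable_torus)

lemma L2_torus_square_integrable: "L2_torus g \<Longrightarrow> square_integrable g"
  by (simp add: L2_torus_iff square_integrable_def borel_measurable_torus)

lemma L2_norm_torus: "L2_norm g = sqrt (LINT x|torus. (g x)\<^sup>2)"
  by (simp add: L2_norm_def integral_torus)

lemma L2_norm_square: "(L2_norm g)\<^sup>2 = (LINT x|torus. (g x)\<^sup>2)"
  by (simp add: L2_norm_torus)

lemma fourier_coeff_0: "fourier_coeff g 0 = of_real ((LINT x|torus. g x) / (2 * pi))"
  by (simp add: fourier_coeff_torus scaleR_conv_of_real integral_complex_of_real)

lemma L2_mean_zero_iff: "L2_mean_zero g \<longleftrightarrow> L2_torus g \<and> fourier_coeff g 0 = 0"
  by (simp add: L2_mean_zero_def fourier_coeff_0 integral_torus)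

lemma fourier_coeff_cong_AE:
  assumes "AE x in lborel. f x = g x" "f \<in> borel_measurable borel" "g \<in> borel_measurable borel"
  shows "fourier_coeff f k = fourier_coeff g k"
proof -
  have ae: "AE x in torus. f x = g x" using assms(1) by (rule AE_torusI)
  have "(LINT x|torus. complex_of_real (f x) * cis (- (of_int k * x))) = (LINT x|torus. of_real (g x) * cis (- (of_int k * x)))"
  proof (rule integral_cong_AE[rotated 2])
    have "(\<lambda>x. complex_of_real (h x) * cis (- (of_int k * x))) \<in> borel_measurable torus" if "h \<in> borel_measurable borel" for h
    proof (intro borel_measurable_torus borel_measurable_times)
      show "(\<lambda>x. complex_of_real (h x)) \<in> borel_measurable borel" using that by measurable
      show "(\<lambda>x. cis (- (of_int k * x))) \<in> borel_measurable borel"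
        by (intro borel_measurable_continuous_onI continuous_intros)
    qed
    then show "(\<lambda>x. complex_of_real (f x) * cis (- (of_int k * x))) \<in> borel_measurable torus"
      "(\<lambda>x. complex_of_real (g x) * cis (- (of_int k * x))) \<in> borel_measurable torus" using assms(2,3) by blast+
  qed (use ae in \<open>auto elim: eventually_mono\<close>)
  then show ?thesis by (simp add: fourier_coeff_torus)
qed

section \<open>Equations for the Fourier coefficients from the weak formulation\<close>

definition cos_int :: "int \<Rightarrow> (real \<Rightarrow> real) \<Rightarrow> real" where
  "cos_int k g = (LINT x|torus. g x * cos (of_int k * x))"

definition sin_int :: "int \<Rightarrow> (real \<Rightarrow> real) \<Rightarrow> real" where
  "sin_int k g = (LINT x|torus. g x * sin (of_int k * x))"

lemma integrable_times_bounded: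
  fixes g b :: "real \<Rightarrow> real"
  assumes "integrable torus g" "b \<in> borel_measurable borel" "\<And>x. \<bar>b x\<bar> \<le> 1"
  shows "integrable torus (\<lambda>x. g x * b x)"
proof (rule Bochner_Integration.integrable_bound[OF assms(1)])
  show "(\<lambda>x. g x * b x) \<in> borel_measurable torus"
    using assms(1) by (intro borel_measurable_times[OF _ borel_measurable_torus[OF assms(2)]]) auto
  show "AE x in torus. norm (g x * b x) \<le> norm (g x)"
    using assms(3) by (auto simp: abs_mult intro!: mult_left_le)
qed

lemma integrable_cos: "integrable torus g \<Longrightarrow> integrable torus (\<lambda>x. g x * cos (c * x))"
  by (rule integrable_times_bounded) auto

lemma integrable_sin: "integrable torus g \<Longrightarrow> integrable torus (\<lambda>x. g x * sin (c * x))"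
  by (rule integrable_times_bounded) auto

lemma fourier_coeff_cos_sin:
  assumes "integrable torus g"
  shows "fourier_coeff g k = (of_real (cos_int k g) - \<i> * of_real (sin_int k g)) / of_real (2 * pi)"
proof -
  have "(LINT x|torus. of_real (g x) * cis (- (of_int k * x))) =
    (LINT x|torus. of_real (g x * cos (of_int k * x)) - \<i> * of_real (g x * sin (of_int k * x)))"
    by (intro Bochner_Integration.integral_cong refl) (simp add: complex_eq_iff)
  also have "\<dots> = (LINT x|torus. complex_of_real (g x * cos (of_int k * x))) - (LINT x|torus. \<i> * of_real (g x * sin (of_int k * x)))"
    by (rule Bochner_Integration.integral_diff)
       (intro Bochner_Integration.integrable_mult_right integrable_of_real integrable_cos integrable_sin assms)+
  also have "\<dots> = of_real (cos_int k g) - \<i> * of_real (sin_int k g)"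
    by (simp only: integral_mult_right_zero integral_complex_of_real cos_int_def sin_int_def)
  finally show ?thesis by (simp add: fourier_coeff_torus scaleR_conv_of_real)
qed

text \<open>Test functions are real, so a coefficient is assembled from cosine and sine parts. The
  family with fixed l is closed under differentiation, which settles smoothness and the third
  derivative.\<close>

definition trig :: "real \<Rightarrow> real \<Rightarrow> real \<Rightarrow> real \<Rightarrow> real" where
  "trig l a b x = a * cos (l * x) + b * sin (l * x)"

lemma trig_has_derivative: "(trig l a b has_real_derivative trig l (l * b) (- (l * a)) x) (at x)"
  unfolding trig_def by (auto intro!: derivative_eq_intros simp: algebra_simps)

lemma deriv_trig: "deriv (trig l a b) = trig l (l * b) (- (l * a))"
  by (rule ext) (rule DERIV_imp_deriv[OF trig_has_derivative])

lemma test_function_trig: "test_function (trig (of_int k) a b)"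
proof -
  have "\<exists>a' b'. (deriv ^^ n) (trig (of_int k) a b) = trig (of_int k) a' b'" for n
  proof (induction n)
    case 0
    have "(deriv ^^ 0) (trig (of_int k) a b) = trig (of_int k) a b" by simp
    then show ?case by blast
  next
    case (Suc n)
    then obtain a' b' where ab: "(deriv ^^ n) (trig (of_int k) a b) = trig (of_int k) a' b'" by blast
    have "(deriv ^^ Suc n) (trig (of_int k) a b) = deriv ((deriv ^^ n) (trig (of_int k) a b))" by simp
    then show ?case unfolding ab deriv_trig by blast
  qed
  then have "(deriv ^^ n) (trig (of_int k) a b) differentiable (at x)" for n x
    using trig_has_derivative real_differentiable_def by metis
  moreover have "periodic_2pi (trig (of_int k) a b)"
  proof -
    have "cis (of_int k * (x + 2 * pi)) = cis (of_int k * x)" for x by (rule cis_int_periodic)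
    then have "cos (of_int k * (x + 2 * pi)) = cos (of_int k * x)" "sin (of_int k * (x + 2 * pi)) = sin (of_int k * x)" for x
      by (auto simp: complex_eq_iff)
    then show ?thesis by (simp add: periodic_2pi_def trig_def)
  qed
  ultimately show ?thesis by (simp add: test_function_def)
qed

lemma deriv3_trig: "(deriv ^^ 3) (trig l a b) = trig l (- (l ^ 3 * b)) (l ^ 3 * a)"
  by (simp add: numeral_3_eq_3 deriv_trig power3_eq_cube mult.assoc)

text \<open>Testing with cos(kx) and sin(kx) gives the two real parts of the coefficient; the
  derivatives of the test functions recombine to the factors ik^3 and -ik/2.\<close>

lemma weak_kdv_fourier_coeff:
  assumes kdv: "weak_kdv \<gamma> f u" and u: "\<And>t. L2_torus (u t)" and f: "L2_torus f"
  shows "((\<lambda>t. fourier_coeff (u t) k) has_vector_derivative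
    (\<i> * of_int (k ^ 3) * fourier_coeff (u t) k - of_real \<gamma> * fourier_coeff (u t) k
      - \<i> * of_int k / 2 * fourier_coeff (\<lambda>x. (u t x)\<^sup>2) k + fourier_coeff f k)) (at t)"
proof -
  let ?l = "real_of_int k" and ?q = "\<lambda>x. (u t x)\<^sup>2"
  have iu: "integrable torus (u t)" for t by (rule square_integrableD(3)[OF L2_torus_square_integrable[OF u]])
  have iq: "integrable torus ?q" by (rule square_integrableD(2)[OF L2_torus_square_integrable[OF u]])
  have "integrable torus f" by (rule square_integrableD(3)[OF L2_torus_square_integrable[OF f]])
  note i = iu[of t] iq this
  have main: "((\<lambda>r. LINT x|torus. u r x * trig ?l a b x) has_real_derivative
     (a * (?l ^ 3 * sin_int k (u t) - \<gamma> * cos_int k (u t) - ?l / 2 * sin_int k ?q + cos_int k f)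
      + b * (- (?l ^ 3) * cos_int k (u t) - \<gamma> * sin_int k (u t) + ?l / 2 * cos_int k ?q + sin_int k f))) (at t)" for a b
  proof -
    have "((\<lambda>r. LINT x|torus. u r x * trig ?l a b x) has_real_derivative
      (LINT x|torus. u t x * (deriv ^^ 3) (trig ?l a b) x - \<gamma> * u t x * trig ?l a b x + (u t x)\<^sup>2 / 2 * deriv (trig ?l a b) x + f x * trig ?l a b x)) (at t)"
      using kdv test_function_trig[of k a b] unfolding weak_kdv_def integral_torus by blast
    also have "(LINT x|torus. u t x * (deriv ^^ 3) (trig ?l a b) x - \<gamma> * u t x * trig ?l a b x + (u t x)\<^sup>2 / 2 * deriv (trig ?l a b) x + f x * trig ?l a b x)
      = (LINT x|torus. (a * ?l ^ 3 - b * \<gamma>) * (u t x * sin (?l * x)) + ((- b * ?l ^ 3 - a * \<gamma>) * (u t x * cos (?l * x))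
        + (- (a * ?l / 2) * (?q x * sin (?l * x)) + (b * ?l / 2 * (?q x * cos (?l * x))
        + (a * (f x * cos (?l * x)) + b * (f x * sin (?l * x)))))))"
      unfolding deriv3_trig deriv_trig trig_def
      by (intro Bochner_Integration.integral_cong refl) (simp add: field_simps)
    also have "\<dots> = (a * ?l ^ 3 - b * \<gamma>) * sin_int k (u t) + ((- b * ?l ^ 3 - a * \<gamma>) * cos_int k (u t)
        + (- (a * ?l / 2) * sin_int k ?q + (b * ?l / 2 * cos_int k ?q + (a * cos_int k f + b * sin_int k f))))"
      unfolding cos_int_def sin_int_def
      by (subst Bochner_Integration.integral_add;
          (intro Bochner_Integration.integrable_add Bochner_Integration.integrable_mult_right integrable_cos integrable_sin i)?)+
         (simp only: integral_mult_right_zero)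
    also have "\<dots> = a * (?l ^ 3 * sin_int k (u t) - \<gamma> * cos_int k (u t) - ?l / 2 * sin_int k ?q + cos_int k f)
      + b * (- (?l ^ 3) * cos_int k (u t) - \<gamma> * sin_int k (u t) + ?l / 2 * cos_int k ?q + sin_int k f)"
      by (simp add: field_simps)
    finally show ?thesis .
  qed
  have C: "((\<lambda>r. cos_int k (u r)) has_real_derivative (?l ^ 3 * sin_int k (u t) - \<gamma> * cos_int k (u t) - ?l / 2 * sin_int k ?q + cos_int k f)) (at t)"
    using main[of 1 0] by (simp add: trig_def cos_int_def)
  have S: "((\<lambda>r. sin_int k (u r)) has_real_derivative (- (?l ^ 3) * cos_int k (u t) - \<gamma> * sin_int k (u t) + ?l / 2 * cos_int k ?q + sin_int k f)) (at t)"
    using main[of 0 1] by (simp add: trig_def sin_int_def)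
  have "((\<lambda>r. (of_real (cos_int k (u r)) - \<i> * of_real (sin_int k (u r))) / of_real (2 * pi)) has_vector_derivative
    (of_real (?l ^ 3 * sin_int k (u t) - \<gamma> * cos_int k (u t) - ?l / 2 * sin_int k ?q + cos_int k f)
      - \<i> * of_real (- (?l ^ 3) * cos_int k (u t) - \<gamma> * sin_int k (u t) + ?l / 2 * cos_int k ?q + sin_int k f)) / of_real (2 * pi)) (at t)"
    by (intro has_vector_derivative_divide has_vector_derivative_diff has_vector_derivative_mult_right has_vector_derivative_of_real)
       (use C S in \<open>simp_all flip: has_real_derivative_iff_has_vector_derivative\<close>)
  then show ?thesis
    unfolding fourier_coeff_cos_sin[OF iu] fourier_coeff_cos_sin[OF i(2)] fourier_coeff_cos_sin[OF i(3)]
    by (rule back_subst) (simp add: divide_simps, simp add: complex_eq_iff algebra_simps)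
qed

lemma square_integrable_abs: "square_integrable g \<Longrightarrow> square_integrable (\<lambda>x. \<bar>g x\<bar>)"
  by (simp add: square_integrable_def borel_measurable_abs)

text \<open>f^2 - g^2 = d^2 + 2gd with d = f - g. For fixed g the right-hand side tends to 0 with
  the norm of d, which yields continuity in time of the mass and of w.\<close>

lemma square_diff_integral:
  assumes f: "square_integrable f" and g: "square_integrable g"
  shows "(LINT x|torus. \<bar>(f x)\<^sup>2 - (g x)\<^sup>2\<bar>) \<le> (L2_norm (\<lambda>x. f x - g x))\<^sup>2 + 2 * (L2_norm g * L2_norm (\<lambda>x. f x - g x))"
proof -
  let ?d = "\<lambda>x. f x - g x"
  have d: "square_integrable ?d" by (rule square_integrable_diff[OF f g])
  note a = square_integrable_abs
  note i = square_integrableD(2)[OF d] square_integrable_mult[OF a[OF g] a[OF d]]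
  have "(LINT x|torus. \<bar>(f x)\<^sup>2 - (g x)\<^sup>2\<bar>) \<le> (LINT x|torus. (?d x)\<^sup>2 + 2 * (\<bar>g x\<bar> * \<bar>?d x\<bar>))"
  proof (rule integral_mono)
    show "integrable torus (\<lambda>x. \<bar>(f x)\<^sup>2 - (g x)\<^sup>2\<bar>)"
      by (intro Bochner_Integration.integrable_abs Bochner_Integration.integrable_diff square_integrableD(2) f g)
    show "integrable torus (\<lambda>x. (?d x)\<^sup>2 + 2 * (\<bar>g x\<bar> * \<bar>?d x\<bar>))"
      by (intro Bochner_Integration.integrable_add Bochner_Integration.integrable_mult_right i)
    fix x
    have "(f x)\<^sup>2 - (g x)\<^sup>2 = (?d x)\<^sup>2 + 2 * (g x * ?d x)" by (simp add: power2_eq_square algebra_simps)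
    then have "\<bar>(f x)\<^sup>2 - (g x)\<^sup>2\<bar> \<le> \<bar>(?d x)\<^sup>2\<bar> + \<bar>2 * (g x * ?d x)\<bar>" by (simp only: abs_triangle_ineq)
    then show "\<bar>(f x)\<^sup>2 - (g x)\<^sup>2\<bar> \<le> (?d x)\<^sup>2 + 2 * (\<bar>g x\<bar> * \<bar>?d x\<bar>)" by (simp only: abs_mult abs_numeral abs_power2)
  qed
  also have "\<dots> = (LINT x|torus. (?d x)\<^sup>2) + (LINT x|torus. 2 * (\<bar>g x\<bar> * \<bar>?d x\<bar>))"
    by (rule Bochner_Integration.integral_add) (intro Bochner_Integration.integrable_mult_right i)+
  also have "(LINT x|torus. 2 * (\<bar>g x\<bar> * \<bar>?d x\<bar>)) = 2 * (LINT x|torus. \<bar>g x\<bar> * \<bar>?d x\<bar>)"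
    by (rule integral_mult_right_zero)
  also have "(LINT x|torus. \<bar>g x\<bar> * \<bar>?d x\<bar>) \<le> L2_norm g * L2_norm ?d"
    using Cauchy_Schwarz_torus[OF a[OF g] a[OF d]] by (simp only: L2_norm_torus power2_abs)
  finally show ?thesis by (simp add: L2_norm_square)
qed

lemma cmod_fourier_coeff_L1:
  "cmod (fourier_coeff g k) \<le> (LINT x|torus. \<bar>g x\<bar>) / (2 * pi)"
proof -
  have "cmod (LINT x|torus. of_real (g x) * cis (- (of_int k * x))) \<le> (LINT x|torus. \<bar>g x\<bar>)"
    by (rule order_trans[OF integral_norm_bound]) (simp add: norm_mult)
  then show ?thesis by (simp add: fourier_coeff_torus divide_right_mono)
qed

text \<open>The vanishing mean removes the pairs with a zero frequency, so the convolution over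
  \<open>freqs N\<close> reduces to \<open>pairs N k\<close>.\<close>

lemma fourier_coeff_psum_square:
  assumes c: "hermitian c" and c0: "c 0 = 0"
  shows "fourier_coeff (\<lambda>x. (psum c N x)\<^sup>2) k = (\<Sum>p\<in>pairs N k. c p * c (k - p))"
proof -
  have "complex_of_real ((psum c N x)\<^sup>2) * cis (- (of_int k * x)) = (\<Sum>(p, q)\<in>freqs N \<times> freqs N. (c p * c q) * cis (of_int (p + q - k) * x))" for x
  proof -
    have "tsum c (freqs N) x * tsum c (freqs N) x = (\<Sum>(p, q)\<in>freqs N \<times> freqs N. (c p * cis (of_int p * x)) * (c q * cis (of_int q * x)))"
      unfolding tsum_def sum_product sum.cartesian_product ..
    moreover have "(c p * cis (of_int p * x)) * (c q * cis (of_int q * x)) * cis (- (of_int k * x)) = (c p * c q) * cis (of_int (p + q - k) * x)" for p q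
    proof -
      have "cis (of_int (p + q - k) * x) = cis (of_int p * x) * cis (of_int q * x) * cis (- (of_int k * x))"
        by (simp add: cis_mult algebra_simps)
      then show ?thesis by (simp only: ac_simps)
    qed
    ultimately show ?thesis
      unfolding power2_eq_square of_real_mult of_real_psum[OF c] by (simp only: sum_distrib_right split_def)
  qed
  then have "(LINT x|torus. complex_of_real ((psum c N x)\<^sup>2) * cis (- (of_int k * x))) =
    (LINT x|torus. (\<Sum>z\<in>freqs N \<times> freqs N. (c (fst z) * c (snd z)) * cis (of_int (fst z + snd z - k) * x)))"
    by (simp only: split_def)
  also have "\<dots> = (\<Sum>z\<in>freqs N \<times> freqs N. (c (fst z) * c (snd z)) * (LINT x|torus. cis (of_int (fst z + snd z - k) * x)))"
    by (subst Bochner_Integration.integral_sum) (auto intro!: continuous_integrable_torus continuous_intros simp del: of_int_diff of_int_add)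
  also have "\<dots> = (\<Sum>z\<in>freqs N \<times> freqs N. if fst z + snd z = k then of_real (2 * pi) * (c (fst z) * c (snd z)) else 0)"
    unfolding integral_torus_cis by (intro sum.cong refl) auto
  also have "\<dots> = (\<Sum>z\<in>{z \<in> freqs N \<times> freqs N. fst z + snd z = k}. of_real (2 * pi) * (c (fst z) * c (snd z)))"
    by (rule sum.inter_filter[symmetric]) simp
  also have "\<dots> = (\<Sum>p\<in>{p \<in> freqs N. k - p \<in> freqs N}. of_real (2 * pi) * (c p * c (k - p)))"
    by (rule sum.reindex_bij_witness[of _ "\<lambda>p. (p, k - p)" fst]) auto
  also have "\<dots> = (\<Sum>p\<in>pairs N k. of_real (2 * pi) * (c p * c (k - p)))"
  proof (rule sum.mono_neutral_right)
    show "finite {p \<in> freqs N. k - p \<in> freqs N}" by simp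
    show "\<forall>p\<in>{p \<in> freqs N. k - p \<in> freqs N} - pairs N k. of_real (2 * pi) * (c p * c (k - p)) = 0"
    proof
      fix p assume "p \<in> {p \<in> freqs N. k - p \<in> freqs N} - pairs N k"
      then have "p = 0 \<or> k - p = 0" by (auto simp: pairs_def modes_def freqs_def)
      then show "of_real (2 * pi) * (c p * c (k - p)) = 0" using c0 by auto
    qed
  qed (auto simp: pairs_def modes_def freqs_def)
  also have "\<dots> = of_real (2 * pi) * (\<Sum>p\<in>pairs N k. c p * c (k - p))"
    by (simp only: sum_distrib_left)
  finally show ?thesis by (simp add: fourier_coeff_torus scaleR_conv_of_real)
qed

lemma fourier_coeff_diff_L1:
  assumes f: "integrable torus f" and g: "integrable torus g"
  shows "fourier_coeff (\<lambda>x. f x - g x) k = fourier_coeff f k - fourier_coeff g k"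
proof -
  have i: "integrable torus (\<lambda>x. complex_of_real (h x) * cis (- (of_int k * x)))" if "integrable torus h" for h
    using integrable_times_cis[OF integrable_of_real[OF that], of "- of_int k"] by simp
  have "(LINT x|torus. complex_of_real (f x - g x) * cis (- (of_int k * x))) =
    (LINT x|torus. complex_of_real (f x) * cis (- (of_int k * x))) - (LINT x|torus. complex_of_real (g x) * cis (- (of_int k * x)))"
    unfolding Bochner_Integration.integral_diff[OF i[OF f] i[OF g], symmetric] by (simp only: of_real_diff left_diff_distrib)
  then show ?thesis unfolding fourier_coeff_torus by (simp only: scaleR_diff_right)
qed

text \<open>g^2 - S^2 = (g - S)(g + S) for the partial sum S: the norm of g - S is the tail, and
  that of g + S is at most twice the norm of g. The L^1 norm of the product controls all
  coefficients at once, so the bound is uniform in k, as \<open>kdv_modes\<close> demands.\<close>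

lemma square_coeff_approx:
  assumes g: "square_integrable g" and 0: "fourier_coeff g 0 = 0"
  shows "cmod (fourier_coeff (\<lambda>x. (g x)\<^sup>2) k - (\<Sum>p\<in>pairs N k. fourier_coeff g p * fourier_coeff g (k - p)))
    \<le> 2 * sqrt ((LINT x|torus. (g x)\<^sup>2) / (2 * pi)) * sqrt ((LINT x|torus. (g x)\<^sup>2) / (2 * pi) - (\<Sum>k\<in>modes N. (cmod (fourier_coeff g k))\<^sup>2))"
proof -
  let ?c = "fourier_coeff g" and ?I = "LINT x|torus. (g x)\<^sup>2"
  let ?S = "psum ?c N"
  define s where "s = (\<Sum>k\<in>modes N. (cmod (?c k))\<^sup>2)"
  have s: "(\<Sum>k\<in>freqs N. (cmod (?c k))\<^sup>2) = s"
    unfolding s_def by (rule sum_freqs_modes) (simp add: 0)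
  have sS: "square_integrable ?S" by (rule square_integrable_psum)
  have dm: "square_integrable (\<lambda>x. \<bar>g x - ?S x\<bar>)" and dp: "square_integrable (\<lambda>x. \<bar>g x + ?S x\<bar>)"
    by (intro square_integrable_abs square_integrable_diff square_integrable_add g sS)+
  have I1: "(LINT x|torus. (g x - ?S x)\<^sup>2) = 2 * pi * (?I / (2 * pi) - s)"
    using bessel_identity[OF g, of N] by (simp add: s right_diff_distrib)
  have s_le: "2 * pi * s \<le> ?I"
    using bessel[OF g finite_modes, of N] unfolding s_def by (simp add: field_simps)
  have gS: "(LINT x|torus. g x * ?S x) = 2 * pi * s"
  proof -
    have "Re (\<Sum>k\<in>freqs N. ?c k * cnj (?c k)) = s"
      unfolding s[symmetric] Re_sum by (intro sum.cong refl) (simp flip: complex_norm_square)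
    then show ?thesis using integral_mult_psum[OF g hermitian_fourier_coeff[of g], of N] by simp
  qed
  have "(LINT x|torus. (g x + ?S x)\<^sup>2) = ?I + 2 * (2 * pi * s) + 2 * pi * s"
    using square_integral_lincomb[OF g sS, of 1 1] by (simp add: gS integral_psum_square[OF hermitian_fourier_coeff] s)
  also have "\<dots> \<le> 4 * ?I" using s_le by simp
  finally have I2: "(LINT x|torus. (g x + ?S x)\<^sup>2) \<le> 4 * ?I" .
  have "fourier_coeff (\<lambda>x. (g x)\<^sup>2) k - (\<Sum>p\<in>pairs N k. ?c p * ?c (k - p)) = fourier_coeff (\<lambda>x. (g x)\<^sup>2 - (?S x)\<^sup>2) k"
  proof -
    have "fourier_coeff (\<lambda>x. (g x)\<^sup>2 - (?S x)\<^sup>2) k = fourier_coeff (\<lambda>x. (g x)\<^sup>2) k - fourier_coeff (\<lambda>x. (?S x)\<^sup>2) k"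
      by (rule fourier_coeff_diff_L1[OF square_integrableD(2)[OF g] square_integrableD(2)[OF sS]])
    then show ?thesis by (simp only: fourier_coeff_psum_square[where c = ?c, OF hermitian_fourier_coeff 0])
  qed
  also have "cmod \<dots> \<le> (LINT x|torus. \<bar>(g x)\<^sup>2 - (?S x)\<^sup>2\<bar>) / (2 * pi)"
    by (rule cmod_fourier_coeff_L1)
  also have "(LINT x|torus. \<bar>(g x)\<^sup>2 - (?S x)\<^sup>2\<bar>) = (LINT x|torus. \<bar>g x - ?S x\<bar> * \<bar>g x + ?S x\<bar>)"
    by (intro Bochner_Integration.integral_cong refl) (simp add: abs_mult[symmetric] power2_eq_square algebra_simps)
  also have "\<dots> / (2 * pi) \<le> (sqrt (2 * pi * (?I / (2 * pi) - s)) * sqrt (4 * ?I)) / (2 * pi)"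
  proof (rule divide_right_mono)
    have "(LINT x|torus. \<bar>g x - ?S x\<bar> * \<bar>g x + ?S x\<bar>) \<le> sqrt (LINT x|torus. (g x - ?S x)\<^sup>2) * sqrt (LINT x|torus. (g x + ?S x)\<^sup>2)"
      using Cauchy_Schwarz_torus[OF dm dp] unfolding power2_abs by (rule order_trans[OF abs_ge_self])
    also have "\<dots> \<le> sqrt (2 * pi * (?I / (2 * pi) - s)) * sqrt (4 * ?I)"
      unfolding I1 using s_le by (intro mult_left_mono real_sqrt_le_mono I2) (simp add: field_simps)
    finally show "(LINT x|torus. \<bar>g x - ?S x\<bar> * \<bar>g x + ?S x\<bar>) \<le> sqrt (2 * pi * (?I / (2 * pi) - s)) * sqrt (4 * ?I)" .
  qed simp
  also have "\<dots> = 2 * sqrt (?I / (2 * pi)) * sqrt (?I / (2 * pi) - s)"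
  proof -
    have I0: "4 * ?I = 4 * (2 * pi) * (?I / (2 * pi))" by simp
    have "sqrt 4 = (2::real)" by (rule real_sqrt_unique) auto
    then have "sqrt (4 * ?I) = 2 * sqrt (2 * pi) * sqrt (?I / (2 * pi))"
      unfolding I0 real_sqrt_mult[of "4 * (2 * pi)"] real_sqrt_mult[of 4] by simp
    moreover have "(p * y * (2 * p * x)) / q = 2 * x * y" if "p * p = q" "q \<noteq> 0" for p q x y :: real
      using that by (simp add: field_simps)
    ultimately show ?thesis
      using sqrt_2pi by (simp only: real_sqrt_mult[of "2 * pi"]) simp
  qed
  finally show ?thesis unfolding s_def .
qed

text \<open>The division by 2 pi in P and m matches the normalisation of the coefficients, under
  which Parseval carries that factor.\<close>

lemma kdv_solution_modes:
  assumes \<gamma>: "0 < \<gamma>" and f: "L2_mean_zero f" and sol: "kdv_solution \<gamma> f u0 u"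
  shows "kdv_modes \<gamma> ((L2_norm f)\<^sup>2 / (2 * pi)) (fourier_coeff f)
    (\<lambda>k t. osc (k ^ 3) t * fourier_coeff (u t) k)
    (\<lambda>k t. osc (k ^ 3) t * fourier_coeff (\<lambda>x. (u t x)\<^sup>2) k)
    (\<lambda>t. (L2_norm (u t))\<^sup>2 / (2 * pi))"
proof -
  have u: "L2_torus (u t)" and u0: "fourier_coeff (u t) 0 = 0" for t
    using sol by (auto simp: kdv_solution_def L2_mean_zero_iff)
  have ct: "((\<lambda>r. L2_norm (\<lambda>x. u r x - u t x)) \<longlongrightarrow> 0) (at t)" for t
    using sol by (simp add: kdv_solution_def continuous_in_time_def)
  have f2: "L2_torus f" using f by (simp add: L2_mean_zero_def)
  note su = L2_torus_square_integrable[OF u]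
  let ?b = "\<lambda>t r. (L2_norm (\<lambda>x. u r x - u t x))\<^sup>2 + 2 * (L2_norm (u t) * L2_norm (\<lambda>x. u r x - u t x))"
  have b0: "(?b t \<longlongrightarrow> 0) (at t)" for t
  proof -
    have "(?b t \<longlongrightarrow> 0\<^sup>2 + 2 * (L2_norm (u t) * 0)) (at t)" by (intro tendsto_intros ct)
    then show ?thesis by simp
  qed
  show ?thesis
  proof
    show "0 < \<gamma>" by (rule \<gamma>)
    show "osc (0 ^ 3) t * fourier_coeff (u t) 0 = 0" for t by (simp add: u0)
    show "osc ((- k) ^ 3) t * fourier_coeff (u t) (- k) = cnj (osc (k ^ 3) t * fourier_coeff (u t) k)" for k t
      by (simp add: fourier_coeff_uminus osc_def cis_cnj)
    show "((\<lambda>t. osc (k ^ 3) t * fourier_coeff (u t) k) has_vector_derivative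
        osc (k ^ 3) t * fourier_coeff f k - of_real \<gamma> * (osc (k ^ 3) t * fourier_coeff (u t) k)
        - \<i> * of_int k / 2 * (osc (k ^ 3) t * fourier_coeff (\<lambda>x. (u t x)\<^sup>2) k)) (at t)" for k t
    proof -
      have "weak_kdv \<gamma> f u" using sol by (simp add: kdv_solution_def)
      \<comment> \<open>The derivative of \<open>osc (k ^ 3)\<close> cancels the dispersive term
        ik^3.\<close>
      from has_vector_derivative_mult[OF osc_has_vector_derivative[of "k ^ 3" t] weak_kdv_fourier_coeff[OF this u f2, of k t]]
      show ?thesis by (rule back_subst) (simp add: algebra_simps)
    qed
    show "continuous_on UNIV (\<lambda>t. osc (k ^ 3) t * fourier_coeff (\<lambda>x. (u t x)\<^sup>2) k)" for k
    proof -
      have "isCont (\<lambda>t. fourier_coeff (\<lambda>x. (u t x)\<^sup>2) k) t" for t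
        unfolding isCont_def
      proof (rule LIM_zero_cancel, rule Lim_null_comparison)
        show "((\<lambda>r. ?b t r / (2 * pi)) \<longlongrightarrow> 0) (at t)"
          using tendsto_divide[OF b0[of t] tendsto_const[of "2 * pi"]] by simp
        have "cmod (fourier_coeff (\<lambda>x. (u r x)\<^sup>2) k - fourier_coeff (\<lambda>x. (u t x)\<^sup>2) k) \<le> ?b t r / (2 * pi)" for r
        proof -
          have "cmod (fourier_coeff (\<lambda>x. (u r x)\<^sup>2) k - fourier_coeff (\<lambda>x. (u t x)\<^sup>2) k) = cmod (fourier_coeff (\<lambda>x. (u r x)\<^sup>2 - (u t x)\<^sup>2) k)"
            by (simp only: fourier_coeff_diff_L1[OF square_integrableD(2)[OF su] square_integrableD(2)[OF su]])
          also have "\<dots> \<le> (LINT x|torus. \<bar>(u r x)\<^sup>2 - (u t x)\<^sup>2\<bar>) / (2 * pi)" by (rule cmod_fourier_coeff_L1)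
          also have "\<dots> \<le> ?b t r / (2 * pi)" by (intro divide_right_mono square_diff_integral su) simp
          finally show ?thesis .
        qed
        then show "\<forall>\<^sub>F r in at t. norm (fourier_coeff (\<lambda>x. (u r x)\<^sup>2) k - fourier_coeff (\<lambda>x. (u t x)\<^sup>2) k) \<le> ?b t r / (2 * pi)"
          by simp
      qed
      then have "continuous_on UNIV (\<lambda>t. fourier_coeff (\<lambda>x. (u t x)\<^sup>2) k)"
        by (simp add: continuous_at_imp_continuous_on)
      then show ?thesis by (intro continuous_intros)
    qed
    show "((\<lambda>k. (cmod (osc (k ^ 3) t * fourier_coeff (u t) k))\<^sup>2) has_sum (L2_norm (u t))\<^sup>2 / (2 * pi)) UNIV" for t
      using parseval[OF su[of t]] by (simp add: norm_mult L2_norm_square)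
    show "continuous_on UNIV (\<lambda>t. (L2_norm (u t))\<^sup>2 / (2 * pi))"
    proof -
      have "isCont (\<lambda>t. LINT x|torus. (u t x)\<^sup>2) t" for t
        unfolding isCont_def
      proof (rule LIM_zero_cancel, rule Lim_null_comparison[OF _ b0[of t]])
        have "\<bar>(LINT x|torus. (u r x)\<^sup>2) - (LINT x|torus. (u t x)\<^sup>2)\<bar> \<le> ?b t r" for r
        proof -
          have "\<bar>(LINT x|torus. (u r x)\<^sup>2) - (LINT x|torus. (u t x)\<^sup>2)\<bar> = \<bar>LINT x|torus. (u r x)\<^sup>2 - (u t x)\<^sup>2\<bar>"
            by (simp only: Bochner_Integration.integral_diff[OF square_integrableD(2)[OF su] square_integrableD(2)[OF su]])
          also have "\<dots> \<le> (LINT x|torus. \<bar>(u r x)\<^sup>2 - (u t x)\<^sup>2\<bar>)" by (rule integral_abs_bound)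
          also have "\<dots> \<le> ?b t r" by (intro square_diff_integral su)
          finally show ?thesis .
        qed
        then show "\<forall>\<^sub>F r in at t. norm ((LINT x|torus. (u r x)\<^sup>2) - (LINT x|torus. (u t x)\<^sup>2)) \<le> ?b t r"
          by simp
      qed
      then have "continuous_on UNIV (\<lambda>t. LINT x|torus. (u t x)\<^sup>2)"
        by (simp add: continuous_at_imp_continuous_on)
      then show ?thesis unfolding L2_norm_square by (intro continuous_intros) auto
    qed
    show "cmod (osc (k ^ 3) t * fourier_coeff (\<lambda>x. (u t x)\<^sup>2) k - quad N k t (\<lambda>p. osc (p ^ 3) t * fourier_coeff (u t) p))
      \<le> 2 * sqrt ((L2_norm (u t))\<^sup>2 / (2 * pi)) *
         sqrt ((L2_norm (u t))\<^sup>2 / (2 * pi) - (\<Sum>k\<in>modes N. (cmod (osc (k ^ 3) t * fourier_coeff (u t) k))\<^sup>2))" for k t N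
    proof -
      have "quad N k t (\<lambda>p. osc (p ^ 3) t * fourier_coeff (u t) p) = osc (k ^ 3) t * (\<Sum>p\<in>pairs N k. fourier_coeff (u t) p * fourier_coeff (u t) (k - p))"
        unfolding quad_def sum_distrib_left
      proof (intro sum.cong refl)
        fix p
        \<comment> \<open>This is k^3 = 3kp(k-p) + p^3 + (k-p)^3.\<close>
        have "osc (k ^ 3) t = osc (3 * k * p * (k - p)) t * osc (p ^ 3) t * osc ((k - p) ^ 3) t"
          unfolding osc_add by (rule arg_cong[of _ _ "\<lambda>n. osc n t"]) (simp add: power3_eq_cube algebra_simps)
        then show "osc (3 * k * p * (k - p)) t * (osc (p ^ 3) t * fourier_coeff (u t) p * (osc ((k - p) ^ 3) t * fourier_coeff (u t) (k - p)))
          = osc (k ^ 3) t * (fourier_coeff (u t) p * fourier_coeff (u t) (k - p))"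
          by (simp only: ac_simps)
      qed
      then have "cmod (osc (k ^ 3) t * fourier_coeff (\<lambda>x. (u t x)\<^sup>2) k - quad N k t (\<lambda>p. osc (p ^ 3) t * fourier_coeff (u t) p)) =
        cmod (osc (k ^ 3) t * (fourier_coeff (\<lambda>x. (u t x)\<^sup>2) k - (\<Sum>p\<in>pairs N k. fourier_coeff (u t) p * fourier_coeff (u t) (k - p))))"
        by (simp only: right_diff_distrib)
      also have "\<dots> = cmod (fourier_coeff (\<lambda>x. (u t x)\<^sup>2) k - (\<Sum>p\<in>pairs N k. fourier_coeff (u t) p * fourier_coeff (u t) (k - p)))"
        by (simp only: norm_mult cmod_osc mult_1_left)
      also note square_coeff_approx[OF su[of t] u0[of t], of k N]
      finally show ?thesis by (simp only: L2_norm_square norm_mult cmod_osc mult_1_left)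
    qed
    show "cmod (osc (k ^ 3) t * fourier_coeff (\<lambda>x. (u t x)\<^sup>2) k) \<le> (L2_norm (u t))\<^sup>2 / (2 * pi)" for k t
      using cmod_fourier_coeff_L1[of "\<lambda>x. (u t x)\<^sup>2" k] by (simp add: norm_mult L2_norm_square)
    show "l2le (\<lambda>k. cmod (fourier_coeff f k)) ((L2_norm f)\<^sup>2 / (2 * pi))"
      unfolding l2le_def using bessel[OF L2_torus_square_integrable[OF f2]] by (simp add: L2_norm_square)
  qed
qed

section \<open>Bounds for the deviation at positive times and locally in time\<close>

context kdv_modes begin

lemma mass_bounded: "\<exists>M. \<forall>r\<in>{a..b}. m r \<le> M"
proof -
  have "bounded (m ` {a..b})"
    by (intro compact_imp_bounded compact_continuous_image continuous_on_m) simp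
  then obtain M where "\<And>y. y \<in> m ` {a..b} \<Longrightarrow> norm y \<le> M" unfolding bounded_iff by blast
  then have "\<forall>r\<in>{a..b}. m r \<le> M" by (force intro: order_trans[OF abs_ge_self])
  then show ?thesis ..
qed

text \<open>The bound M from compactness of [0, t] is consumed by \<open>energy\<close>; what
  remains depends on the data only and not on t.\<close>

lemma mass_forward:
  assumes t: "0 \<le> t"
  shows "m t \<le> m 0 + P / \<gamma>\<^sup>2"
proof -
  obtain M where M: "\<And>r. r \<in> {0..t} \<Longrightarrow> m r \<le> M" using mass_bounded[of 0 t] by blast
  have "exp (- \<gamma> * (t - 0)) * m 0 \<le> 1 * m 0"
    using t \<gamma>_pos m_nonneg[of 0] by (intro mult_right_mono) auto
  then show ?thesis using energy[OF t M] by simp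
qed

lemma l2le_dev:
  assumes t: "a \<le> t" and M: "\<And>r. r \<in> {a..t} \<Longrightarrow> m r \<le> M"
  shows "l2le (\<lambda>k. \<bar>of_int k\<bar> * cmod (dev a k t)) (sobolev_const \<gamma> P M)"
  unfolding l2le_def
proof (intro allI impI)
  fix F :: "int set" assume F: "finite F"
  have "(\<Sum>k\<in>F. (\<bar>of_int k\<bar> * cmod (dev a k t))\<^sup>2) = (\<Sum>k\<in>F - {0}. (\<bar>of_int k\<bar> * cmod (dev a k t))\<^sup>2)"
    using F by (intro sum.mono_neutral_right) auto
  also have "\<dots> \<le> sobolev_const \<gamma> P M"
    using F by (intro dev_sobolev t M) auto
  finally show "(\<Sum>k\<in>F. (\<bar>of_int k\<bar> * cmod (dev a k t))\<^sup>2) \<le> sobolev_const \<gamma> P M" .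
qed

lemma l2le_dev_forward:
  "0 \<le> t \<Longrightarrow> l2le (\<lambda>k. \<bar>of_int k\<bar> * cmod (dev 0 k t)) (sobolev_const \<gamma> P (m 0 + P / \<gamma>\<^sup>2))"
  by (rule l2le_dev) (auto intro: mass_forward)

text \<open>The deviation from time 0 is expressed by the deviations from time -T, taken at t and at
  0, both of which lie after -T. The bound depends on the mass over [-T, T]; it serves regularity
  and continuity, not the final constant.\<close>

lemma l2le_dev_local:
  assumes T: "0 \<le> T"
  shows "\<exists>B. \<forall>t\<in>{-T..T}. l2le (\<lambda>k. \<bar>of_int k\<bar> * cmod (dev 0 k t)) B"
proof -
  obtain M where M: "\<And>r. r \<in> {-T..T} \<Longrightarrow> m r \<le> M" using mass_bounded[of "-T" T] by blast
  let ?S = "sobolev_const \<gamma> P M"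
  have S: "l2le (\<lambda>k. \<bar>of_int k\<bar> * cmod (dev (-T) k t)) ?S" if "t \<in> {-T..T}" for t
    using that by (intro l2le_dev) (auto intro: M)
  have "l2le (\<lambda>k. \<bar>of_int k\<bar> * cmod (dev 0 k t)) (2 * ?S + 2 * ((exp (\<gamma> * T))\<^sup>2 * ?S))" if t: "t \<in> {-T..T}" for t
  proof (rule l2le_mono[OF l2le_add[OF S[OF t]]])
    show "l2le (\<lambda>k. exp (\<gamma> * T) * (\<bar>of_int k\<bar> * cmod (dev (-T) k 0))) ((exp (\<gamma> * T))\<^sup>2 * ?S)"
      using S[of 0] T unfolding l2le_def
      by (auto simp: power_mult_distrib simp flip: sum_distrib_left intro!: mult_left_mono)
    fix k
    have e: "exp (- \<gamma> * t) * exp (- \<gamma> * T) = exp (- \<gamma> * (t + T))" by (simp add: algebra_simps flip: exp_add)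
    have "dev 0 k t = dev (-T) k t - of_real (exp (- \<gamma> * t)) * dev (-T) k 0"
      unfolding dev_def by (simp add: right_diff_distrib mult.assoc[symmetric] e[simplified] flip: of_real_mult)
    then have "cmod (dev 0 k t) \<le> cmod (dev (-T) k t) + exp (- \<gamma> * t) * cmod (dev (-T) k 0)"
      using norm_triangle_ineq4[of "dev (-T) k t" "of_real (exp (- \<gamma> * t)) * dev (-T) k 0"] by (simp add: norm_mult)
    also have "\<dots> \<le> cmod (dev (-T) k t) + exp (\<gamma> * T) * cmod (dev (-T) k 0)"
    proof -
      have "\<gamma> * (- t) \<le> \<gamma> * T" using t \<gamma>_pos by (intro mult_left_mono) auto
      then show ?thesis by (intro add_left_mono mult_right_mono) auto
    qed
    finally have "\<bar>real_of_int k\<bar> * cmod (dev 0 k t) \<le> \<bar>real_of_int k\<bar> * (cmod (dev (-T) k t) + exp (\<gamma> * T) * cmod (dev (-T) k 0))"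
      by (rule mult_left_mono) simp
    also have "\<dots> = \<bar>of_int k\<bar> * cmod (dev (-T) k t) + exp (\<gamma> * T) * (\<bar>of_int k\<bar> * cmod (dev (-T) k 0))"
      by (simp add: algebra_simps)
    finally show "\<bar>\<bar>real_of_int k\<bar> * cmod (dev 0 k t)\<bar> \<le>
      \<bar>\<bar>of_int k\<bar> * cmod (dev (-T) k t) + exp (\<gamma> * T) * (\<bar>of_int k\<bar> * cmod (dev (-T) k 0))\<bar>"
      by simp
  qed simp
  then show ?thesis by blast
qed

lemma continuous_on_dev: "continuous_on A (dev a k)"
  unfolding dev_def by (intro continuous_intros)

end

lemma powr_le_abs_int:
  assumes "0 < s" "s < 1"
  shows "\<bar>real_of_int k\<bar> powr s \<le> \<bar>of_int k\<bar>"
proof (cases "k = 0")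
  case False
  then have "\<bar>real_of_int k\<bar> powr s \<le> \<bar>real_of_int k\<bar> powr 1"
    using abs_int_ge_1[OF False] assms by (intro powr_mono) auto
  then show ?thesis by simp
qed simp

text \<open>For integers |k|^s <= |k|. The second part leaves L free for the sharper bound that
  splits low from high modes.\<close>

lemma Hs_of_H1:
  assumes s: "0 < s" "s < 1" and B: "l2le (\<lambda>k. \<bar>of_int k\<bar> * cmod (fourier_coeff g k)) B"
  shows "(\<lambda>k::int. (\<bar>of_int k\<bar> powr s * cmod (fourier_coeff g k))\<^sup>2) summable_on UNIV" (is ?S)
    and "\<And>L. (\<And>F. finite F \<Longrightarrow> (\<Sum>k\<in>F. (\<bar>of_int k\<bar> powr s * cmod (fourier_coeff g k))\<^sup>2) \<le> L) \<Longrightarrow> Hs_norm s g \<le> sqrt L"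
    and "Hs_norm s g \<le> sqrt B"
proof -
  have "l2le (\<lambda>k. \<bar>of_int k\<bar> powr s * cmod (fourier_coeff g k)) B"
    by (rule l2le_mono[OF B]) (auto simp: abs_mult intro!: mult_right_mono powr_le_abs_int s)
  then have fin: "(\<Sum>k\<in>F. (\<bar>of_int k\<bar> powr s * cmod (fourier_coeff g k))\<^sup>2) \<le> B" if "finite F" for F
    using that by (rule l2leD)
  show S: ?S
    by (rule nonneg_bdd_above_summable_on) (auto intro!: bdd_aboveI[where M = B] fin)
  show *: "Hs_norm s g \<le> sqrt L" if "\<And>F. finite F \<Longrightarrow> (\<Sum>k\<in>F. (\<bar>of_int k\<bar> powr s * cmod (fourier_coeff g k))\<^sup>2) \<le> L" for L
    unfolding Hs_norm_def by (intro real_sqrt_le_mono infsum_le_finite_sums S that)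
  show "Hs_norm s g \<le> sqrt B" by (rule *[OF fin])
qed

text \<open>On high modes |k|^(2s) = |k|^(2s-2) |k|^2 with 2s - 2 < 0, so an H^1 bound gains a
  negative power of R. This is the interpolation behind continuity for s < 1.\<close>

lemma Hs_norm_split:
  assumes s: "0 < s" "s < 1" and B: "l2le (\<lambda>k. \<bar>of_int k\<bar> * cmod (fourier_coeff g k)) B" and R: "1 \<le> R"
  shows "Hs_norm s g \<le> sqrt ((\<Sum>k\<in>freqs R. (\<bar>of_int k\<bar> powr s * cmod (fourier_coeff g k))\<^sup>2) + real R powr (2 * s - 2) * B)"
proof (rule Hs_of_H1(2)[OF s B])
  fix F :: "int set" assume F: "finite F"
  let ?a = "\<lambda>k. (\<bar>of_int k\<bar> powr s * cmod (fourier_coeff g k))\<^sup>2"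
  have "(\<Sum>k\<in>F. ?a k) = (\<Sum>k\<in>F \<inter> freqs R. ?a k) + (\<Sum>k\<in>F - freqs R. ?a k)"
    by (rule sum.Int_Diff[OF F])
  also have "(\<Sum>k\<in>F \<inter> freqs R. ?a k) \<le> (\<Sum>k\<in>freqs R. ?a k)" by (intro sum_mono2) auto
  also have "(\<Sum>k\<in>F - freqs R. ?a k) \<le> (\<Sum>k\<in>F - freqs R. real R powr (2 * s - 2) * (\<bar>of_int k\<bar> * cmod (fourier_coeff g k))\<^sup>2)"
  proof (intro sum_mono)
    fix k assume "k \<in> F - freqs R"
    then have "int R \<le> \<bar>k\<bar>" by (auto simp: freqs_def)
    then have kR: "real R \<le> \<bar>real_of_int k\<bar>" by linarith
    then have k0: "0 < \<bar>real_of_int k\<bar>" using R by linarith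
    have "(\<bar>real_of_int k\<bar> powr s)\<^sup>2 = \<bar>real_of_int k\<bar> powr (2 * s - 2) * \<bar>real_of_int k\<bar>\<^sup>2"
    proof -
      have "\<bar>real_of_int k\<bar>\<^sup>2 = \<bar>real_of_int k\<bar> powr 2" using k0 by (simp add: powr_numeral)
      moreover have "(\<bar>real_of_int k\<bar> powr s)\<^sup>2 = \<bar>real_of_int k\<bar> powr (2 * s)"
        by (simp add: power2_eq_square flip: powr_add)
      ultimately show ?thesis by (simp only: powr_add[symmetric]) simp
    qed
    also have "\<dots> \<le> real R powr (2 * s - 2) * \<bar>real_of_int k\<bar>\<^sup>2"
      using s R kR by (intro mult_right_mono powr_mono2') auto
    finally show "?a k \<le> real R powr (2 * s - 2) * (\<bar>of_int k\<bar> * cmod (fourier_coeff g k))\<^sup>2"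
      unfolding power_mult_distrib mult.assoc[symmetric] by (intro mult_right_mono) auto
  qed
  also have "\<dots> \<le> real R powr (2 * s - 2) * B"
    unfolding sum_distrib_left[symmetric] using F by (intro mult_left_mono l2leD[OF B]) auto
  finally show "(\<Sum>k\<in>F. ?a k) \<le> (\<Sum>k\<in>freqs R. ?a k) + real R powr (2 * s - 2) * B" by simp
qed

text \<open>The choice in the definition succeeds because \<open>Riesz_Fischer\<close> provides a
  function; the exponent k^3 is odd, so the coefficients stay hermitian.\<close>

lemma airy_flow:
  assumes g: "L2_torus g"
  shows "L2_torus (airy_flow t g)"
    and "fourier_coeff (airy_flow t g) k = cis (of_int (k ^ 3) * t) * fourier_coeff g k"
proof -
  let ?c = "\<lambda>k. cis (of_int (k ^ 3) * t) * fourier_coeff g k"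
  have c: "hermitian ?c"
    by (simp add: hermitian_def fourier_coeff_uminus cis_cnj)
  have S: "((\<lambda>k. (cmod (?c k))\<^sup>2) has_sum ((LINT x|torus. (g x)\<^sup>2) / (2 * pi))) UNIV"
    using parseval[OF L2_torus_square_integrable[OF g]] by (simp add: norm_mult)
  obtain h where h: "periodic_2pi h" "h \<in> borel_measurable borel" "square_integrable h" "\<And>k. fourier_coeff h k = ?c k"
    "\<And>N. (LINT x|torus. (psum ?c N x - h x)\<^sup>2) \<le> 2 * pi * ((LINT x|torus. (g x)\<^sup>2) / (2 * pi) - (\<Sum>k\<in>freqs N. (cmod (?c k))\<^sup>2))"
    by (rule Riesz_Fischer[OF c S]) (rule that)
  have "L2_torus h" using h(1,2) square_integrableD(2)[OF h(3)] by (simp add: L2_torus_iff)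
  then have "\<exists>h. L2_torus h \<and> (\<forall>k. fourier_coeff h k = ?c k)" using h(4) by blast
  from someI_ex[OF this] show "L2_torus (airy_flow t g)"
    and "fourier_coeff (airy_flow t g) k = ?c k"
    unfolding airy_flow_def by blast+
qed

text \<open>The constant is \<open>sobolev_const\<close> at the mass bound of
  \<open>mass_forward\<close>, valid for t \<ge> 0; regularity and continuity at all real times come
  from the local bound.\<close>

theorem theorem1p1:
  fixes s :: real
  assumes "0 < s" and "s < 1"
  shows "\<exists>C :: real \<Rightarrow> real \<Rightarrow> real \<Rightarrow> real.
    \<forall>(\<gamma>::real) f u0 u.
      \<gamma> > 0 \<and> L2_mean_zero f \<and> L2_mean_zero u0 \<and> kdv_solution \<gamma> f u0 u \<longrightarrow>
      (let v = (\<lambda>t x. u t x - exp (- \<gamma> * t) * airy_flow t u0 x) in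
        (\<forall>t. Hs_mean_zero s (v t)) \<and> continuous_in_time (Hs_norm s) v \<and>
        (\<forall>t\<ge>0. Hs_norm s (v t) \<le> C \<gamma> (L2_norm u0) (L2_norm f)))"
proof (intro exI allI impI)
  fix \<gamma> f u0 u
  assume "\<gamma> > 0 \<and> L2_mean_zero f \<and> L2_mean_zero u0 \<and> kdv_solution \<gamma> f u0 u"
  then have \<gamma>: "0 < \<gamma>" and f: "L2_mean_zero f" and u0: "L2_mean_zero u0" and sol: "kdv_solution \<gamma> f u0 u" by auto
  define v where "v = (\<lambda>t x. u t x - exp (- \<gamma> * t) * airy_flow t u0 x)"
  interpret modes: kdv_modes \<gamma> "(L2_norm f)\<^sup>2 / (2 * pi)" "fourier_coeff f"
    "\<lambda>k t. osc (k ^ 3) t * fourier_coeff (u t) k"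
    "\<lambda>k t. osc (k ^ 3) t * fourier_coeff (\<lambda>x. (u t x)\<^sup>2) k"
    "\<lambda>t. (L2_norm (u t))\<^sup>2 / (2 * pi)"
    by (rule kdv_solution_modes[OF \<gamma> f sol])
  have u: "L2_torus (u t)" "fourier_coeff (u t) 0 = 0" for t
    using sol by (auto simp: kdv_solution_def L2_mean_zero_iff)
  have u0': "L2_torus u0" using u0 by (simp add: L2_mean_zero_def)
  have init: "AE x in lborel. u 0 x = u0 x" using sol by (simp add: kdv_solution_def)
  have meas: "u 0 \<in> borel_measurable borel" "u0 \<in> borel_measurable borel"
    using u(1)[of 0] u0' by (auto simp: L2_torus_def)
  \<comment> \<open>u(0) and \<open>u0\<close> agree almost everywhere only, which coefficients and
    norms do not see.\<close>
  have c0: "fourier_coeff u0 k = fourier_coeff (u 0) k" for k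
    using fourier_coeff_cong_AE[OF init meas] by simp
  have n0: "L2_norm (u 0) = L2_norm u0"
  proof -
    have "AE x in torus. u 0 x = u0 x" using init by (rule AE_torusI)
    then have "(LINT x|torus. (u 0 x)\<^sup>2) = (LINT x|torus. (u0 x)\<^sup>2)"
      using meas by (intro integral_cong_AE borel_measurable_power borel_measurable_torus) (auto elim: eventually_mono)
    then show ?thesis by (simp add: L2_norm_torus)
  qed
  have v_L2: "L2_torus (v t)" for t
  proof -
    have a: "L2_torus (airy_flow t u0)" by (rule airy_flow(1)[OF u0'])
    have "square_integrable (\<lambda>x. 1 * u t x + - exp (- \<gamma> * t) * airy_flow t u0 x)"
      by (intro square_integrable_lincomb L2_torus_square_integrable u a)
    then have "square_integrable (v t)" by (simp add: v_def)
    moreover have "periodic_2pi (v t)" using u(1)[of t] a by (simp add: v_def L2_torus_iff periodic_2pi_def)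
    moreover have "v t \<in> borel_measurable borel" using u(1)[of t] a unfolding v_def L2_torus_iff
      by (intro borel_measurable_diff borel_measurable_times borel_measurable_const) auto
    ultimately show ?thesis using square_integrableD(2) by (simp add: L2_torus_iff)
  qed
  \<comment> \<open>Outside the interaction picture the coefficient differs from the deviation by a
    unimodular factor, so all bounds on moduli carry over.\<close>
  have v_coeff: "fourier_coeff (v t) k = osc (- (k ^ 3)) t * modes.dev 0 k t" for t k
  proof -
    have "fourier_coeff (v t) k = fourier_coeff (u t) k - of_real (exp (- \<gamma> * t)) * fourier_coeff (airy_flow t u0) k"
      unfolding v_def
      by (intro fourier_coeff_lincomb L2_torus_square_integrable u airy_flow(1)[OF u0'])
    also have "fourier_coeff (airy_flow t u0) k = osc (- (k ^ 3)) t * fourier_coeff (u 0) k"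
      unfolding airy_flow(2)[OF u0'] c0 by (simp add: osc_def)
    also have "fourier_coeff (u t) k = osc (- (k ^ 3)) t * (osc (k ^ 3) t * fourier_coeff (u t) k)"
      unfolding mult.assoc[symmetric] osc_add by (simp add: osc_def)
    finally show ?thesis
      unfolding modes.dev_def by (simp add: right_diff_distrib osc_def[of _ 0] mult.left_commute)
  qed
  have v_cmod: "cmod (fourier_coeff (v t) k) = cmod (modes.dev 0 k t)" for t k
    by (simp add: v_coeff norm_mult)
  have v_local: "\<exists>B. \<forall>t\<in>{-T..T}. l2le (\<lambda>k. \<bar>of_int k\<bar> * cmod (fourier_coeff (v t) k)) B" if "0 \<le> T" for T
    unfolding v_cmod by (rule modes.l2le_dev_local[OF that])
  have "Hs_mean_zero s (v t)" for t
  proof -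
    obtain B where "l2le (\<lambda>k. \<bar>of_int k\<bar> * cmod (fourier_coeff (v t) k)) B"
      using v_local[of "\<bar>t\<bar>"] by force
    then have "(\<lambda>k::int. (\<bar>of_int k\<bar> powr s * cmod (fourier_coeff (v t) k))\<^sup>2) summable_on UNIV"
      by (rule Hs_of_H1(1)[OF assms])
    moreover have "fourier_coeff (v t) 0 = 0"
      unfolding v_coeff modes.dev_def by (simp add: u)
    ultimately show ?thesis by (simp add: Hs_mean_zero_def L2_mean_zero_iff v_L2)
  qed
  moreover have "continuous_in_time (Hs_norm s) v"
    unfolding continuous_in_time_def
  proof (intro allI tendstoI)
    fix t e :: real assume e: "0 < e"
    obtain B where B: "\<And>r. r \<in> {-(\<bar>t\<bar> + 1)..\<bar>t\<bar> + 1} \<Longrightarrow> l2le (\<lambda>k. \<bar>of_int k\<bar> * cmod (fourier_coeff (v r) k)) B"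
    proof -
      have "0 \<le> \<bar>t\<bar> + 1" by simp
      from v_local[OF this] show thesis using that by blast
    qed
    let ?d = "\<lambda>r x. v r x - v t x"
    have d: "fourier_coeff (?d r) k = fourier_coeff (v r) k - fourier_coeff (v t) k" for r k
      by (intro fourier_coeff_diff L2_torus_square_integrable v_L2)
    have dB: "l2le (\<lambda>k. \<bar>of_int k\<bar> * cmod (fourier_coeff (?d r) k)) (2 * B + 2 * B)" if r: "\<bar>r - t\<bar> < 1" for r
    proof (rule l2le_mono[OF l2le_add[OF B[of r] B[of t]]])
      fix k
      have "\<bar>real_of_int k\<bar> * cmod (fourier_coeff (?d r) k) \<le> \<bar>real_of_int k\<bar> * (cmod (fourier_coeff (v r) k) + cmod (fourier_coeff (v t) k))"
        unfolding d by (intro mult_left_mono norm_triangle_ineq4) auto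
      then show "\<bar>\<bar>real_of_int k\<bar> * cmod (fourier_coeff (?d r) k)\<bar> \<le>
        \<bar>\<bar>of_int k\<bar> * cmod (fourier_coeff (v r) k) + \<bar>of_int k\<bar> * cmod (fourier_coeff (v t) k)\<bar>"
        by (simp add: distrib_left)
    qed (use r in auto)
    \<comment> \<open>The cut-off R is chosen first, with an H^1 bound uniform for |r - t| < 1; the
      finitely many low modes are then continuous in time.\<close>
    have "(\<lambda>R. real R powr (2 * s - 2) * (2 * B + 2 * B)) \<longlonglongrightarrow> 0 * (2 * B + 2 * B)"
      using assms by (intro tendsto_mult tendsto_const tendsto_neg_powr filterlim_real_sequentially) auto
    then have "\<forall>\<^sub>F R in sequentially. real R powr (2 * s - 2) * (2 * B + 2 * B) < e\<^sup>2 / 2"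
      using e by (intro order_tendstoD) auto
    then have "\<forall>\<^sub>F R in sequentially. 1 \<le> R \<and> real R powr (2 * s - 2) * (2 * B + 2 * B) < e\<^sup>2 / 2"
      using eventually_ge_at_top[of 1] by eventually_elim auto
    then obtain R where R: "1 \<le> R" "real R powr (2 * s - 2) * (2 * B + 2 * B) < e\<^sup>2 / 2"
      by (auto simp: eventually_sequentially)
    let ?G = "\<lambda>r. \<Sum>k\<in>freqs R. (\<bar>of_int k\<bar> powr s * cmod (fourier_coeff (?d r) k))\<^sup>2"
    have "((\<lambda>r. fourier_coeff (v r) k) \<longlongrightarrow> fourier_coeff (v t) k) (at t)" for k
    proof -
      have "continuous_on UNIV (\<lambda>r. fourier_coeff (v r) k)"
        unfolding v_coeff by (intro continuous_intros modes.continuous_on_dev)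
      then show ?thesis by (simp add: continuous_on_def)
    qed
    then have "(?G \<longlongrightarrow> (\<Sum>k\<in>freqs R. (\<bar>of_int k\<bar> powr s * cmod (fourier_coeff (v t) k - fourier_coeff (v t) k))\<^sup>2)) (at t)"
      unfolding d by (intro tendsto_intros)
    then have "(?G \<longlongrightarrow> 0) (at t)" by simp
    then have "\<forall>\<^sub>F r in at t. ?G r < e\<^sup>2 / 2" using e by (intro order_tendstoD) auto
    moreover have "\<forall>\<^sub>F r in at t. \<bar>r - t\<bar> < 1"
      by (auto simp: eventually_at dist_real_def intro!: exI[of _ 1])
    ultimately show "\<forall>\<^sub>F r in at t. dist (Hs_norm s (?d r)) 0 < e"
    proof eventually_elim
      case (elim r)
      have "Hs_norm s (?d r) \<le> sqrt (?G r + real R powr (2 * s - 2) * (2 * B + 2 * B))"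
        by (rule Hs_norm_split[OF assms dB[OF elim(2)] R(1)])
      also have "\<dots> < sqrt (e\<^sup>2)" using elim(1) R(2) by (intro real_sqrt_less_mono) simp
      finally have "Hs_norm s (?d r) < e" using e by simp
      moreover have "0 \<le> Hs_norm s (?d r)" unfolding Hs_norm_def by (intro real_sqrt_ge_zero infsum_nonneg) auto
      ultimately show ?case by simp
    qed
  qed
  \<comment> \<open>Here a^2/(2 pi) is the initial mass and b^2/(2 pi) the bound P for the
    forcing.\<close>
  moreover have "Hs_norm s (v t) \<le> (\<lambda>\<gamma> a b. sqrt (sobolev_const \<gamma> (b\<^sup>2 / (2 * pi)) (a\<^sup>2 / (2 * pi) + b\<^sup>2 / (2 * pi) / \<gamma>\<^sup>2))) \<gamma> (L2_norm u0) (L2_norm f)"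
    if "0 \<le> t" for t
    using modes.l2le_dev_forward[OF that] unfolding n0 v_cmod[symmetric] by (intro Hs_of_H1(3)[OF assms])
  ultimately show "let v = (\<lambda>t x. u t x - exp (- \<gamma> * t) * airy_flow t u0 x) in
        (\<forall>t. Hs_mean_zero s (v t)) \<and> continuous_in_time (Hs_norm s) v \<and>
        (\<forall>t\<ge>0. Hs_norm s (v t) \<le> (\<lambda>\<gamma> a b. sqrt (sobolev_const \<gamma> (b\<^sup>2 / (2 * pi)) (a\<^sup>2 / (2 * pi) + b\<^sup>2 / (2 * pi) / \<gamma>\<^sup>2))) \<gamma> (L2_norm u0) (L2_norm f))"
    unfolding v_def[symmetric] Let_def by blast
qed

end
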